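(* Let $G$ be a finite solvable group and let $\chi\in\operatorname{Irr}(G)$. Then \[ \lambda(\chi)\geq \frac12 . \]
   Context: For a finite group $G$, $\operatorname{Irr}(G)$ denotes the set of irreducible complex characters of $G$. For $\chi\in\operatorname{Irr}(G)$ define \[ \lambda(\chi)=\frac{1}{|G|}\bigl|\{g\in G:\chi(g)=0\text{ or }\chi(g)\text{ is a root of unity}\}\bigr| . \] *)

theory Defs
  imports
    "HOL-Algebra.Solvable_Groups"
    "Jordan_Normal_Form.VS_Connect"
begin

text \<open>The codomain is \<open>GL\<^sub>n\<close> over the complex numbers.\<close>

definition complex_rep :: "('a, 'b) monoid_scheme \<Rightarrow> nat \<Rightarrow> ('a \<Rightarrow> complex mat) \<Rightarrow> bool" where
  "complex_rep G n \<rho> \<longleftrightarrow> \<rho> \<in> hom G (units_of (ring_mat TYPE(complex) n ()))"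

definition invariant_subspace ::
    "('a, 'b) monoid_scheme \<Rightarrow> nat \<Rightarrow> ('a \<Rightarrow> complex mat) \<Rightarrow> complex vec set \<Rightarrow> bool" where
  "invariant_subspace G n \<rho> W \<longleftrightarrow>
     subspace class_ring W (module_vec TYPE(complex) n) \<and>
     (\<forall>g\<in>carrier G. \<forall>w\<in>W. \<rho> g *\<^sub>v w \<in> W)"

definition irreducible_rep :: "('a, 'b) monoid_scheme \<Rightarrow> nat \<Rightarrow> ('a \<Rightarrow> complex mat) \<Rightarrow> bool" where
  "irreducible_rep G n \<rho> \<longleftrightarrow>
     complex_rep G n \<rho> \<and> n > 0 \<and>
     (\<forall>W. invariant_subspace G n \<rho> W \<longrightarrow> W = {0\<^sub>v n} \<or> W = carrier_vec n)"

definition mat_trace :: "'a :: comm_monoid_add mat \<Rightarrow> 'a" where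
  "mat_trace A = (\<Sum>i<dim_row A. A $$ (i, i))"

text \<open>Characters are functions on the carrier only; the restriction fixes their values
  outside it, so that \<open>Irr G\<close> contains exactly one function per irreducible character.\<close>

definition rep_character :: "('a, 'b) monoid_scheme \<Rightarrow> ('a \<Rightarrow> complex mat) \<Rightarrow> 'a \<Rightarrow> complex" where
  "rep_character G \<rho> = (\<lambda>g\<in>carrier G. mat_trace (\<rho> g))"

definition Irr :: "('a, 'b) monoid_scheme \<Rightarrow> ('a \<Rightarrow> complex) set" where
  "Irr G = {rep_character G \<rho> | n \<rho>. irreducible_rep G n \<rho>}"

definition is_root_of_unity :: "complex \<Rightarrow> bool" where
  "is_root_of_unity z \<longleftrightarrow> (\<exists>k::nat. k > 0 \<and> z ^ k = 1)"

definition char_lambda :: "('a, 'b) monoid_scheme \<Rightarrow> ('a \<Rightarrow> complex) \<Rightarrow> real" where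
  "char_lambda G \<chi> =
     real (card {g \<in> carrier G. \<chi> g = 0 \<or> is_root_of_unity (\<chi> g)}) / real (card (carrier G))"

end

theory Submission
  imports
    Defs
    "HOL-Number_Theory.Totient"
    "HOL-Algebra.Multiplicative_Group"
    "Jordan_Normal_Form.Spectral_Radius"
    "Jordan_Normal_Form.Schur_Decomposition"
begin

text \<open>The statement that can be proved by induction speaks of cosets.  Let \<open>\<rho>\<close> be a
  representation of a subgroup \<open>H\<close> with character \<open>\<chi>\<close>, let \<open>K\<close> be a solvable subgroup of \<open>H\<close>
  on which \<open>\<rho>\<close> stays irreducible, and let \<open>g \<in> H\<close> normalise \<open>K\<close>.  Then at least half of the
  values \<open>\<chi>(gk)\<close>, \<open>k \<in> K\<close>, are zeros or roots of unity (\<open>half_zero_or_root\<close>).  The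
  theorem is the case \<open>K = H = G\<close>, \<open>g = \<one>\<close>.  The induction is on \<open>|K|\<close>.

  Put \<open>L = K'\<close> and let \<open>D\<close> be generated by \<open>L\<close> and all \<open>(g\<inverse>xg)x\<inverse>\<close> with \<open>x \<in> K\<close>, so that \<open>K/D\<close>
  is the largest quotient of \<open>K/K'\<close> on which \<open>g\<close> acts trivially.

  Suppose \<open>D \<noteq> K\<close>.  Take a maximal proper subgroup \<open>N\<close> of \<open>K\<close> that contains \<open>D\<close>.  Then \<open>K/N\<close>
  is cyclic and \<open>g\<close> acts trivially on it.  Comparing the norm of \<open>\<chi>\<close> on \<open>N\<close> and on \<open>K\<close> gives two
  possibilities.  Either \<open>\<rho>\<close> is irreducible on \<open>N\<close>, and the induction hypothesis holds on
  each coset \<open>gkN\<close>.  Or \<open>\<nu>\<chi> = \<chi>\<close> on \<open>K\<close> for a nontrivial linear character \<open>\<nu>\<close> of \<open>K/N\<close>; then some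
  matrix \<open>T\<close> satisfies \<open>T\<rho>(k)T\<inverse> = \<nu>(k)\<rho>(k)\<close>, and as \<open>\<nu>\<close> is \<open>g\<close>-invariant, Schur's lemma shows
  that \<open>T\<close> commutes with \<open>\<rho>(g)\<close> up to a scalar \<open>c\<close>.  Taking traces, \<open>\<chi>(gk) \<noteq> 0\<close> forces
  \<open>\<nu>(k) = c\<close>, which holds for at most half of \<open>K\<close>.

  Suppose \<open>D = K\<close> and \<open>K \<noteq> 1\<close>.  Conjugation by \<open>K\<close> permutes the cosets of \<open>L\<close> inside \<open>gK\<close>
  transitively, so a class function has the same mean on \<open>gK\<close> as on \<open>gL\<close>; the same holds for
  every \<open>g\<^sup>j\<close> with \<open>j\<close> prime to \<open>|G|\<close>.  In particular \<open>|\<chi>|\<^sup>2\<close> has mean \<open>1\<close> on \<open>g\<^sup>jL\<close>.  Decompose \<open>\<chi>\<close>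
  over \<open>\<langle>g\<rangle>L\<close> and let \<open>\<psi>\<close> be a constituent that does not vanish on \<open>gL\<close>.  Then \<open>\<psi>\<close> is irreducible
  on \<open>L\<close>, so \<open>|\<psi>|\<^sup>2\<close> also has mean \<open>1\<close> on \<open>g\<^sup>jL\<close>.  The mean of \<open>\<chi>\<close> times the conjugate of \<open>\<psi>\<close> over
  \<open>g\<^sup>jL\<close> has the form \<open>f(\<zeta>\<^sup>j)\<close> with an integer polynomial \<open>f\<close> and a root of unity \<open>\<zeta>\<close> that do not
  depend on \<open>j\<close>, and it is at most \<open>1\<close> in absolute value by the Cauchy-Schwarz inequality.  By
  a theorem of Kronecker \<open>f(\<zeta>)\<close> is zero or a root of unity
  (\<open>bounded_conjugates_imp_root_of_unity\<close>).  For some \<open>\<psi>\<close> it is not zero, since these means add up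
  to \<open>1\<close>; then equality holds in Cauchy-Schwarz and \<open>\<chi> = f(\<zeta>)\<psi>\<close> on \<open>gL\<close>.  The induction
  hypothesis for \<open>\<psi>\<close> and \<open>gL\<close> therefore gives the claim for \<open>\<chi>\<close> on \<open>gL\<close>, hence on \<open>gK\<close>.\<close>

section \<open>Algebraic integers in cyclotomic fields\<close>

lemma primitive_root_of_unity_exists:
  assumes "r > 0"
  obtains \<eta> :: complex where "\<And>i. \<eta> ^ i = 1 \<longleftrightarrow> r dvd i" "norm \<eta> = 1"
proof
  let ?\<eta> = "cis (2 * pi / real r)"
  show "norm ?\<eta> = 1" by simp
  show "?\<eta> ^ i = 1 \<longleftrightarrow> r dvd i" for i
  proof -
    have pow: "?\<eta> ^ k = cis (2 * pi * real k / real r)" for k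
      by (simp add: Complex.DeMoivre mult.commute)
    have "?\<eta> ^ i = ?\<eta> ^ (r * (i div r) + i mod r)" by simp
    also have "\<dots> = (?\<eta> ^ r) ^ (i div r) * ?\<eta> ^ (i mod r)"
      by (simp only: power_add power_mult)
    also have "?\<eta> ^ r = 1" using assms by (simp add: pow)
    finally have "?\<eta> ^ i = 1 \<longleftrightarrow> ?\<eta> ^ (i mod r) = ?\<eta> ^ 0" by simp
    also have "\<dots> \<longleftrightarrow> i mod r = 0"
      using bij_betw_roots_unity[OF assms] assms
      unfolding pow bij_betw_def by (intro inj_on_eq_iff[of _ "{..<r}"]) auto
    finally show ?thesis by (simp add: dvd_eq_mod_eq_0)
  qed
qed

lemma sum_powers_root_of_unity:
  fixes w :: complex
  assumes "w ^ m = 1"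
  shows "(\<Sum>i<m. w ^ i) = (if w = 1 then of_nat m else 0)"
  using assms by (auto simp: geometric_sum)

text \<open>The sum over all \<open>j \<le> m\<close> is \<open>0\<close> or \<open>m\<close>.  Sorting it by \<open>gcd j m\<close> leaves, apart from
  the sum in question, sums of the same kind for proper divisors of \<open>m\<close>.\<close>

lemma ramanujan_sum_Ints:
  fixes z :: complex
  assumes "z ^ m = 1" "m > 0"
  shows "(\<Sum>j\<in>totatives m. z ^ j) \<in> \<int>"
  using assms
proof (induction m arbitrary: z rule: less_induct)
  case (less m)
  let ?S = "\<lambda>d. {j \<in> {0<..m}. gcd j m = d}"
  have img: "?S d = (\<lambda>i. i * d) ` totatives (m div d)" if "d dvd m" for d
    using bij_betw_totatives_gcd_eq[OF that \<open>m > 0\<close>] by (simp add: bij_betw_def)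
  have S: "(\<Sum>j\<in>?S d. z ^ j) = (\<Sum>i\<in>totatives (m div d). (z ^ d) ^ i)" if "d dvd m" for d
  proof -
    have "inj_on (\<lambda>i. i * d) (totatives (m div d))"
      using bij_betw_totatives_gcd_eq[OF that \<open>m > 0\<close>] by (simp add: bij_betw_def)
    thus ?thesis
      unfolding img[OF that] by (simp add: sum.reindex power_mult [symmetric] mult.commute)
  qed
  have part: "(\<Sum>j\<in>{0<..m}. z ^ j) = (\<Sum>d | d dvd m. \<Sum>j\<in>?S d. z ^ j)"
    using less.prems(2) by (intro sum.group[symmetric]) auto
  have "(\<Sum>j\<in>{0<..m}. z ^ j) = (\<Sum>j<m. z ^ Suc j)"
    by (rule sum.reindex_bij_witness[of _ Suc "\<lambda>j. j - 1"]) auto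
  also have "\<dots> = z * (\<Sum>j<m. z ^ j)"
    by (simp add: sum_distrib_left)
  also have "\<dots> \<in> \<int>"
    using sum_powers_root_of_unity[OF less.prems(1)] by auto
  finally have total: "(\<Sum>d | d dvd m. \<Sum>j\<in>?S d. z ^ j) \<in> \<int>"
    by (simp add: part)
  have "(\<Sum>d\<in>{d. d dvd m} - {1}. \<Sum>j\<in>?S d. z ^ j) \<in> \<int>"
  proof (rule Ints_sum)
    fix d assume d: "d \<in> {d. d dvd m} - {1}"
    hence "d > 0" using less.prems(2) by (auto intro: Nat.gr0I)
    hence "d \<noteq> 1" "d > 1" "d dvd m" "d \<le> m" using d less.prems(2) by (auto intro: dvd_imp_le)
    hence "m div d < m" "m div d > 0" "(z ^ d) ^ (m div d) = 1"
      using less.prems by (auto simp: div_greater_zero_iff simp flip: power_mult)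
    thus "(\<Sum>j\<in>?S d. z ^ j) \<in> \<int>"
      using less.IH[of "m div d" "z ^ d"] S \<open>d dvd m\<close> by simp
  qed
  moreover have "(\<Sum>d | d dvd m. \<Sum>j\<in>?S d. z ^ j)
      = (\<Sum>j\<in>?S 1. z ^ j) + (\<Sum>d\<in>{d. d dvd m} - {1}. \<Sum>j\<in>?S d. z ^ j)"
    using less.prems(2) by (intro sum.remove) auto
  ultimately have "(\<Sum>j\<in>?S 1. z ^ j) \<in> \<int>"
    using total Ints_diff by fastforce
  thus ?case using S[of 1] by simp
qed

lemma root_of_one_power:
  fixes w :: "'a :: monoid_mult"
  assumes "w ^ m = 1"
  shows "(w ^ e) ^ m = 1"
  unfolding power_mult[symmetric] mult.commute[of e m] unfolding power_mult assms by simp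

lemma coeff_power_Ints:
  fixes f :: "complex poly"
  assumes "\<And>i. poly.coeff f i \<in> \<int>"
  shows "poly.coeff (f ^ k) i \<in> \<int>"
  using assms by (induction k arbitrary: i) (auto simp: Polynomial.coeff_1 Polynomial.coeff_mult)

text \<open>Kronecker's theorem, with \<open>f(\<zeta>\<^sup>j)\<close>, \<open>j\<close> prime to \<open>m\<close>, in the place of the conjugates of \<open>f(\<zeta>)\<close>.
  For each \<open>k\<close> the function that is \<open>f(\<zeta>\<^sup>j)\<^sup>k\<close> at the residues \<open>j\<close> prime to \<open>m\<close> and zero at the others
  has a discrete Fourier transform whose values are integers, by \<open>ramanujan_sum_Ints\<close>, of absolute
  value at most \<open>m\<close>.  There are only finitely many such transforms, so two different powers of
  \<open>f(\<zeta>)\<close> coincide.\<close>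

lemma bounded_conjugates_imp_root_of_unity:
  fixes f :: "complex poly" and \<zeta> :: complex
  defines "F \<equiv> poly f"
  assumes int: "\<And>i. poly.coeff f i \<in> \<int>" and "m > 0" "\<zeta> ^ m = 1" and bound: "\<And>j. coprime j m \<Longrightarrow> norm (F (\<zeta> ^ j)) \<le> 1"
  shows "F \<zeta> = 0 \<or> is_root_of_unity (F \<zeta>)"
proof -
  obtain \<eta> :: complex where \<eta>: "\<And>i. \<eta> ^ i = 1 \<longleftrightarrow> m dvd i" "norm \<eta> = 1"
    using primitive_root_of_unity_exists[OF \<open>m > 0\<close>] by blast
  have \<eta>0: "\<eta> \<noteq> 0" using \<eta>(2) by auto
  have \<eta>m: "\<eta> ^ m = 1" using \<eta>(1) by simp
  \<comment> \<open>\<open>\<eta> ^ (m - i)\<close> is the inverse of \<open>\<eta> ^ i\<close>.\<close>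
  define T where "T k i = (\<Sum>j\<in>totatives m. F (\<zeta> ^ j) ^ k * (\<eta> ^ (m - i)) ^ j)" for k i
  have T_int: "T k i \<in> \<int>" for k i
  proof -
    define c where "c e = poly.coeff (f ^ k) e" for e
    define d where "d = Polynomial.degree (f ^ k)"
    have "F w ^ k = (\<Sum>e\<le>d. c e * w ^ e)" for w
      unfolding F_def c_def d_def poly_power[symmetric] by (rule poly_altdef)
    moreover have "(\<zeta> ^ j) ^ e * (\<eta> ^ (m - i)) ^ j = (\<zeta> ^ e * \<eta> ^ (m - i)) ^ j" for e j
      unfolding power_mult_distrib power_mult[symmetric] mult.commute[of j e] ..
    ultimately have "T k i = (\<Sum>j\<in>totatives m. \<Sum>e\<le>d. c e * (\<zeta> ^ e * \<eta> ^ (m - i)) ^ j)"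
      by (simp add: T_def sum_distrib_right mult.assoc)
    also have "\<dots> = (\<Sum>e\<le>d. c e * (\<Sum>j\<in>totatives m. (\<zeta> ^ e * \<eta> ^ (m - i)) ^ j))"
      by (subst sum.swap) (simp add: sum_distrib_left)
    also have "\<dots> \<in> \<int>"
    proof (intro Ints_sum[of "{..d}"] Ints_mult)
      fix e
      show "c e \<in> \<int>" using coeff_power_Ints[OF int] by (simp add: c_def)
      have "(\<zeta> ^ e) ^ m = 1" "(\<eta> ^ (m - i)) ^ m = 1"
        using \<open>\<zeta> ^ m = 1\<close> \<eta>m by (auto intro: root_of_one_power)
      thus "(\<Sum>j\<in>totatives m. (\<zeta> ^ e * \<eta> ^ (m - i)) ^ j) \<in> \<int>"
        using \<open>m > 0\<close> by (intro ramanujan_sum_Ints) (simp_all add: power_mult_distrib)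
    qed
    finally show ?thesis .
  qed
  have T_bound: "norm (T k i) \<le> real m" for k i
  proof -
    have "norm (T k i) \<le> (\<Sum>j\<in>totatives m. 1)"
      unfolding T_def
    proof (rule sum_norm_le)
      fix j assume "j \<in> totatives m"
      hence "norm (F (\<zeta> ^ j)) \<le> 1" by (intro bound) (auto simp: totatives_def)
      thus "norm (F (\<zeta> ^ j) ^ k * (\<eta> ^ (m - i)) ^ j) \<le> 1"
        using \<eta>(2) by (simp add: norm_mult norm_power power_le_one)
    qed
    also have "\<dots> \<le> real m" using totient_le[of m] by (simp add: totient_def)
    finally show ?thesis .
  qed
  have inversion: "(\<Sum>i<m. \<eta> ^ i * T k i) = of_nat m * F \<zeta> ^ k" for k
  proof -
    have "(\<Sum>i<m. \<eta> ^ i * T k i) = (\<Sum>j\<in>totatives m. F (\<zeta> ^ j) ^ k * (\<Sum>i<m. (\<eta> / \<eta> ^ j) ^ i))"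
    proof -
      have "\<eta> ^ i * (\<eta> ^ (m - i)) ^ j = (\<eta> / \<eta> ^ j) ^ i" if "i < m" for i j
      proof -
        have "\<eta> ^ (m - i) = 1 / \<eta> ^ i"
          using \<eta>m \<eta>0 that by (simp add: power_diff)
        moreover have "(\<eta> ^ i) ^ j = (\<eta> ^ j) ^ i"
          unfolding power_mult[symmetric] mult.commute[of i j] ..
        ultimately show ?thesis by (simp add: power_divide)
      qed
      hence "\<eta> ^ i * T k i = (\<Sum>j\<in>totatives m. F (\<zeta> ^ j) ^ k * (\<eta> / \<eta> ^ j) ^ i)" if "i < m" for i
        using that unfolding T_def sum_distrib_left
        by (intro sum.cong refl) (simp add: mult.left_commute)
      hence "(\<Sum>i<m. \<eta> ^ i * T k i)
          = (\<Sum>i<m. \<Sum>j\<in>totatives m. F (\<zeta> ^ j) ^ k * (\<eta> / \<eta> ^ j) ^ i)" by simp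
      also have "\<dots> = (\<Sum>j\<in>totatives m. \<Sum>i<m. F (\<zeta> ^ j) ^ k * (\<eta> / \<eta> ^ j) ^ i)"
        by (rule sum.swap)
      finally show ?thesis by (simp add: sum_distrib_left)
    qed
    also have "\<dots> = (\<Sum>j\<in>totatives m. if j = 1 then of_nat m * F \<zeta> ^ k else 0)"
    proof (rule sum.cong[OF refl])
      fix j assume j: "j \<in> totatives m"
      hence j': "0 < j" "j \<le> m" by (auto simp: totatives_def)
      have "(\<eta> / \<eta> ^ j) ^ m = 1"
        using \<eta>m root_of_one_power[OF \<eta>m, of j] by (simp add: power_divide)
      moreover have "\<eta> / \<eta> ^ j = 1 \<longleftrightarrow> j = 1"
      proof
        assume "\<eta> / \<eta> ^ j = 1"
        hence "\<eta> ^ (j - 1) = 1" using \<eta>0 j' by (simp add: power_diff field_simps)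
        hence "m dvd j - 1" using \<eta>(1) by simp
        thus "j = 1" using j' by (auto dest: dvd_imp_le)
      qed (use \<eta>0 in auto)
      ultimately show "F (\<zeta> ^ j) ^ k * (\<Sum>i<m. (\<eta> / \<eta> ^ j) ^ i)
          = (if j = 1 then of_nat m * F \<zeta> ^ k else 0)"
        by (simp add: sum_powers_root_of_unity)
    qed
    also have "\<dots> = of_nat m * F \<zeta> ^ k"
      using \<open>m > 0\<close> by (simp add: sum.delta totatives_def)
    finally show ?thesis .
  qed
  \<comment> \<open>Finitely many vectors \<open>V k\<close>, infinitely many exponents \<open>k\<close>.\<close>
  define V where "V k = (\<lambda>i\<in>{..<m}. T k i)" for k
  have "range V \<subseteq> {..<m} \<rightarrow>\<^sub>E of_int ` {- int m..int m}"
  proof (clarify, rule PiE_I)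
    fix k i assume "i \<in> {..<m}"
    obtain t where t: "T k i = of_int t" using T_int[of k i] by (auto elim: Ints_cases)
    have "\<bar>t\<bar> \<le> int m" using T_bound[of k i] t by simp
    thus "V k i \<in> of_int ` {- int m..int m}" using t \<open>i \<in> {..<m}\<close> by (auto simp: V_def abs_le_iff intro!: imageI)
  qed (simp add: V_def)
  hence "finite (range V)" by (rule finite_subset) (intro finite_PiE; simp)
  hence "\<not> inj V" using finite_imageD by fastforce
  then obtain a b where ab: "V a = V b" "a < b"
    unfolding inj_def by (metis linorder_neqE_nat)
  have "T a i = T b i" if "i < m" for i
    using fun_cong[OF ab(1), of i] that by (simp add: V_def)
  hence "of_nat m * F \<zeta> ^ a = of_nat m * F \<zeta> ^ b"
    by (simp flip: inversion)
  hence "F \<zeta> ^ a = F \<zeta> ^ b" using \<open>m > 0\<close> by simp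
  moreover have "F \<zeta> ^ b = F \<zeta> ^ a * F \<zeta> ^ (b - a)"
    using ab(2) by (simp flip: power_add)
  ultimately have "F \<zeta> ^ a * F \<zeta> ^ (b - a) = F \<zeta> ^ a * 1" by simp
  hence "F \<zeta> = 0 \<or> F \<zeta> ^ (b - a) = 1" by auto
  thus ?thesis using ab(2) unfolding is_root_of_unity_def by (metis zero_less_diff)
qed

section \<open>Complex matrices\<close>

lemma index_mult_mat_sum:
  assumes "A \<in> carrier_mat n m" "B \<in> carrier_mat m p" "i < n" "j < p"
  shows "(A * B) $$ (i, j) = (\<Sum>k<m. A $$ (i, k) * B $$ (k, j))"
  using assms by (simp add: scalar_prod_def atLeast0LessThan)

lemma mat_trace_eq: "A \<in> carrier_mat n m \<Longrightarrow> mat_trace A = (\<Sum>i<n. A $$ (i, i))"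
  by (auto simp: mat_trace_def)

lemma mat_trace_mult_commute:
  fixes A :: "'a :: comm_semiring_0 mat"
  assumes "A \<in> carrier_mat n m" "B \<in> carrier_mat m n"
  shows "mat_trace (A * B) = mat_trace (B * A)"
proof -
  have "mat_trace (A * B) = (\<Sum>i<n. \<Sum>k<m. A $$ (i, k) * B $$ (k, i))"
    using assms by (simp add: mat_trace_eq[of _ n n] index_mult_mat_sum[of _ n m _ n] del: index_mult_mat)
  also have "\<dots> = (\<Sum>k<m. \<Sum>i<n. B $$ (k, i) * A $$ (i, k))"
    by (subst sum.swap) (simp add: mult.commute)
  also have "\<dots> = mat_trace (B * A)"
    using assms by (simp add: mat_trace_eq[of _ m m] index_mult_mat_sum[of _ m n _ m] del: index_mult_mat)
  finally show ?thesis .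
qed

lemma mat_trace_one: "mat_trace (1\<^sub>m n :: complex mat) = of_nat n"
  by (simp add: mat_trace_def)

lemma mat_trace_smult:
  fixes A :: "complex mat"
  assumes "A \<in> carrier_mat n n"
  shows "mat_trace (c \<cdot>\<^sub>m A) = c * mat_trace A"
  using assms by (simp add: mat_trace_def sum_distrib_left)

lemma upper_triangular_pow:
  fixes U :: "complex mat"
  assumes U: "U \<in> carrier_mat n n" "upper_triangular U"
  shows "upper_triangular (U ^\<^sub>m k) \<and> (\<forall>i<n. (U ^\<^sub>m k) $$ (i, i) = (U $$ (i, i)) ^ k)"
proof (induction k)
  case 0
  show ?case using U by (auto simp: upper_triangular_def)
next
  case (Suc k)
  have c: "U ^\<^sub>m k \<in> carrier_mat n n" using U by simp
  have entry: "(U ^\<^sub>m k * U) $$ (i, j) = (\<Sum>l<n. if i \<le> l \<and> l \<le> j then (U ^\<^sub>m k) $$ (i, l) * U $$ (l, j) else 0)"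
    if "i < n" "j < n" for i j
    unfolding index_mult_mat_sum[OF c U(1) that]
    using Suc U that by (intro sum.cong) (auto simp: upper_triangular_def)
  show ?case
  proof (intro conjI allI impI upper_triangularI)
    fix i j assume "j < i" "i < dim_row (U ^\<^sub>m Suc k)"
    hence ij: "i < n" "j < n" using U by auto
    show "(U ^\<^sub>m Suc k) $$ (i, j) = 0"
      unfolding pow_mat.simps entry[OF ij] using \<open>j < i\<close> by (intro sum.neutral) auto
  next
    fix i assume "i < n"
    have "(U ^\<^sub>m k * U) $$ (i, i) = (\<Sum>l<n. if l = i then (U ^\<^sub>m k) $$ (i, i) * U $$ (i, i) else 0)"
      unfolding entry[OF \<open>i < n\<close> \<open>i < n\<close>] by (intro sum.cong) auto
    thus "(U ^\<^sub>m Suc k) $$ (i, i) = (U $$ (i, i)) ^ Suc k" using Suc \<open>i < n\<close> by simp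
  qed
qed

lemma mat_mult_inverse_cancel:
  fixes A :: "complex mat"
  assumes "Q * P = 1\<^sub>m n" "Q \<in> carrier_mat n m" "P \<in> carrier_mat m n" "A \<in> carrier_mat n k"
  shows "Q * (P * A) = A"
  using assms by (simp flip: assoc_mult_mat)

lemma mat_trace_similar:
  fixes A :: "complex mat"
  assumes "A \<in> carrier_mat n n" "P \<in> carrier_mat n n" "Q \<in> carrier_mat n n" "Q * P = 1\<^sub>m n"
  shows "mat_trace (P * A * Q) = mat_trace A"
proof -
  have "mat_trace (P * A * Q) = mat_trace (Q * (P * A))"
    using assms by (intro mat_trace_mult_commute[of _ n n]) auto
  also have "Q * (P * A) = A"
    using assms by (intro mat_mult_inverse_cancel[of _ _ n n])
  finally show ?thesis .
qed

text \<open>In a triangular form of \<open>A\<close> the diagonal entries are roots of unity, whose inverses are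
  their conjugates.\<close>

lemma mat_trace_inverse_finite_order:
  fixes A :: "complex mat"
  assumes A: "A \<in> carrier_mat n n" and B: "B \<in> carrier_mat n n" and AB: "A * B = 1\<^sub>m n"
    and m: "A ^\<^sub>m m = 1\<^sub>m n" "m > 0"
  shows "mat_trace B = cnj (mat_trace A)"
proof -
  obtain k where k: "m = Suc k" using m by (cases m) auto
  have "A ^\<^sub>m k = A ^\<^sub>m k * (A * B)" using A AB by simp
  also have "\<dots> = A ^\<^sub>m m * B" using A B by (simp add: k assoc_mult_mat[of _ n n _ n _ n])
  finally have B_eq: "B = A ^\<^sub>m k" using m B by simp
  obtain as where "char_poly A = (\<Prod>a\<leftarrow>as. [:- a, 1:])" using char_poly_factorized[OF A] by blast
  then obtain U where U: "U \<in> carrier_mat n n" "upper_triangular U" and "similar_mat A U"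
    using schur_decomposition_exists[OF A] by blast
  then obtain P Q where sim: "similar_mat_wit A U P Q" by (auto simp: similar_mat_def)
  note PQ = similar_mat_witD2[OF A sim]
  have pow: "A ^\<^sub>m i = P * U ^\<^sub>m i * Q" for i by (rule similar_mat_wit_pow_id[OF sim])
  have trace: "mat_trace (A ^\<^sub>m i) = (\<Sum>j<n. (U $$ (j, j)) ^ i)" for i
  proof -
    have "mat_trace (A ^\<^sub>m i) = mat_trace (U ^\<^sub>m i)"
      unfolding pow using U PQ by (intro mat_trace_similar) auto
    thus ?thesis
      using upper_triangular_pow[OF U, of i] U by (simp add: mat_trace_eq[of _ n n])
  qed
  have "U ^\<^sub>m m = Q * A ^\<^sub>m m * P"
    by (rule similar_mat_wit_pow_id[OF similar_mat_wit_sym[OF sim]])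
  hence "U ^\<^sub>m m = 1\<^sub>m n" using m PQ by simp
  hence root: "(U $$ (j, j)) ^ m = 1" if "j < n" for j
    using upper_triangular_pow[OF U, of m] that by simp
  have "mat_trace B = (\<Sum>j<n. cnj (U $$ (j, j)))"
    unfolding B_eq trace
  proof (rule sum.cong[OF refl])
    fix j assume "j \<in> {..<n}"
    let ?u = "U $$ (j, j)"
    have u: "?u ^ m = 1" using root \<open>j \<in> {..<n}\<close> by simp
    hence "norm ?u = 1" using m by (metis norm_one norm_power norm_ge_zero power_eq_1_iff less_numeral_extra(3))
    hence "?u * cnj ?u = 1" by (simp add: complex_norm_square[symmetric])
    moreover have "?u * ?u ^ k = 1" using u by (simp add: k)
    ultimately have "?u * ?u ^ k = ?u * cnj ?u" by simp
    thus "?u ^ k = cnj ?u" using u m by (metis mult_cancel_left mult_zero_left zero_neq_one \<open>?u * cnj ?u = 1\<close>)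
  qed
  also have "\<dots> = cnj (mat_trace (A ^\<^sub>m 1))"
    unfolding trace by simp
  finally show ?thesis using A by simp
qed

text \<open>Row reduction \<open>P * Y\<close> of a matrix without right inverse ends with a zero row.  Its first \<open>r\<close>
  rows are the nonzero ones; the pivot columns \<open>p i\<close> are unit vectors, so a vanishing product
  \<open>C * (P * Y)\<close> makes the first \<open>r\<close> columns of \<open>C\<close> vanish.\<close>

lemma not_right_invertible_row_reduction:
  fixes Y :: "complex mat"
  assumes Y: "Y \<in> carrier_mat n m" "Y \<noteq> 0\<^sub>m n m" and no_inv: "\<not> (\<exists>Z\<in>carrier_mat m n. Y * Z = 1\<^sub>m n)"
  obtains P Q r p where "P \<in> carrier_mat n n" "Q \<in> carrier_mat n n" "P * Q = 1\<^sub>m n" "Q * P = 1\<^sub>m n"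
    "0 < r" "r < n" "\<And>i j. r \<le> i \<Longrightarrow> i < n \<Longrightarrow> j < m \<Longrightarrow> (P * Y) $$ (i, j) = 0"
    "\<And>i. i < r \<Longrightarrow> p i < m"
    "\<And>i j. i < r \<Longrightarrow> j < n \<Longrightarrow> (P * Y) $$ (j, p i) = (if i = j then 1 else 0)"
proof -
  obtain R B where gj: "gauss_jordan Y (0\<^sub>m n 0) = (R, B)" by force
  have R: "R \<in> carrier_mat n m" using gauss_jordan_carrier[OF Y(1) _ gj, of 0] by auto
  obtain P where P: "P \<in> Units (ring_mat TYPE(complex) n ())" "R = P * Y"
    using gauss_jordan_transform[OF Y(1) _ gj, of 0 "()"] by auto
  then obtain Q where Q: "P \<in> carrier_mat n n" "Q \<in> carrier_mat n n" "P * Q = 1\<^sub>m n" "Q * P = 1\<^sub>m n"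
    by (auto simp: Units_def ring_mat_def)
  have "row_echelon_form R" by (rule gauss_jordan_row_echelon[OF Y(1) gj])
  then obtain p where "pivot_fun R p m" using R by (auto simp: row_echelon_form_def)
  note p = pivot_funD[OF _ this, of n]
  have dimR: "dim_row R = n" using R by auto
  define r where "r = (LEAST i. i = n \<or> p i = m)"
  have r: "r = n \<or> p r = m" unfolding r_def by (rule LeastI[of _ n]) simp
  have "r \<le> n" unfolding r_def by (rule Least_le) simp
  have below: "p i < m" if "i < r" for i
  proof -
    have "i \<noteq> n \<and> p i \<noteq> m" using not_less_Least[of i "\<lambda>i. i = n \<or> p i = m"] that by (simp add: r_def)
    thus ?thesis using p(1)[OF dimR, of i] that \<open>r \<le> n\<close> by simp
  qed
  have above: "p i = m" if "r \<le> i" "i < n" for i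
    using that
  proof (induction i rule: dec_induct)
    case base
    thus ?case using r by auto
  next
    case (step i)
    thus ?case using p(1)[OF dimR, of "Suc i"] p(3)[OF dimR, of i] by auto
  qed
  have zero: "R $$ (i, j) = 0" if "r \<le> i" "i < n" "j < m" for i j
    using p(2)[OF dimR, of i j] above that by simp
  have unit: "R $$ (j, p i) = (if i = j then 1 else 0)" if "i < r" "j < n" for i j
    using p(4)[OF dimR, of i] p(5)[OF dimR, of i j] below that \<open>r \<le> n\<close> by auto
  have r0: "0 < r"
  proof (rule ccontr)
    assume "\<not> r > 0"
    hence "R = 0\<^sub>m n m" using zero R by (intro eq_matI) auto
    hence "Q * (P * Y) = 0\<^sub>m n m" using P Q by simp
    moreover have "Q * (P * Y) = Y" using Q Y by (intro mat_mult_inverse_cancel[of _ _ n n])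
    ultimately show False using Y by simp
  qed
  have rn: "r < n"
  proof (rule ccontr)
    assume "\<not> r < n"
    hence r_eq: "r = n" using \<open>r \<le> n\<close> by simp
    \<comment> \<open>\<open>S\<close> selects the pivot columns; if every row had a pivot, \<open>S * P\<close> would be a right inverse.\<close>
    define S where "S = mat m n (\<lambda>(a, b). if a = p b then 1 else 0 :: complex)"
    have S: "S \<in> carrier_mat m n" by (simp add: S_def)
    have "R * S = 1\<^sub>m n"
    proof (rule eq_matI)
      fix i j assume ij: "i < dim_row (1\<^sub>m n :: complex mat)" "j < dim_col (1\<^sub>m n :: complex mat)"
      hence "(R * S) $$ (i, j) = (\<Sum>k<m. if k = p j then R $$ (i, k) else 0)"
        unfolding index_mult_mat_sum[OF R S ij[simplified]]
        using ij by (intro sum.cong) (auto simp: S_def)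
      thus "(R * S) $$ (i, j) = 1\<^sub>m n $$ (i, j)"
        using ij below[of j] unit[of j i] r_eq by (simp add: sum.delta')
    qed (use R S in auto)
    hence "P * (Y * S) = 1\<^sub>m n"
      unfolding P(2) assoc_mult_mat[OF Q(1) Y(1) S] .
    hence "(Y * S) * P = 1\<^sub>m n" using mat_mult_left_right_inverse[OF Q(1) mult_carrier_mat[OF Y(1) S]] by blast
    hence "Y * (S * P) = 1\<^sub>m n" unfolding assoc_mult_mat[OF Y(1) S Q(1)] .
    thus False using no_inv S Q by (meson mult_carrier_mat)
  qed
  show ?thesis
    using that[OF Q r0 rn, of p] zero below unit unfolding P(2) by simp
qed

section \<open>Irreducibility and Schur's lemma\<close>

text \<open>The domain is a subset of the group rather than its carrier, so that restriction to a
  subgroup changes neither the group nor \<open>\<rho>\<close>.\<close>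

definition matrix_rep :: "('a, 'b) monoid_scheme \<Rightarrow> 'a set \<Rightarrow> nat \<Rightarrow> ('a \<Rightarrow> complex mat) \<Rightarrow> bool" where
  "matrix_rep G H n \<rho> \<longleftrightarrow>
     (\<forall>x\<in>H. \<rho> x \<in> carrier_mat n n) \<and> \<rho> \<one>\<^bsub>G\<^esub> = 1\<^sub>m n \<and>
     (\<forall>x\<in>H. \<forall>y\<in>H. \<rho> (x \<otimes>\<^bsub>G\<^esub> y) = \<rho> x * \<rho> y)"

text \<open>The equations \<open>\<rho> h * Y = Y * S h\<close> say that the column space of \<open>Y\<close> is invariant.  Hence
  this is irreducibility with invariant subspaces given by spanning columns: such a column space is
  zero or the whole space.\<close>

definition irreducible_on :: "'a set \<Rightarrow> nat \<Rightarrow> ('a \<Rightarrow> complex mat) \<Rightarrow> bool" where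
  "irreducible_on H n \<rho> \<longleftrightarrow> n > 0 \<and>
     (\<forall>m Y S. Y \<in> carrier_mat n m \<longrightarrow> (\<forall>h\<in>H. S h \<in> carrier_mat m m \<and> \<rho> h * Y = Y * S h) \<longrightarrow>
        Y = 0\<^sub>m n m \<or> (\<exists>Z\<in>carrier_mat m n. Y * Z = 1\<^sub>m n))"

lemma matrix_rep_subset: "matrix_rep G H n \<rho> \<Longrightarrow> K \<subseteq> H \<Longrightarrow> matrix_rep G K n \<rho>"
  by (auto simp: matrix_rep_def)

lemma matrix_rep_carrier: "matrix_rep G H n \<rho> \<Longrightarrow> x \<in> H \<Longrightarrow> \<rho> x \<in> carrier_mat n n"
  by (auto simp: matrix_rep_def)

lemma matrix_rep_mult:
  "matrix_rep G H n \<rho> \<Longrightarrow> x \<in> H \<Longrightarrow> y \<in> H \<Longrightarrow> \<rho> (x \<otimes>\<^bsub>G\<^esub> y) = \<rho> x * \<rho> y"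
  by (auto simp: matrix_rep_def)

lemma matrix_rep_one: "matrix_rep G H n \<rho> \<Longrightarrow> \<rho> \<one>\<^bsub>G\<^esub> = 1\<^sub>m n"
  by (auto simp: matrix_rep_def)

lemma irreducible_onD:
  assumes "irreducible_on H n \<rho>" "Y \<in> carrier_mat n m"
    and "\<And>h. h \<in> H \<Longrightarrow> S h \<in> carrier_mat m m" "\<And>h. h \<in> H \<Longrightarrow> \<rho> h * Y = Y * S h"
  shows "Y = 0\<^sub>m n m \<or> (\<exists>Z\<in>carrier_mat m n. Y * Z = 1\<^sub>m n)"
  using assms unfolding irreducible_on_def by blast

text \<open>Irreducibility of \<open>\<rho>\<close> makes \<open>T\<close> surjective, since its column space is invariant.
  Irreducibility of \<open>\<sigma>\<close> makes it injective, since its kernel is invariant.\<close>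

lemma irreducible_on_intertwiner_invertible:
  assumes "irreducible_on H n \<rho>" "irreducible_on H m \<sigma>"
    and \<rho>: "\<And>h. h \<in> H \<Longrightarrow> \<rho> h \<in> carrier_mat n n" and \<sigma>: "\<And>h. h \<in> H \<Longrightarrow> \<sigma> h \<in> carrier_mat m m"
    and T: "T \<in> carrier_mat n m" "T \<noteq> 0\<^sub>m n m" and inter: "\<And>h. h \<in> H \<Longrightarrow> \<rho> h * T = T * \<sigma> h"
  obtains Z where "Z \<in> carrier_mat m n" "T * Z = 1\<^sub>m n" "Z * T = 1\<^sub>m m"
proof -
  obtain Z where Z: "Z \<in> carrier_mat m n" "T * Z = 1\<^sub>m n"
    using irreducible_onD[OF assms(1) T(1) \<sigma> inter] T(2) by blast
  \<comment> \<open>\<open>Y\<close> is the projection onto the kernel of \<open>T\<close> along the range of \<open>Z\<close>.\<close>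
  define Y where "Y = 1\<^sub>m m - Z * T"
  have Y: "Y \<in> carrier_mat m m" using Z T by (auto simp: Y_def)
  have ZT: "Z * T \<in> carrier_mat m m" using Z T by auto
  have proj: "Y * X = X - Z * (T * X)" if "X \<in> carrier_mat m m" for X
    unfolding Y_def using that Z T
    by (simp add: minus_mult_distrib_mat[of _ m m _ _ m] assoc_mult_mat[of _ m n _ m _ m])
  have TY: "T * Y = 0\<^sub>m n m"
  proof -
    have "T * Y = T - T * (Z * T)"
      unfolding Y_def using T ZT by (simp add: mult_minus_distrib_mat[of _ n m _ m])
    also have "T * (Z * T) = T"
      using mat_mult_inverse_cancel[OF Z(2) T(1) Z(1) T(1)] .
    finally show ?thesis using T by simp
  qed
  have inv: "\<sigma> h * Y = Y * (\<sigma> h * Y)" if h: "h \<in> H" for h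
  proof -
    have "T * (\<sigma> h * Y) = \<rho> h * (T * Y)"
      unfolding assoc_mult_mat[OF T(1) \<sigma>[OF h] Y, symmetric] inter[OF h, symmetric]
      by (rule assoc_mult_mat[OF \<rho>[OF h] T(1) Y])
    also have "\<dots> = 0\<^sub>m n m" using TY \<rho>[OF h] by simp
    finally have "T * (\<sigma> h * Y) = 0\<^sub>m n m" .
    thus ?thesis using proj[of "\<sigma> h * Y"] Y \<sigma>[OF h] Z by (auto intro!: eq_matI)
  qed
  have "Y = 0\<^sub>m m m \<or> (\<exists>W\<in>carrier_mat m m. Y * W = 1\<^sub>m m)"
    using irreducible_onD[OF assms(2) Y mult_carrier_mat[OF \<sigma> Y] inv] .
  thus ?thesis
  proof
    assume "Y = 0\<^sub>m m m"
    have "Z * T = 1\<^sub>m m"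
    proof (rule eq_matI)
      fix i j assume ij: "i < dim_row (1\<^sub>m m :: complex mat)" "j < dim_col (1\<^sub>m m :: complex mat)"
      have "Y $$ (i, j) = (0\<^sub>m m m :: complex mat) $$ (i, j)" using \<open>Y = 0\<^sub>m m m\<close> by simp
      thus "(Z * T) $$ (i, j) = 1\<^sub>m m $$ (i, j)"
        using ij ZT unfolding Y_def by (subst (asm) index_minus_mat) auto
    qed (use ZT in auto)
    thus ?thesis using that Z by blast
  next
    assume "\<exists>W\<in>carrier_mat m m. Y * W = 1\<^sub>m m"
    then obtain W where W: "W \<in> carrier_mat m m" "Y * W = 1\<^sub>m m" by blast
    have "T = T * (Y * W)" using W T by simp
    also have "\<dots> = (T * Y) * W" using T Y W by simp
    also have "\<dots> = 0\<^sub>m n m" using TY W by simp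
    finally show ?thesis using T by simp
  qed
qed

text \<open>If \<open>c\<close> is an eigenvalue of \<open>X\<close>, then \<open>X - c\<close> is an intertwiner that is not invertible.\<close>

lemma irreducible_on_commutant_scalar:
  assumes irr: "irreducible_on H n \<rho>" and \<rho>: "\<And>h. h \<in> H \<Longrightarrow> \<rho> h \<in> carrier_mat n n"
    and X: "X \<in> carrier_mat n n" and comm: "\<And>h. h \<in> H \<Longrightarrow> \<rho> h * X = X * \<rho> h"
  obtains c where "X = c \<cdot>\<^sub>m 1\<^sub>m n"
proof -
  have "n > 0" using irr by (simp add: irreducible_on_def)
  then obtain c where "eigenvalue X c"
    using spectrum_non_empty[OF X] by (auto simp: spectrum_def)
  then obtain v where v: "v \<in> carrier_vec n" "v \<noteq> 0\<^sub>v n" "X *\<^sub>v v = c \<cdot>\<^sub>v v"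
    using X by (auto simp: eigenvalue_def eigenvector_def)
  define T where "T = X - c \<cdot>\<^sub>m 1\<^sub>m n"
  have T: "T \<in> carrier_mat n n" using X by (auto simp: T_def)
  have c1: "c \<cdot>\<^sub>m 1\<^sub>m n \<in> carrier_mat n n" by simp
  have "\<rho> h * T = T * \<rho> h" if "h \<in> H" for h
    unfolding T_def mult_minus_distrib_mat[OF \<rho>[OF that] X c1]
      minus_mult_distrib_mat[OF X c1 \<rho>[OF that]]
    using comm[OF that] \<rho>[OF that] by (simp add: mult_smult_distrib[of _ n n _ n] mult_smult_assoc_mat[of _ n n _ n])
  moreover have "T = 0\<^sub>m n n"
  proof (rule ccontr)
    assume "T \<noteq> 0\<^sub>m n n"
    then obtain Z where Z: "Z \<in> carrier_mat n n" "Z * T = 1\<^sub>m n"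
      using irreducible_on_intertwiner_invertible[OF irr irr \<rho> \<rho> T] calculation by metis
    have "T *\<^sub>v v = 0\<^sub>v n"
      unfolding T_def minus_mult_distrib_mat_vec[OF X c1 v(1)]
      using v by (intro eq_vecI) auto
    hence "(Z * T) *\<^sub>v v = 0\<^sub>v n"
      unfolding assoc_mult_mat_vec[OF Z(1) T v(1)] using Z by auto
    thus False unfolding Z(2) using v by simp
  qed
  have "X = c \<cdot>\<^sub>m 1\<^sub>m n"
  proof (rule eq_matI)
    fix i j assume ij: "i < dim_row (c \<cdot>\<^sub>m 1\<^sub>m n)" "j < dim_col (c \<cdot>\<^sub>m 1\<^sub>m n)"
    have "T $$ (i, j) = (0\<^sub>m n n :: complex mat) $$ (i, j)" using \<open>T = 0\<^sub>m n n\<close> by simp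
    thus "X $$ (i, j) = (c \<cdot>\<^sub>m 1\<^sub>m n) $$ (i, j)"
      using ij X unfolding T_def by (subst (asm) index_minus_mat) auto
  qed (use X in auto)
  thus ?thesis using that by blast
qed

section \<open>Schur orthogonality\<close>

lemma equivalent_imp_same_trace:
  fixes A B :: "complex mat"
  assumes "A \<in> carrier_mat n n" "B \<in> carrier_mat m m" "T \<in> carrier_mat n m" "Z \<in> carrier_mat m n"
    and "T * Z = 1\<^sub>m n" "Z * T = 1\<^sub>m m" "A * T = T * B"
  shows "mat_trace A = mat_trace B"
proof -
  have "mat_trace A = mat_trace (A * (T * Z))" using assms by simp
  also have "A * (T * Z) = T * (B * Z)"
    unfolding assoc_mult_mat[OF assms(1,3,4), symmetric] assms(7)
    by (rule assoc_mult_mat[OF assms(3,2,4)])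
  also have "mat_trace \<dots> = mat_trace (B * Z * T)"
    using assms by (intro mat_trace_mult_commute[of _ n m]) auto
  also have "B * Z * T = B"
    using assms by (simp add: assoc_mult_mat[OF assms(2,4,3)])
  finally show ?thesis .
qed

lemma double_sum_product:
  fixes f g :: "_ \<Rightarrow> _ \<Rightarrow> complex"
  shows "(\<Sum>a\<in>A. \<Sum>i\<in>I. f a i) * (\<Sum>b\<in>B. \<Sum>j\<in>J. g b j)
    = (\<Sum>a\<in>A. \<Sum>i\<in>I. \<Sum>b\<in>B. \<Sum>j\<in>J. f a i * g b j)"
  unfolding sum_distrib_right unfolding sum_distrib_left ..

lemma double_sum_delta:
  fixes F :: "nat \<Rightarrow> nat \<Rightarrow> complex"
  assumes "a < n" "i < m"
  shows "(\<Sum>b<n. \<Sum>j<m. F b j * (if i = j \<and> a = b then c else 0)) = F a i * c"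
proof -
  have "(\<Sum>j<m. F b j * (if i = j \<and> a = b then c else 0)) = (if b = a then F a i * c else 0)" for b
  proof -
    have "(\<Sum>j<m. F b j * (if i = j \<and> a = b then c else 0))
        = (\<Sum>j<m. if j = i then (if b = a then F b j * c else 0) else 0)"
      by (intro sum.cong) auto
    thus ?thesis using \<open>i < m\<close> by simp
  qed
  thus ?thesis using \<open>a < n\<close> by simp
qed

context group
begin

lemma matrix_rep_inv:
  assumes "subgroup H G" "matrix_rep G H n \<rho>" "h \<in> H"
  shows "\<rho> h * \<rho> (inv h) = 1\<^sub>m n" "\<rho> (inv h) * \<rho> h = 1\<^sub>m n"
proof -
  have "h \<in> carrier G" "inv h \<in> H" using assms by (auto intro: subgroup.mem_carrier subgroup.m_inv_closed)
  thus "\<rho> h * \<rho> (inv h) = 1\<^sub>m n" "\<rho> (inv h) * \<rho> h = 1\<^sub>m n"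
    using assms by (simp_all add: matrix_rep_one[of G] flip: matrix_rep_mult[of G H n \<rho>])
qed

lemma matrix_rep_pow:
  assumes "subgroup H G" "matrix_rep G H n \<rho>" "h \<in> H"
  shows "\<rho> (h [^] (k::nat)) = \<rho> h ^\<^sub>m k"
proof (induction k)
  case 0
  show ?case using assms matrix_rep_carrier[OF assms(2,3)] by (auto simp: matrix_rep_one[of G])
next
  case (Suc k)
  have "h [^] k \<in> H" using subgroup_int_pow_closed[OF assms(1,3), of "int k"] by (simp add: int_pow_int)
  thus ?case using Suc assms by (simp add: matrix_rep_mult[of G H n \<rho>])
qed

lemma character_inv:
  assumes "subgroup H G" "finite (carrier G)" "matrix_rep G H n \<rho>" "h \<in> H"
  shows "mat_trace (\<rho> (inv h)) = cnj (mat_trace (\<rho> h))"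
proof (rule mat_trace_inverse_finite_order)
  have h: "h \<in> carrier G" "inv h \<in> H" using assms by (auto intro: subgroup.mem_carrier subgroup.m_inv_closed)
  show "\<rho> h \<in> carrier_mat n n" "\<rho> (inv h) \<in> carrier_mat n n"
    using assms h by (auto intro: matrix_rep_carrier)
  show "\<rho> h * \<rho> (inv h) = 1\<^sub>m n" by (rule matrix_rep_inv[OF assms(1,3,4)])
  show "Coset.order G > 0" using assms(2) by (simp add: order_gt_0_iff_finite)
  show "\<rho> h ^\<^sub>m Coset.order G = 1\<^sub>m n"
    using matrix_rep_pow[OF assms(1,3,4), of "Coset.order G"] pow_order_eq_1[OF h(1)] assms(3)
    by (simp add: matrix_rep_one[of G])
qed

text \<open>\<open>T\<close> is the average of \<open>\<rho>(h)E\<sigma>(h)\<inverse>\<close> over the group, up to its order, for the matrix unit \<open>E\<close> at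
  position \<open>(a, b)\<close>; its entries are the sums in the orthogonality relations.\<close>

lemma average_intertwines:
  assumes H: "subgroup H G" and \<rho>: "matrix_rep G H n \<rho>" and \<sigma>: "matrix_rep G H m \<sigma>"
    and "a < n" "b < m" "x \<in> H"
  defines "T \<equiv> mat n m (\<lambda>(i, j). \<Sum>h\<in>H. \<rho> h $$ (i, a) * \<sigma> (inv h) $$ (b, j))"
  shows "\<rho> x * T = T * \<sigma> x"
proof (rule eq_matI)
  have T: "T \<in> carrier_mat n m" by (simp add: T_def)
  have cx: "\<rho> x \<in> carrier_mat n n" "\<sigma> x \<in> carrier_mat m m"
    using \<rho> \<sigma> \<open>x \<in> H\<close> by (auto intro: matrix_rep_carrier)
  show "dim_row (\<rho> x * T) = dim_row (T * \<sigma> x)" "dim_col (\<rho> x * T) = dim_col (T * \<sigma> x)"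
    using T cx by auto
  note Hc = subgroup.mem_carrier[OF H] subgroup.m_inv_closed[OF H] subgroup.m_closed[OF H]
  fix i j assume "i < dim_row (T * \<sigma> x)" "j < dim_col (T * \<sigma> x)"
  hence ij: "i < n" "j < m" using T cx by auto
  have "(\<rho> x * T) $$ (i, j) = (\<Sum>k<n. \<Sum>h\<in>H. \<rho> x $$ (i, k) * \<rho> h $$ (k, a) * \<sigma> (inv h) $$ (b, j))"
    unfolding index_mult_mat_sum[OF cx(1) T ij]
    using ij by (simp add: T_def sum_distrib_left mult.assoc)
  also have "\<dots> = (\<Sum>h\<in>H. (\<rho> x * \<rho> h) $$ (i, a) * \<sigma> (inv h) $$ (b, j))"
    unfolding sum.swap[of _ H]
    using index_mult_mat_sum[OF cx(1) matrix_rep_carrier[OF \<rho>] ij(1) \<open>a < n\<close>]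
    by (intro sum.cong refl) (simp add: sum_distrib_right del: index_mult_mat)
  also have "\<dots> = (\<Sum>h\<in>H. \<rho> (x \<otimes> h) $$ (i, a) * \<sigma> (inv h) $$ (b, j))"
    using \<rho> \<open>x \<in> H\<close> by (simp add: matrix_rep_mult[of G H n])
  also have "\<dots> = (\<Sum>h\<in>H. \<rho> h $$ (i, a) * \<sigma> (inv h \<otimes> x) $$ (b, j))"
  proof -
    have "inv x \<otimes> (x \<otimes> h) = h" "x \<otimes> (inv x \<otimes> h) = h" "inv (x \<otimes> h) \<otimes> x = inv h" if "h \<in> H" for h
      using Hc(1)[OF that] Hc(1)[OF \<open>x \<in> H\<close>]
      by (simp_all add: inv_mult_group m_assoc) (simp_all flip: m_assoc)
    thus ?thesis
      using \<open>x \<in> H\<close> Hc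
      by (intro sum.reindex_bij_witness[of _ "\<lambda>h. inv x \<otimes> h" "\<lambda>h. x \<otimes> h"]) auto
  qed
  also have "\<dots> = (\<Sum>h\<in>H. \<rho> h $$ (i, a) * (\<sigma> (inv h) * \<sigma> x) $$ (b, j))"
    using \<sigma> \<open>x \<in> H\<close> Hc by (simp add: matrix_rep_mult[of G H m])
  also have "\<dots> = (\<Sum>h\<in>H. \<Sum>k<m. \<rho> h $$ (i, a) * \<sigma> (inv h) $$ (b, k) * \<sigma> x $$ (k, j))"
    using index_mult_mat_sum[OF matrix_rep_carrier[OF \<sigma> Hc(2)] cx(2) \<open>b < m\<close> ij(2)]
    by (intro sum.cong refl) (simp add: sum_distrib_left mult.assoc del: index_mult_mat)
  also have "\<dots> = (T * \<sigma> x) $$ (i, j)"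
    unfolding index_mult_mat_sum[OF T cx(2) ij] sum.swap[of _ _ H]
    using ij by (simp add: T_def sum_distrib_right)
  finally show "(\<rho> x * T) $$ (i, j) = (T * \<sigma> x) $$ (i, j)" .
qed

lemma matrix_coefficients_orthogonal_or_equivalent:
  assumes H: "subgroup H G" and \<rho>: "matrix_rep G H n \<rho>" "irreducible_on H n \<rho>"
    and \<sigma>: "matrix_rep G H m \<sigma>" "irreducible_on H m \<sigma>"
  obtains (equivalent) T Z where "T \<in> carrier_mat n m" "Z \<in> carrier_mat m n"
      "T * Z = 1\<^sub>m n" "Z * T = 1\<^sub>m m" "\<And>h. h \<in> H \<Longrightarrow> \<rho> h * T = T * \<sigma> h"
  | (orthogonal) "\<And>i a b j. i < n \<Longrightarrow> a < n \<Longrightarrow> b < m \<Longrightarrow> j < m \<Longrightarrow>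
      (\<Sum>h\<in>H. \<rho> h $$ (i, a) * \<sigma> (inv h) $$ (b, j)) = 0"
proof (cases "\<exists>T\<in>carrier_mat n m. T \<noteq> 0\<^sub>m n m \<and> (\<forall>h\<in>H. \<rho> h * T = T * \<sigma> h)")
  case True
  then obtain T where T: "T \<in> carrier_mat n m" "T \<noteq> 0\<^sub>m n m" "\<And>h. h \<in> H \<Longrightarrow> \<rho> h * T = T * \<sigma> h"
    by blast
  obtain Z where "Z \<in> carrier_mat m n" "T * Z = 1\<^sub>m n" "Z * T = 1\<^sub>m m"
    using irreducible_on_intertwiner_invertible[OF \<rho>(2) \<sigma>(2) matrix_rep_carrier[OF \<rho>(1)]
      matrix_rep_carrier[OF \<sigma>(1)] T] .
  thus ?thesis using equivalent T by blast
next
  case False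
  show ?thesis
  proof (rule orthogonal)
    fix i a b j assume ij: "i < n" "a < n" "b < m" "j < m"
    define T where "T = mat n m (\<lambda>(i, j). \<Sum>h\<in>H. \<rho> h $$ (i, a) * \<sigma> (inv h) $$ (b, j))"
    have "\<forall>h\<in>H. \<rho> h * T = T * \<sigma> h"
      using average_intertwines[OF H \<rho>(1) \<sigma>(1) ij(2,3)] by (simp add: T_def)
    moreover have "T \<in> carrier_mat n m" by (simp add: T_def)
    ultimately have "T = 0\<^sub>m n m" using False by blast
    hence "T $$ (i, j) = 0" using ij by simp
    thus "(\<Sum>h\<in>H. \<rho> h $$ (i, a) * \<sigma> (inv h) $$ (b, j)) = 0"
      using ij by (simp add: T_def)
  qed
qed

lemma matrix_coefficients_orthonormal:
  assumes H: "subgroup H G" and \<rho>: "matrix_rep G H n \<rho>" "irreducible_on H n \<rho>"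
    and ij: "i < n" "a < n" "b < n" "j < n"
  shows "(\<Sum>h\<in>H. \<rho> h $$ (i, a) * \<rho> (inv h) $$ (b, j))
    = (if i = j \<and> a = b then of_nat (card H) / of_nat n else 0)"
proof -
  define T where "T = mat n n (\<lambda>(i, j). \<Sum>h\<in>H. \<rho> h $$ (i, a) * \<rho> (inv h) $$ (b, j))"
  have T: "T \<in> carrier_mat n n" by (simp add: T_def)
  have "\<rho> h * T = T * \<rho> h" if "h \<in> H" for h
    using average_intertwines[OF H \<rho>(1) \<rho>(1) ij(2,3) that] by (simp add: T_def)
  then obtain c where c: "T = c \<cdot>\<^sub>m 1\<^sub>m n"
    using irreducible_on_commutant_scalar[OF \<rho>(2) matrix_rep_carrier[OF \<rho>(1)] T] by blast
  have "of_nat n * c = (\<Sum>i<n. T $$ (i, i))" by (simp add: c)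
  also have "\<dots> = (\<Sum>i<n. \<Sum>h\<in>H. \<rho> (inv h) $$ (b, i) * \<rho> h $$ (i, a))"
    by (simp add: T_def mult.commute)
  also have "\<dots> = (\<Sum>h\<in>H. (\<rho> (inv h) * \<rho> h) $$ (b, a))"
    unfolding sum.swap[of _ H]
    using index_mult_mat_sum[OF matrix_rep_carrier[OF \<rho>(1) subgroup.m_inv_closed[OF H]]
        matrix_rep_carrier[OF \<rho>(1)] ij(3,2)]
    by (intro sum.cong refl) (simp del: index_mult_mat)
  also have "\<dots> = (if a = b then of_nat (card H) else 0)"
    using matrix_rep_inv(2)[OF H \<rho>(1)] ij by simp
  finally have "of_nat n * c = (if a = b then of_nat (card H) else 0)" .
  moreover have "n > 0" using ij by simp
  ultimately have "c = (if a = b then of_nat (card H) / of_nat n else 0)"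
    by (auto simp: field_simps)
  moreover have "(\<Sum>h\<in>H. \<rho> h $$ (i, a) * \<rho> (inv h) $$ (b, j)) = T $$ (i, j)"
    using ij by (simp add: T_def)
  ultimately show ?thesis using ij by (simp add: c)
qed

text \<open>Expanding both traces reduces such sums to the orthogonality relations of matrix coefficients.\<close>

lemma sum_traces_eq_sum_coefficients:
  assumes H: "subgroup H G" and \<rho>: "matrix_rep G H n \<rho>" and \<sigma>: "matrix_rep G H m \<sigma>"
    and A: "A \<in> carrier_mat n n" and B: "B \<in> carrier_mat m m"
  shows "(\<Sum>h\<in>H. mat_trace (A * \<rho> h) * mat_trace (\<sigma> (inv h) * B))
    = (\<Sum>a<n. \<Sum>i<n. \<Sum>b<m. \<Sum>j<m. A $$ (a, i) * B $$ (j, b) *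
         (\<Sum>h\<in>H. \<rho> h $$ (i, a) * \<sigma> (inv h) $$ (b, j)))"
proof -
  have "mat_trace (A * \<rho> h) = (\<Sum>a<n. \<Sum>i<n. A $$ (a, i) * \<rho> h $$ (i, a))" if "h \<in> H" for h
    using index_mult_mat_sum[OF A matrix_rep_carrier[OF \<rho> that]]
    by (simp add: mat_trace_eq[OF mult_carrier_mat[OF A matrix_rep_carrier[OF \<rho> that]]] del: index_mult_mat)
  moreover have "mat_trace (\<sigma> (inv h) * B) = (\<Sum>b<m. \<Sum>j<m. \<sigma> (inv h) $$ (b, j) * B $$ (j, b))" if "h \<in> H" for h
  proof -
    have c: "\<sigma> (inv h) \<in> carrier_mat m m"
      using matrix_rep_carrier[OF \<sigma> subgroup.m_inv_closed[OF H that]] .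
    show ?thesis
      using index_mult_mat_sum[OF c B]
      by (simp add: mat_trace_eq[OF mult_carrier_mat[OF c B]] del: index_mult_mat)
  qed
  ultimately have "(\<Sum>h\<in>H. mat_trace (A * \<rho> h) * mat_trace (\<sigma> (inv h) * B))
    = (\<Sum>h\<in>H. \<Sum>a<n. \<Sum>i<n. \<Sum>b<m. \<Sum>j<m.
         A $$ (a, i) * B $$ (j, b) * (\<rho> h $$ (i, a) * \<sigma> (inv h) $$ (b, j)))"
    by (simp add: double_sum_product mult_ac)
  also have "\<dots> = (\<Sum>a<n. \<Sum>i<n. \<Sum>b<m. \<Sum>j<m. \<Sum>h\<in>H.
         A $$ (a, i) * B $$ (j, b) * (\<rho> h $$ (i, a) * \<sigma> (inv h) $$ (b, j)))"
    by (simp only: sum.swap[where A = H])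
  finally show ?thesis by (simp add: sum_distrib_left)
qed

text \<open>The matrices \<open>A\<close> and \<open>B\<close> give the orthogonality relations on a coset as well: take
  \<open>A = \<rho>(g)\<close> and \<open>B = \<rho>(g)\<inverse>\<close>.\<close>

lemma Schur_orthogonality:
  assumes H: "subgroup H G" and \<rho>: "matrix_rep G H n \<rho>" "irreducible_on H n \<rho>"
    and A: "A \<in> carrier_mat n n" and B: "B \<in> carrier_mat n n"
  shows "(\<Sum>h\<in>H. mat_trace (A * \<rho> h) * mat_trace (\<rho> (inv h) * B))
    = of_nat (card H) / of_nat n * mat_trace (A * B)"
proof -
  have "(\<Sum>h\<in>H. mat_trace (A * \<rho> h) * mat_trace (\<rho> (inv h) * B))
    = (\<Sum>a<n. \<Sum>i<n. \<Sum>b<n. \<Sum>j<n. A $$ (a, i) * B $$ (j, b) *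
         (if i = j \<and> a = b then of_nat (card H) / of_nat n else 0))"
    unfolding sum_traces_eq_sum_coefficients[OF H \<rho>(1) \<rho>(1) A B]
    using matrix_coefficients_orthonormal[OF H \<rho>] by (intro sum.cong refl) auto
  also have "\<dots> = (\<Sum>a<n. \<Sum>i<n. A $$ (a, i) * B $$ (i, a) * (of_nat (card H) / of_nat n))"
    by (intro sum.cong refl double_sum_delta) auto
  also have "\<dots> = of_nat (card H) / of_nat n * mat_trace (A * B)"
    by (simp add: mat_trace_eq[OF mult_carrier_mat[OF A B]] index_mult_mat_sum[OF A B]
          sum_distrib_left sum_distrib_right mult_ac del: index_mult_mat)
  finally show ?thesis .
qed

end

section \<open>Characters and their decomposition\<close>

lemma sum_lessThan_split:
  fixes f :: "nat \<Rightarrow> 'a :: comm_monoid_add"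
  shows "(\<Sum>k<r + s. f k) = (\<Sum>k<r. f k) + (\<Sum>k<s. f (r + k))"
  by (induction s) (simp_all add: add.assoc)

lemma irreducible_on_twist:
  assumes irr: "irreducible_on H n \<rho>" and \<rho>: "\<And>h. h \<in> H \<Longrightarrow> \<rho> h \<in> carrier_mat n n"
    and nz: "\<And>h. h \<in> H \<Longrightarrow> \<mu> h \<noteq> 0"
  shows "irreducible_on H n (\<lambda>h. \<mu> h \<cdot>\<^sub>m \<rho> h)"
  unfolding irreducible_on_def
proof (intro conjI allI impI)
  show "n > 0" using irr by (simp add: irreducible_on_def)
  fix m Y S
  assume Y: "Y \<in> carrier_mat n m" and S: "\<forall>h\<in>H. S h \<in> carrier_mat m m \<and> \<mu> h \<cdot>\<^sub>m \<rho> h * Y = Y * S h"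
  have "\<rho> h * Y = Y * (inverse (\<mu> h) \<cdot>\<^sub>m S h)" if h: "h \<in> H" for h
  proof -
    have Sh: "S h \<in> carrier_mat m m" "\<mu> h \<cdot>\<^sub>m (\<rho> h * Y) = Y * S h"
      using S h mult_smult_assoc_mat[OF \<rho>[OF h] Y] by auto
    have "Y * (inverse (\<mu> h) \<cdot>\<^sub>m S h) = inverse (\<mu> h) \<cdot>\<^sub>m (\<mu> h \<cdot>\<^sub>m (\<rho> h * Y))"
      using mult_smult_distrib[OF Y Sh(1)] Sh(2) by simp
    also have "\<dots> = \<rho> h * Y" using nz[OF h] by (intro eq_matI) auto
    finally show ?thesis ..
  qed
  thus "Y = 0\<^sub>m n m \<or> (\<exists>Z\<in>carrier_mat m n. Y * Z = 1\<^sub>m n)"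
    using S by (intro irreducible_onD[OF irr Y, of "\<lambda>h. inverse (\<mu> h) \<cdot>\<^sub>m S h"]) auto
qed

lemma (in group) matrix_rep_twist:
  assumes "matrix_rep G H n \<rho>" and "\<mu> \<one> = 1" "\<And>x y. x \<in> H \<Longrightarrow> y \<in> H \<Longrightarrow> \<mu> (x \<otimes> y) = \<mu> x * \<mu> y"
  shows "matrix_rep G H n (\<lambda>h. \<mu> h \<cdot>\<^sub>m \<rho> h)"
  unfolding matrix_rep_def
proof (intro conjI ballI)
  show "\<mu> h \<cdot>\<^sub>m \<rho> h \<in> carrier_mat n n" if "h \<in> H" for h
    using matrix_rep_carrier[OF assms(1) that] by simp
  show "\<mu> \<one> \<cdot>\<^sub>m \<rho> \<one> = 1\<^sub>m n" using assms(2) matrix_rep_one[OF assms(1)] by (intro eq_matI) auto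
  fix x y assume xy: "x \<in> H" "y \<in> H"
  have c: "\<rho> x \<in> carrier_mat n n" "\<rho> y \<in> carrier_mat n n"
    using matrix_rep_carrier[OF assms(1)] xy by auto
  show "\<mu> (x \<otimes> y) \<cdot>\<^sub>m \<rho> (x \<otimes> y) = \<mu> x \<cdot>\<^sub>m \<rho> x * (\<mu> y \<cdot>\<^sub>m \<rho> y)"
    unfolding assms(3)[OF xy] matrix_rep_mult[OF assms(1) xy]
      mult_smult_distrib[OF smult_carrier_mat[OF c(1)] c(2)] mult_smult_assoc_mat[OF c]
    by (intro eq_matI) auto
qed

context group
begin

lemma sum_character_mult_cnj:
  assumes fin: "finite (carrier G)" and H: "subgroup H G"
    and \<rho>: "matrix_rep G H n \<rho>" and \<sigma>: "matrix_rep G H m \<sigma>"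
  shows "(\<Sum>h\<in>H. mat_trace (\<rho> h) * cnj (mat_trace (\<sigma> h)))
      = (\<Sum>h\<in>H. mat_trace (1\<^sub>m n * \<rho> h) * mat_trace (\<sigma> (inv h) * 1\<^sub>m m))"
  by (intro sum.cong refl)
    (simp add: character_inv[OF H fin \<sigma>] left_mult_one_mat[OF matrix_rep_carrier[OF \<rho>]]
       right_mult_one_mat[OF matrix_rep_carrier[OF \<sigma> subgroup.m_inv_closed[OF H]]])

lemma character_inner_product:
  assumes fin: "finite (carrier G)" and H: "subgroup H G"
    and \<rho>: "matrix_rep G H n \<rho>" "irreducible_on H n \<rho>"
    and \<sigma>: "matrix_rep G H m \<sigma>" "irreducible_on H m \<sigma>"
  shows "(\<Sum>h\<in>H. mat_trace (\<rho> h) * cnj (mat_trace (\<sigma> h)))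
    = (if \<forall>h\<in>H. mat_trace (\<rho> h) = mat_trace (\<sigma> h) then of_nat (card H) else 0)"
proof -
  have I: "1\<^sub>m n \<in> carrier_mat n n" "1\<^sub>m m \<in> carrier_mat m m" by auto
  have eq: "(\<Sum>h\<in>H. mat_trace (\<rho> h) * cnj (mat_trace (\<sigma> h)))
      = (\<Sum>h\<in>H. mat_trace (1\<^sub>m n * \<rho> h) * mat_trace (\<sigma> (inv h) * 1\<^sub>m m))"
    by (rule sum_character_mult_cnj[OF fin H \<rho>(1) \<sigma>(1)])
  show ?thesis
  proof (cases "\<forall>h\<in>H. mat_trace (\<rho> h) = mat_trace (\<sigma> h)")
    case True
    have n: "n > 0" using \<rho>(2) by (simp add: irreducible_on_def)
    have "(\<Sum>h\<in>H. mat_trace (\<rho> h) * cnj (mat_trace (\<sigma> h)))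
      = (\<Sum>h\<in>H. mat_trace (\<rho> h) * cnj (mat_trace (\<rho> h)))"
      using True by (intro sum.cong refl) simp
    also have "\<dots> = (\<Sum>h\<in>H. mat_trace (1\<^sub>m n * \<rho> h) * mat_trace (\<rho> (inv h) * 1\<^sub>m n))"
      by (rule sum_character_mult_cnj[OF fin H \<rho>(1) \<rho>(1)])
    also have "\<dots> = of_nat (card H)"
      unfolding Schur_orthogonality[OF H \<rho> I(1) I(1)] using n by (simp add: mat_trace_one)
    finally show ?thesis using True by simp
  next
    case False
    show ?thesis
    proof (cases rule: matrix_coefficients_orthogonal_or_equivalent[OF H \<rho> \<sigma>,
        case_names equivalent orthogonal])
      case (equivalent T Z)
      have "mat_trace (\<rho> h) = mat_trace (\<sigma> h)" if "h \<in> H" for h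
        by (rule equivalent_imp_same_trace[OF matrix_rep_carrier[OF \<rho>(1) that]
            matrix_rep_carrier[OF \<sigma>(1) that] equivalent(1-4) equivalent(5)[OF that]])
      thus ?thesis using False by blast
    next
      case orthogonal
      have "(\<Sum>h\<in>H. mat_trace (1\<^sub>m n * \<rho> h) * mat_trace (\<sigma> (inv h) * 1\<^sub>m m)) = 0"
        unfolding sum_traces_eq_sum_coefficients[OF H \<rho>(1) \<sigma>(1) I]
        by (intro sum.neutral ballI) (simp add: orthogonal)
      thus ?thesis unfolding if_not_P[OF False] eq .
    qed
  qed
qed

lemma same_character_imp_equivalent:
  assumes fin: "finite (carrier G)" and H: "subgroup H G"
    and \<rho>: "matrix_rep G H n \<rho>" "irreducible_on H n \<rho>"
    and \<sigma>: "matrix_rep G H m \<sigma>" "irreducible_on H m \<sigma>"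
    and eq: "\<And>h. h \<in> H \<Longrightarrow> mat_trace (\<rho> h) = mat_trace (\<sigma> h)"
  obtains T Z where "T \<in> carrier_mat n m" "Z \<in> carrier_mat m n"
      "T * Z = 1\<^sub>m n" "Z * T = 1\<^sub>m m" "\<And>h. h \<in> H \<Longrightarrow> \<rho> h * T = T * \<sigma> h"
proof (rule matrix_coefficients_orthogonal_or_equivalent[OF H \<rho> \<sigma>])
  assume orthogonal: "\<And>i a b j. i < n \<Longrightarrow> a < n \<Longrightarrow> b < m \<Longrightarrow> j < m \<Longrightarrow>
      (\<Sum>h\<in>H. \<rho> h $$ (i, a) * \<sigma> (inv h) $$ (b, j)) = 0"
  have I: "1\<^sub>m n \<in> carrier_mat n n" "1\<^sub>m m \<in> carrier_mat m m" by auto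
  have "(\<Sum>h\<in>H. mat_trace (\<rho> h) * cnj (mat_trace (\<sigma> h)))
      = (\<Sum>h\<in>H. mat_trace (1\<^sub>m n * \<rho> h) * mat_trace (\<sigma> (inv h) * 1\<^sub>m m))"
    by (rule sum_character_mult_cnj[OF fin H \<rho>(1) \<sigma>(1)])
  also have "\<dots> = 0"
    unfolding sum_traces_eq_sum_coefficients[OF H \<rho>(1) \<sigma>(1) I]
    by (intro sum.neutral ballI) (simp add: orthogonal)
  finally have "card H = 0"
    using character_inner_product[OF fin H \<rho> \<sigma>] eq by (auto split: if_splits)
  moreover have "finite H" "H \<noteq> {}"
    using fin H subgroup.subset[OF H] subgroup.one_closed[OF H] by (auto intro: finite_subset)
  ultimately show thesis by simp
qed (use that in blast)

text \<open>The restriction of \<open>\<rho>\<close> to \<open>K\<close> is irreducible, so the mean of \<open>|\<chi>|\<^sup>2\<close> is \<open>1\<close> not only on \<open>K\<close> but on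
  every coset of \<open>K\<close> in \<open>H\<close>.\<close>

lemma coset_norm:
  assumes fin: "finite (carrier G)" and H: "subgroup H G" and K: "subgroup K G" "K \<subseteq> H"
    and \<rho>: "matrix_rep G H n \<rho>" "irreducible_on K n \<rho>" and g: "g \<in> H"
  shows "(\<Sum>k\<in>K. mat_trace (\<rho> (g \<otimes> k)) * cnj (mat_trace (\<rho> (g \<otimes> k)))) = of_nat (card K)"
proof -
  note c = matrix_rep_carrier[OF \<rho>(1)]
  have inv: "inv h \<in> H" "h \<in> carrier G" if "h \<in> H" for h
    using subgroup.m_inv_closed[OF H that] subgroup.mem_carrier[OF H that] .
  have n: "n > 0" using \<rho>(2) by (simp add: irreducible_on_def)
  have "(\<Sum>k\<in>K. mat_trace (\<rho> (g \<otimes> k)) * cnj (mat_trace (\<rho> (g \<otimes> k))))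
     = (\<Sum>k\<in>K. mat_trace (\<rho> g * \<rho> k) * mat_trace (\<rho> (inv k) * \<rho> (inv g)))"
  proof (intro sum.cong refl)
    fix k assume "k \<in> K"
    hence k: "k \<in> H" using K(2) by auto
    have "cnj (mat_trace (\<rho> (g \<otimes> k))) = mat_trace (\<rho> (inv (g \<otimes> k)))"
      using character_inv[OF H fin \<rho>(1)] subgroup.m_closed[OF H g k] by simp
    also have "inv (g \<otimes> k) = inv k \<otimes> inv g"
      using inv(2)[OF g] inv(2)[OF k] by (simp add: inv_mult_group)
    finally show "mat_trace (\<rho> (g \<otimes> k)) * cnj (mat_trace (\<rho> (g \<otimes> k)))
       = mat_trace (\<rho> g * \<rho> k) * mat_trace (\<rho> (inv k) * \<rho> (inv g))"
      using g k inv by (simp add: matrix_rep_mult[OF \<rho>(1)])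
  qed
  also have "\<dots> = of_nat (card K) / of_nat n * mat_trace (\<rho> g * \<rho> (inv g))"
    using Schur_orthogonality[OF K(1) matrix_rep_subset[OF \<rho>(1) K(2)] \<rho>(2) c[OF g] c[OF inv(1)[OF g]]] .
  also have "\<dots> = of_nat (card K)"
    using matrix_rep_inv(1)[OF H \<rho>(1) g] n by (simp add: mat_trace_one)
  finally show ?thesis .
qed

text \<open>Row reduction of a matrix whose column space is a proper invariant subspace brings \<open>\<rho>\<close> into
  block triangular form.  The diagonal blocks are representations, and they carry the trace.\<close>

lemma reducible_imp_character_sum:
  assumes \<rho>: "matrix_rep G H n \<rho>" and H: "subgroup H G" and red: "n > 0" "\<not> irreducible_on H n \<rho>"
  obtains r s \<rho>\<^sub>1 \<rho>\<^sub>2 where "0 < r" "0 < s" "n = r + s" "matrix_rep G H r \<rho>\<^sub>1" "matrix_rep G H s \<rho>\<^sub>2"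
    "\<And>h. h \<in> H \<Longrightarrow> mat_trace (\<rho> h) = mat_trace (\<rho>\<^sub>1 h) + mat_trace (\<rho>\<^sub>2 h)"
proof -
  from red obtain m Y S where Y: "Y \<in> carrier_mat n m" "Y \<noteq> 0\<^sub>m n m" "\<not> (\<exists>Z\<in>carrier_mat m n. Y * Z = 1\<^sub>m n)"
    and S: "\<And>h. h \<in> H \<Longrightarrow> S h \<in> carrier_mat m m" "\<And>h. h \<in> H \<Longrightarrow> \<rho> h * Y = Y * S h"
    unfolding irreducible_on_def by blast
  obtain P Q r p where PQ: "P \<in> carrier_mat n n" "Q \<in> carrier_mat n n" "P * Q = 1\<^sub>m n" "Q * P = 1\<^sub>m n"
    and r: "0 < r" "r < n"
    and zero: "\<And>i j. r \<le> i \<Longrightarrow> i < n \<Longrightarrow> j < m \<Longrightarrow> (P * Y) $$ (i, j) = 0"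
    and p: "\<And>i. i < r \<Longrightarrow> p i < m"
    and unit: "\<And>i j. i < r \<Longrightarrow> j < n \<Longrightarrow> (P * Y) $$ (j, p i) = (if i = j then 1 else 0)"
    using not_right_invertible_row_reduction[OF Y] by blast
  note c = matrix_rep_carrier[OF \<rho>]
  define M where "M h = P * \<rho> h * Q" for h
  have M: "M h \<in> carrier_mat n n" if "h \<in> H" for h using c[OF that] PQ by (auto simp: M_def)
  have PY: "P * Y \<in> carrier_mat n m" using PQ Y by auto
  \<comment> \<open>\<open>M h * (P * Y) = (P * Y) * S h\<close> has zero rows from \<open>r\<close> on; its pivot columns are columns of \<open>M h\<close>.\<close>
  have block: "M h $$ (i, j) = 0" if h: "h \<in> H" and ij: "r \<le> i" "i < n" "j < r" for h i j
  proof -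
    have "M h * (P * Y) = P * (\<rho> h * (Q * (P * Y)))"
      unfolding M_def
      using assoc_mult_mat[OF mult_carrier_mat[OF PQ(1) c[OF h]] PQ(2) PY]
        assoc_mult_mat[OF PQ(1) c[OF h] mult_carrier_mat[OF PQ(2) PY]] by simp
    also have "Q * (P * Y) = Y" using mat_mult_inverse_cancel[OF PQ(4,2,1) Y(1)] .
    also have "P * (\<rho> h * Y) = (P * Y) * S h"
      unfolding S(2)[OF h] using assoc_mult_mat[OF PQ(1) Y(1) S(1)[OF h]] by simp
    finally have "(M h * (P * Y)) $$ (i, p j) = ((P * Y) * S h) $$ (i, p j)" by simp
    also have "\<dots> = 0"
      unfolding index_mult_mat_sum[OF PY S(1)[OF h] ij(2) p[OF ij(3)]]
      using zero ij by (intro sum.neutral) auto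
    also have "(M h * (P * Y)) $$ (i, p j) = (\<Sum>k<n. if k = j then M h $$ (i, k) else 0)"
      unfolding index_mult_mat_sum[OF M[OF h] PY ij(2) p[OF ij(3)]]
      using unit[OF ij(3)] by (intro sum.cong refl) auto
    also have "\<dots> = M h $$ (i, j)" using ij r by simp
    finally show ?thesis .
  qed
  have M_mult: "M (x \<otimes> y) = M x * M y" if xy: "x \<in> H" "y \<in> H" for x y
  proof -
    have "M x * M y = P * \<rho> x * (Q * (P * (\<rho> y * Q)))"
      unfolding M_def
      using assoc_mult_mat[OF mult_carrier_mat[OF PQ(1) c[OF xy(1)]] PQ(2) M[OF xy(2), unfolded M_def]]
        assoc_mult_mat[OF PQ(1) c[OF xy(2)] PQ(2)] by simp
    also have "Q * (P * (\<rho> y * Q)) = \<rho> y * Q"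
      using mat_mult_inverse_cancel[OF PQ(4,2,1) mult_carrier_mat[OF c[OF xy(2)] PQ(2)]] .
    also have "P * \<rho> x * (\<rho> y * Q) = M (x \<otimes> y)"
      unfolding M_def matrix_rep_mult[OF \<rho> xy]
      using assoc_mult_mat[OF mult_carrier_mat[OF PQ(1) c[OF xy(1)]] c[OF xy(2)] PQ(2)]
       assoc_mult_mat[OF PQ(1) c[OF xy(1)] c[OF xy(2)]] by simp
    finally show ?thesis ..
  qed
  have M_one: "M \<one> = 1\<^sub>m n" using PQ by (simp add: M_def matrix_rep_one[OF \<rho>])
  define s where "s = n - r"
  have n: "n = r + s" "s > 0" using r by (auto simp: s_def)
  define \<rho>\<^sub>1 where "\<rho>\<^sub>1 h = mat r r (\<lambda>(i, j). M h $$ (i, j))" for h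
  define \<rho>\<^sub>2 where "\<rho>\<^sub>2 h = mat s s (\<lambda>(i, j). M h $$ (r + i, r + j))" for h
  have c1: "\<rho>\<^sub>1 h \<in> carrier_mat r r" and c2: "\<rho>\<^sub>2 h \<in> carrier_mat s s" for h
    by (auto simp: \<rho>\<^sub>1_def \<rho>\<^sub>2_def)
  have entry: "M (x \<otimes> y) $$ (i, j) = (\<Sum>k<r. M x $$ (i, k) * M y $$ (k, j)) + (\<Sum>k<s. M x $$ (i, r + k) * M y $$ (r + k, j))"
    if "x \<in> H" "y \<in> H" "i < n" "j < n" for x y i j
    using index_mult_mat_sum[OF M[OF that(1)] M[OF that(2)] that(3,4)] M_mult[OF that(1,2)]
    by (simp add: n(1) sum_lessThan_split)
  have "matrix_rep G H r \<rho>\<^sub>1"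
    unfolding matrix_rep_def
  proof (intro conjI ballI c1)
    show "\<rho>\<^sub>1 \<one> = 1\<^sub>m r" using r by (intro eq_matI) (auto simp: \<rho>\<^sub>1_def M_one)
    fix x y assume xy: "x \<in> H" "y \<in> H"
    show "\<rho>\<^sub>1 (x \<otimes> y) = \<rho>\<^sub>1 x * \<rho>\<^sub>1 y"
    proof (rule eq_matI)
      fix i j assume "i < dim_row (\<rho>\<^sub>1 x * \<rho>\<^sub>1 y)" "j < dim_col (\<rho>\<^sub>1 x * \<rho>\<^sub>1 y)"
      hence ij: "i < r" "j < r" by (auto simp: \<rho>\<^sub>1_def)
      show "\<rho>\<^sub>1 (x \<otimes> y) $$ (i, j) = (\<rho>\<^sub>1 x * \<rho>\<^sub>1 y) $$ (i, j)"
        unfolding index_mult_mat_sum[OF c1 c1 ij]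
        using entry[OF xy, of i j] ij block[OF xy(2)] n by (simp add: \<rho>\<^sub>1_def)
    qed (auto simp: \<rho>\<^sub>1_def)
  qed
  moreover have "matrix_rep G H s \<rho>\<^sub>2"
    unfolding matrix_rep_def
  proof (intro conjI ballI c2)
    show "\<rho>\<^sub>2 \<one> = 1\<^sub>m s" using n by (intro eq_matI) (auto simp: \<rho>\<^sub>2_def M_one)
    fix x y assume xy: "x \<in> H" "y \<in> H"
    show "\<rho>\<^sub>2 (x \<otimes> y) = \<rho>\<^sub>2 x * \<rho>\<^sub>2 y"
    proof (rule eq_matI)
      fix i j assume "i < dim_row (\<rho>\<^sub>2 x * \<rho>\<^sub>2 y)" "j < dim_col (\<rho>\<^sub>2 x * \<rho>\<^sub>2 y)"
      hence ij: "i < s" "j < s" by (auto simp: \<rho>\<^sub>2_def)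
      show "\<rho>\<^sub>2 (x \<otimes> y) $$ (i, j) = (\<rho>\<^sub>2 x * \<rho>\<^sub>2 y) $$ (i, j)"
        unfolding index_mult_mat_sum[OF c2 c2 ij]
        using entry[OF xy, of "r + i" "r + j"] ij block[OF xy(1)] n by (simp add: \<rho>\<^sub>2_def)
    qed (auto simp: \<rho>\<^sub>2_def)
  qed
  moreover have "mat_trace (\<rho> h) = mat_trace (\<rho>\<^sub>1 h) + mat_trace (\<rho>\<^sub>2 h)" if "h \<in> H" for h
  proof -
    have "mat_trace (\<rho> h) = mat_trace (M h)"
      unfolding M_def using mat_trace_similar[OF c[OF that] PQ(1,2,4)] by simp
    moreover have "mat_trace (\<rho>\<^sub>1 h) = (\<Sum>i<r. M h $$ (i, i))"
      unfolding mat_trace_eq[OF c1] by (simp add: \<rho>\<^sub>1_def)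
    moreover have "mat_trace (\<rho>\<^sub>2 h) = (\<Sum>i<s. M h $$ (r + i, r + i))"
      unfolding mat_trace_eq[OF c2] by (simp add: \<rho>\<^sub>2_def)
    ultimately show ?thesis
      by (simp add: mat_trace_eq[OF M[OF that]] n(1) sum_lessThan_split)
  qed
  ultimately show ?thesis using that[of r s] r n by blast
qed

text \<open>A decomposition of the character only: the trace does not distinguish a representation from the
  sum of its composition factors.\<close>

definition decomposes_into :: "'a set \<Rightarrow> ('a \<Rightarrow> complex mat) \<Rightarrow> nat \<Rightarrow> (nat \<Rightarrow> nat) \<Rightarrow> (nat \<Rightarrow> 'a \<Rightarrow> complex mat) \<Rightarrow> bool" where
  "decomposes_into H \<rho> N d \<sigma> \<longleftrightarrow>
     (\<forall>s<N. matrix_rep G H (d s) (\<sigma> s) \<and> irreducible_on H (d s) (\<sigma> s)) \<and>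
     (\<forall>h\<in>H. mat_trace (\<rho> h) = (\<Sum>s<N. mat_trace (\<sigma> s h)))"

lemma decomposes_into_add:
  assumes "decomposes_into H \<rho>\<^sub>1 N\<^sub>1 d\<^sub>1 \<sigma>\<^sub>1" "decomposes_into H \<rho>\<^sub>2 N\<^sub>2 d\<^sub>2 \<sigma>\<^sub>2"
    and "\<And>h. h \<in> H \<Longrightarrow> mat_trace (\<rho> h) = mat_trace (\<rho>\<^sub>1 h) + mat_trace (\<rho>\<^sub>2 h)"
  shows "decomposes_into H \<rho> (N\<^sub>1 + N\<^sub>2) (\<lambda>s. if s < N\<^sub>1 then d\<^sub>1 s else d\<^sub>2 (s - N\<^sub>1))
    (\<lambda>s. if s < N\<^sub>1 then \<sigma>\<^sub>1 s else \<sigma>\<^sub>2 (s - N\<^sub>1))"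
  using assms unfolding decomposes_into_def by (auto simp: sum_lessThan_split)

lemma character_decomposes:
  assumes H: "subgroup H G" and \<rho>: "matrix_rep G H n \<rho>"
  shows "\<exists>N d \<sigma>. decomposes_into H \<rho> N d \<sigma> \<and> (n > 0 \<longrightarrow> N > 0)"
  using \<rho>
proof (induction n arbitrary: \<rho> rule: less_induct)
  case (less n)
  consider "n = 0" | "irreducible_on H n \<rho>" "n > 0" | "n > 0" "\<not> irreducible_on H n \<rho>" by blast
  thus ?case
  proof cases
    case 1
    have "decomposes_into H \<rho> 0 d \<sigma>" for d \<sigma>
      using matrix_rep_carrier[OF less.prems] 1
      by (auto simp: decomposes_into_def mat_trace_eq[of _ 0 0])
    thus ?thesis using 1 by blast
  next
    case 2
    hence "decomposes_into H \<rho> 1 (\<lambda>_. n) (\<lambda>_. \<rho>)"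
      using less.prems by (simp add: decomposes_into_def)
    moreover have "(0::nat) < 1" by simp
    ultimately show ?thesis by blast
  next
    case 3
    obtain r s \<rho>\<^sub>1 \<rho>\<^sub>2 where rs: "0 < r" "0 < s" "n = r + s" "matrix_rep G H r \<rho>\<^sub>1" "matrix_rep G H s \<rho>\<^sub>2"
      "\<And>h. h \<in> H \<Longrightarrow> mat_trace (\<rho> h) = mat_trace (\<rho>\<^sub>1 h) + mat_trace (\<rho>\<^sub>2 h)"
      using reducible_imp_character_sum[OF less.prems H 3] by metis
    obtain N1 d1 \<sigma>1 where 1: "decomposes_into H \<rho>\<^sub>1 N1 d1 \<sigma>1" "N1 > 0"
      using less.IH[OF _ rs(4)] rs by auto
    obtain N2 d2 \<sigma>2 where 2: "decomposes_into H \<rho>\<^sub>2 N2 d2 \<sigma>2" "N2 > 0"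
      using less.IH[OF _ rs(5)] rs by auto
    have "N1 + N2 > 0" using 1(2) by simp
    thus ?thesis using decomposes_into_add[OF 1(1) 2(1) rs(6)] by blast
  qed
qed

text \<open>The mean of \<open>|\<chi>|\<^sup>2\<close> is at least \<open>N\<close> when \<open>\<chi>\<close> is a sum of \<open>N\<close> irreducible characters.\<close>

lemma norm_one_imp_irreducible_on:
  assumes fin: "finite (carrier G)" and H: "subgroup H G" and \<rho>: "matrix_rep G H n \<rho>" "n > 0"
    and norm: "(\<Sum>h\<in>H. mat_trace (\<rho> h) * cnj (mat_trace (\<rho> h))) = of_nat (card H)"
  shows "irreducible_on H n \<rho>"
proof (rule ccontr)
  assume red: "\<not> irreducible_on H n \<rho>"
  obtain r s \<rho>\<^sub>1 \<rho>\<^sub>2 where rs: "0 < r" "0 < s" "matrix_rep G H r \<rho>\<^sub>1" "matrix_rep G H s \<rho>\<^sub>2"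
      "\<And>h. h \<in> H \<Longrightarrow> mat_trace (\<rho> h) = mat_trace (\<rho>\<^sub>1 h) + mat_trace (\<rho>\<^sub>2 h)"
    using reducible_imp_character_sum[OF \<rho>(1) H \<rho>(2) red] by metis
  obtain N1 d1 \<sigma>1 where 1: "decomposes_into H \<rho>\<^sub>1 N1 d1 \<sigma>1" "N1 > 0"
    using character_decomposes[OF H rs(3)] rs by auto
  obtain N2 d2 \<sigma>2 where 2: "decomposes_into H \<rho>\<^sub>2 N2 d2 \<sigma>2" "N2 > 0"
    using character_decomposes[OF H rs(4)] rs by auto
  obtain N d \<sigma> where dec: "decomposes_into H \<rho> N d \<sigma>" and N: "N \<ge> 2"
  proof
    show "decomposes_into H \<rho> (N1 + N2) (\<lambda>s. if s < N1 then d1 s else d2 (s - N1))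
        (\<lambda>s. if s < N1 then \<sigma>1 s else \<sigma>2 (s - N1))"
      using 1(1) 2(1) rs(5) by (rule decomposes_into_add)
  qed (use 1(2) 2(2) in simp)
  define \<chi> where "\<chi> s h = mat_trace (\<sigma> s h)" for s h
  define e where "e s t = (if \<forall>h\<in>H. \<chi> s h = \<chi> t h then 1 else 0 :: nat)" for s t
  have ip: "(\<Sum>h\<in>H. \<chi> s h * cnj (\<chi> t h)) = of_nat (card H * e s t)" if "s < N" "t < N" for s t
    using character_inner_product[OF fin H, of "d s" "\<sigma> s" "d t" "\<sigma> t"] dec that
    by (auto simp: decomposes_into_def \<chi>_def e_def)
  have "(\<Sum>h\<in>H. mat_trace (\<rho> h) * cnj (mat_trace (\<rho> h)))
      = (\<Sum>h\<in>H. \<Sum>s<N. \<Sum>t<N. \<chi> s h * cnj (\<chi> t h))"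
    using dec by (intro sum.cong refl) (simp add: decomposes_into_def \<chi>_def sum_product)
  also have "\<dots> = (\<Sum>s<N. \<Sum>t<N. \<Sum>h\<in>H. \<chi> s h * cnj (\<chi> t h))"
    by (simp only: sum.swap[where A = H])
  also have "\<dots> = (\<Sum>s<N. \<Sum>t<N. of_nat (card H * e s t))"
    using ip by (intro sum.cong refl) auto
  finally have "complex_of_nat (card H) = of_nat (card H * (\<Sum>s<N. \<Sum>t<N. e s t))"
    using norm by (simp add: sum_distrib_left)
  hence "card H = card H * (\<Sum>s<N. \<Sum>t<N. e s t)" by (simp only: of_nat_eq_iff)
  moreover have "card H > 0"
    using fin subgroup.subset[OF H] subgroup.one_closed[OF H] by (auto simp: card_gt_0_iff intro: finite_subset)
  ultimately have "(\<Sum>s<N. \<Sum>t<N. e s t) = 1" by simp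
  moreover have "(\<Sum>s<N. \<Sum>t<N. e s t) \<ge> (\<Sum>s<N. 1)"
  proof (rule sum_mono)
    fix s assume "s \<in> {..<N}"
    hence "e s s \<le> (\<Sum>t<N. e s t)" by (intro member_le_sum) auto
    thus "1 \<le> (\<Sum>t<N. e s t)" by (simp add: e_def)
  qed
  ultimately show False using N by simp
qed


section \<open>Conjugation, cosets and commutators\<close>

lemma conj_mult:
  assumes "y \<in> carrier G" "a \<in> carrier G" "b \<in> carrier G"
  shows "inv y \<otimes> (a \<otimes> b) \<otimes> y = (inv y \<otimes> a \<otimes> y) \<otimes> (inv y \<otimes> b \<otimes> y)"
proof -
  have "y \<otimes> (inv y \<otimes> (b \<otimes> y)) = b \<otimes> y" using assms by (simp flip: m_assoc)
  thus ?thesis using assms by (simp add: m_assoc)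
qed

lemma conj_conj:
  assumes "x \<in> carrier G" "y \<in> carrier G" "a \<in> carrier G"
  shows "inv (x \<otimes> y) \<otimes> a \<otimes> (x \<otimes> y) = inv y \<otimes> (inv x \<otimes> a \<otimes> x) \<otimes> y"
  using assms by (simp add: inv_mult_group m_assoc)

lemma conj_pow_closed:
  assumes "x \<in> carrier G" "N \<subseteq> carrier G" "\<And>n. n \<in> N \<Longrightarrow> inv x \<otimes> n \<otimes> x \<in> N" "n \<in> N"
  shows "inv (x [^] (j::nat)) \<otimes> n \<otimes> x [^] j \<in> N"
proof (induction j)
  case 0
  show ?case using assms by auto
next
  case (Suc j)
  have "n \<in> carrier G" using assms by auto
  hence "inv (x [^] Suc j) \<otimes> n \<otimes> x [^] Suc j = inv x \<otimes> (inv (x [^] j) \<otimes> n \<otimes> x [^] j) \<otimes> x"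
    using conj_conj[of "x [^] j" x n] assms(1) by simp
  thus ?case using Suc assms(3) by simp
qed

text \<open>The cosets \<open>x\<^sup>iN\<close> multiply like the powers of \<open>x\<close>, because \<open>x\<close> normalises \<open>N\<close>.\<close>

lemma pow_coset_mult:
  fixes i j :: nat
  assumes x: "x \<in> carrier G" and N: "subgroup N G"
    and norm: "\<And>n. n \<in> N \<Longrightarrow> inv x \<otimes> n \<otimes> x \<in> N"
    and c: "h1 \<in> carrier G" "h2 \<in> carrier G"
    and ij: "inv (x [^] i) \<otimes> h1 \<in> N" "inv (x [^] j) \<otimes> h2 \<in> N"
  shows "inv (x [^] (i + j)) \<otimes> (h1 \<otimes> h2) \<in> N"
proof -
  let ?n = "inv (x [^] i) \<otimes> h1"
  have "x [^] j \<otimes> (inv (x [^] j) \<otimes> h2) = h2" using x c by (simp flip: m_assoc)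
  hence "inv (x [^] (i + j)) \<otimes> (h1 \<otimes> h2)
      = (inv (x [^] j) \<otimes> ?n \<otimes> x [^] j) \<otimes> (inv (x [^] j) \<otimes> h2)"
    using x c by (simp add: nat_pow_mult[symmetric] inv_mult_group m_assoc)
  also have "\<dots> \<in> N"
    using conj_pow_closed[OF x subgroup.subset[OF N] norm ij(1)] ij(2) subgroup.m_closed[OF N] by blast
  finally show ?thesis .
qed

lemma generate_insert_normalized:
  assumes fin: "finite (carrier G)" and N: "subgroup N G" and x: "x \<in> carrier G"
    and norm: "\<And>n. n \<in> N \<Longrightarrow> inv x \<otimes> n \<otimes> x \<in> N"
    and h: "h \<in> generate G (insert x N)"
  shows "\<exists>i::nat. inv (x [^] i) \<otimes> h \<in> N"
proof -
  note Nc = subgroup.mem_carrier[OF N] subgroup.m_closed[OF N] subgroup.m_inv_closed[OF N] subgroup.one_closed[OF N]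
  have gc: "h \<in> carrier G" if "h \<in> generate G (insert x N)" for h
    using generate_in_carrier[OF _ that] x subgroup.subset[OF N] by auto
  show ?thesis using h
  proof (induction h rule: generate.induct)
    case one
    show ?case using Nc(4) by (intro exI[of _ 0]) simp
  next
    case (incl h)
    show ?case
    proof (cases "h = x")
      case True
      thus ?thesis using Nc(4) x by (intro exI[of _ 1]) simp
    next
      case False
      thus ?thesis using incl Nc(1) by (intro exI[of _ 0]) auto
    qed
  next
    case (inv h)
    show ?case
    proof (cases "h = x")
      case True
      have pos: "Coset.order G > 0" using fin by (simp add: order_gt_0_iff_finite)
      have "x [^] (Coset.order G - 1) \<otimes> x = x [^] Suc (Coset.order G - 1)" by simp
      also have "\<dots> = \<one>" using pos pow_order_eq_1[OF x] by simp
      finally have "inv x = x [^] (Coset.order G - 1)" using x by (intro inv_equality) auto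
      thus ?thesis using True Nc(4) x
        by (intro exI[of _ "Coset.order G - 1"]) (simp add: l_inv)
    next
      case False
      thus ?thesis using inv Nc by (intro exI[of _ 0]) auto
    qed
  next
    case (eng h1 h2)
    obtain i j :: nat where ij: "inv (x [^] i) \<otimes> h1 \<in> N" "inv (x [^] j) \<otimes> h2 \<in> N" using eng by blast
    have c: "h1 \<in> carrier G" "h2 \<in> carrier G" using gc eng.hyps by auto
    show ?case using pow_coset_mult[OF x N norm c ij] by blast
  qed
qed

lemma sum_over_cosets:
  assumes "finite K" "subgroup K G" "subgroup L G" "L \<subseteq> K"
  shows "(\<Sum>k\<in>K. \<Sum>l\<in>L. f (k \<otimes> l)) = of_nat (card L) * (\<Sum>k\<in>K. f k :: 'c :: semiring_1)"
proof -
  have "(\<Sum>k\<in>K. \<Sum>l\<in>L. f (k \<otimes> l)) = (\<Sum>l\<in>L. \<Sum>k\<in>K. f (k \<otimes> l))" by (rule sum.swap)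
  also have "\<dots> = (\<Sum>l\<in>L. \<Sum>k\<in>K. f k)"
  proof (rule sum.cong[OF refl])
    fix l assume "l \<in> L"
    hence l: "l \<in> K" "inv l \<in> K" "l \<in> carrier G"
      using assms subgroup.m_inv_closed[OF assms(2)] subgroup.mem_carrier[OF assms(2)] by auto
    show "(\<Sum>k\<in>K. f (k \<otimes> l)) = (\<Sum>k\<in>K. f k)"
      using l subgroup.mem_carrier[OF assms(2)] subgroup.m_closed[OF assms(2)]
      by (intro sum.reindex_bij_witness[of _ "\<lambda>k. k \<otimes> inv l" "\<lambda>k. k \<otimes> l"]) (auto simp: m_assoc)
  qed
  finally show ?thesis by simp
qed

lemma conj_derived_closed:
  assumes K: "subgroup K G" and y: "y \<in> carrier G" and norm: "\<And>k. k \<in> K \<Longrightarrow> inv y \<otimes> k \<otimes> y \<in> K"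
    and l: "l \<in> derived G K"
  shows "inv y \<otimes> l \<otimes> y \<in> derived G K"
proof -
  have "group_hom G G (\<lambda>a. inv y \<otimes> a \<otimes> y)"
    using y by unfold_locales (auto simp: hom_def conj_mult)
  hence "(\<lambda>a. inv y \<otimes> a \<otimes> y) ` derived G K = derived G ((\<lambda>a. inv y \<otimes> a \<otimes> y) ` K)"
    using group_hom.derived_img[OF _ subgroup.subset[OF K]] by metis
  also have "\<dots> \<subseteq> derived G K" using norm by (intro mono_derived) auto
  finally show ?thesis using l by blast
qed

lemma conj_subgroup_closed:
  assumes "subgroup K G" "x \<in> K" "k \<in> K"
  shows "inv x \<otimes> k \<otimes> x \<in> K"
  using assms by (simp add: subgroup.m_closed subgroup.m_inv_closed)

lemma commutator_in_derived:
  assumes "a \<in> K" "b \<in> K"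
  shows "a \<otimes> b \<otimes> inv a \<otimes> inv b \<in> derived G K"
  unfolding derived_def using assms by (intro generate.incl) blast

text \<open>If \<open>y\<close> normalises \<open>K\<close>, the quotient of \<open>K\<close> by this subgroup is the largest abelian quotient of
  \<open>K\<close> on which \<open>y\<close> acts trivially.\<close>

definition commutators_with :: "'a \<Rightarrow> 'a set \<Rightarrow> 'a set" where
  "commutators_with y K = generate G (derived G K \<union> (\<lambda>x. (inv y \<otimes> x \<otimes> y) \<otimes> inv x) ` K)"

text \<open>Conjugation by \<open>x \<in> K\<close> maps the coset \<open>ykL\<close> onto \<open>yk(y\<inverse>xyx\<inverse>)L\<close>, where \<open>L = K'\<close>, and it preserves \<open>f\<close>.
  So the sum of \<open>f\<close> over \<open>ykL\<close> does not change when \<open>k\<close> is multiplied by one of the elements that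
  generate \<open>commutators_with y K\<close>, and these generate all of \<open>K\<close>.\<close>

lemma coset_sum_constant:
  assumes fin: "finite (carrier G)" and K: "subgroup K G" and y: "y \<in> carrier G"
    and norm: "\<And>k. k \<in> K \<Longrightarrow> inv y \<otimes> k \<otimes> y \<in> K"
    and gen: "K \<subseteq> commutators_with y K"
    and class_fun: "\<And>x k. x \<in> K \<Longrightarrow> k \<in> K \<Longrightarrow> f (x \<otimes> (y \<otimes> k) \<otimes> inv x) = (f (y \<otimes> k) :: 'c :: comm_semiring_1)"
    and k: "k \<in> K"
  shows "(\<Sum>l\<in>derived G K. f (y \<otimes> (k \<otimes> l))) = (\<Sum>l\<in>derived G K. f (y \<otimes> l))"
proof -
  let ?L = "derived G K"
  note Kc = subgroup.mem_carrier[OF K] subgroup.m_closed[OF K] subgroup.m_inv_closed[OF K] subgroup.one_closed[OF K]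
  have L: "subgroup ?L G" "?L \<subseteq> K"
    using derived_is_subgroup[OF subgroup.subset[OF K]] derived_incl[OF order_refl K] by auto
  note Lc = subgroup.mem_carrier[OF L(1)] subgroup.m_closed[OF L(1)] subgroup.m_inv_closed[OF L(1)]
  have finL: "finite ?L" using fin subgroup.subset[OF L(1)] by (rule rev_finite_subset)
  define s where "s k = (\<Sum>l\<in>?L. f (y \<otimes> (k \<otimes> l)))" for k
  have base: "h \<in> K \<and> (\<forall>k'\<in>K. s (k' \<otimes> h) = s k')"
    if "h \<in> ?L \<union> (\<lambda>x. (inv y \<otimes> x \<otimes> y) \<otimes> inv x) ` K" for h
  using that
  proof
    assume h: "h \<in> ?L"
    show ?thesis
    proof (intro conjI ballI)
      show "h \<in> K" using h L by auto
      fix k' assume k': "k' \<in> K"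
      show "s (k' \<otimes> h) = s k'"
        unfolding s_def using h k' Lc Kc
        by (intro sum.reindex_bij_witness[of _ "\<lambda>l. inv h \<otimes> l" "\<lambda>l. h \<otimes> l"])
           (auto simp: m_assoc simp flip: m_assoc[of h "inv h"] m_assoc[of "inv h" h])
    qed
  next
    assume "h \<in> (\<lambda>x. (inv y \<otimes> x \<otimes> y) \<otimes> inv x) ` K"
    then obtain x where x: "x \<in> K" and h: "h = (inv y \<otimes> x \<otimes> y) \<otimes> inv x" by blast
    define a where "a = inv y \<otimes> x \<otimes> y"
    have a: "a \<in> K" using norm x by (simp add: a_def)
    have hK: "h \<in> K" using a x Kc by (simp add: h a_def)
    show ?thesis
    proof (intro conjI ballI)
      fix k' assume k': "k' \<in> K"
      note cc = Kc(1)[OF x] Kc(1)[OF a] Kc(1)[OF k'] Kc(1)[OF hK] y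
      \<comment> \<open>Conjugation by \<open>x\<close> sends \<open>y k' l\<close> to \<open>y k' h (\<phi> l)\<close>.\<close>
      define \<phi> where "\<phi> l = x \<otimes> (inv a \<otimes> inv k' \<otimes> a \<otimes> k' \<otimes> l) \<otimes> inv x" for l
      have \<phi>L: "\<phi> l \<in> ?L" if "l \<in> ?L" for l
      proof -
        have "inv a \<otimes> inv k' \<otimes> a \<otimes> k' \<in> ?L"
          using commutator_in_derived[of "inv a" K "inv k'"] a k' Kc cc by simp
        hence "inv a \<otimes> inv k' \<otimes> a \<otimes> k' \<otimes> l \<in> ?L" using that Lc by blast
        hence "inv (inv x) \<otimes> (inv a \<otimes> inv k' \<otimes> a \<otimes> k' \<otimes> l) \<otimes> inv x \<in> ?L"
          using conj_derived_closed[OF K, of "inv x"] conj_subgroup_closed[OF K, of "inv x"] x Kc cc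
          by blast
        thus ?thesis using cc by (simp add: \<phi>_def)
      qed
      have inj: "inj_on \<phi> ?L"
      proof (rule inj_onI)
        fix l l' assume l: "l \<in> ?L" "l' \<in> ?L" "\<phi> l = \<phi> l'"
        hence lc: "l \<in> carrier G" "l' \<in> carrier G" using Lc by auto
        thus "l = l'" using l(3) cc unfolding \<phi>_def by simp
      qed
      have img: "\<phi> ` ?L = ?L" using endo_inj_surj[OF finL _ inj] \<phi>L by blast
      have "f (y \<otimes> (k' \<otimes> l)) = f (y \<otimes> (k' \<otimes> h \<otimes> \<phi> l))" if l: "l \<in> ?L" for l
      proof -
        have lc: "l \<in> carrier G" "l \<in> K" using l Lc L by auto
        have ya: "y \<otimes> a = x \<otimes> y" using cc by (simp add: a_def m_assoc flip: m_assoc[of y "inv y"])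
        have "k' \<otimes> h \<otimes> \<phi> l = a \<otimes> (k' \<otimes> l) \<otimes> inv x"
        proof -
          have 1: "inv x \<otimes> (x \<otimes> z) = z" "a \<otimes> (inv a \<otimes> z) = z" "k' \<otimes> (inv k' \<otimes> z) = z" if "z \<in> carrier G" for z
            using that cc by (simp_all flip: m_assoc)
          show ?thesis unfolding \<phi>_def h a_def[symmetric] using cc lc by (simp add: m_assoc 1)
        qed
        hence "y \<otimes> (k' \<otimes> h \<otimes> \<phi> l) = y \<otimes> a \<otimes> ((k' \<otimes> l) \<otimes> inv x)"
          using cc lc by (simp add: m_assoc)
        also have "\<dots> = x \<otimes> (y \<otimes> (k' \<otimes> l)) \<otimes> inv x"
          unfolding ya using cc lc by (simp add: m_assoc)
        finally show ?thesis using class_fun[OF x, of "k' \<otimes> l"] Kc(2)[OF k' lc(2)] by simp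
      qed
      hence "s k' = (\<Sum>l\<in>?L. f (y \<otimes> (k' \<otimes> h \<otimes> \<phi> l)))" unfolding s_def by (rule sum.cong[OF refl])
      also have "\<dots> = (\<Sum>l\<in>\<phi> ` ?L. f (y \<otimes> (k' \<otimes> h \<otimes> l)))" by (simp add: sum.reindex[OF inj])
      also have "\<dots> = s (k' \<otimes> h)" unfolding img s_def ..
      finally show "s (k' \<otimes> h) = s k'" ..
    qed (rule hK)
  qed
  have "k \<in> K \<and> (\<forall>k'\<in>K. s (k' \<otimes> k) = s k')"
    if "k \<in> generate G (?L \<union> (\<lambda>x. (inv y \<otimes> x \<otimes> y) \<otimes> inv x) ` K)" for k
    using that
  proof (induction k rule: generate.induct)
    case one
    show ?case using Kc by simp
  next
    case (incl h)
    thus ?case by (rule base)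
  next
    case (inv h)
    hence h: "h \<in> K" "\<And>k'. k' \<in> K \<Longrightarrow> s (k' \<otimes> h) = s k'" using base by auto
    have "s (k' \<otimes> inv h) = s k'" if "k' \<in> K" for k'
    proof -
      have "(k' \<otimes> inv h) \<otimes> h = k'" using that h Kc by (simp add: m_assoc)
      thus ?thesis using h(2)[OF Kc(2)[OF that Kc(3)[OF h(1)]]] by simp
    qed
    thus ?case using Kc(3)[OF h(1)] by simp
  next
    case (eng h1 h2)
    hence h: "h1 \<in> K" "h2 \<in> K" "\<And>k'. k' \<in> K \<Longrightarrow> s (k' \<otimes> h1) = s k'"
      "\<And>k'. k' \<in> K \<Longrightarrow> s (k' \<otimes> h2) = s k'" by auto
    have "s (k' \<otimes> (h1 \<otimes> h2)) = s k'" if "k' \<in> K" for k'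
    proof -
      have assoc: "k' \<otimes> (h1 \<otimes> h2) = (k' \<otimes> h1) \<otimes> h2" using that h Kc by (simp add: m_assoc)
      show ?thesis unfolding assoc h(4)[OF Kc(2)[OF that h(1)]] h(3)[OF that] ..
    qed
    thus ?case using Kc(2)[OF h(1,2)] by simp
  qed
  hence "s (\<one> \<otimes> k) = s \<one>" using gen k Kc(4) unfolding commutators_with_def by blast
  thus ?thesis using Kc(1)[OF k] Lc(1) by (simp add: s_def)
qed


section \<open>Characters stable under a linear twist\<close>

lemma coset_sum_average:
  fixes f :: "'a \<Rightarrow> complex"
  assumes fin: "finite (carrier G)" and K: "subgroup K G" and y: "y \<in> carrier G"
    and norm: "\<And>k. k \<in> K \<Longrightarrow> inv y \<otimes> k \<otimes> y \<in> K"
    and gen: "K \<subseteq> commutators_with y K"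
    and class_fun: "\<And>x k. x \<in> K \<Longrightarrow> k \<in> K \<Longrightarrow> f (x \<otimes> (y \<otimes> k) \<otimes> inv x) = f (y \<otimes> k)"
  shows "of_nat (card (derived G K)) * (\<Sum>k\<in>K. f (y \<otimes> k)) = of_nat (card K) * (\<Sum>l\<in>derived G K. f (y \<otimes> l))"
proof -
  have L: "subgroup (derived G K) G" "derived G K \<subseteq> K"
    using derived_is_subgroup[OF subgroup.subset[OF K]] derived_incl[OF order_refl K] by auto
  have finK: "finite K" using fin subgroup.subset[OF K] by (rule rev_finite_subset)
  have "of_nat (card (derived G K)) * (\<Sum>k\<in>K. f (y \<otimes> k)) = (\<Sum>k\<in>K. \<Sum>l\<in>derived G K. f (y \<otimes> (k \<otimes> l)))"
    using sum_over_cosets[OF finK K L, of "\<lambda>k. f (y \<otimes> k)"] by simp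
  also have "\<dots> = (\<Sum>k\<in>K. \<Sum>l\<in>derived G K. f (y \<otimes> l))"
    by (rule sum.cong[OF refl], rule coset_sum_constant[OF fin K y norm gen class_fun])
  finally show ?thesis by simp
qed

text \<open>Modulo the right-hand side \<open>y\<close> acts trivially on \<open>K\<close>, hence so does each power of \<open>y\<close>.\<close>

lemma commutators_with_power:
  assumes K: "subgroup K G" and y: "y \<in> carrier G"
    and norm: "\<And>k. k \<in> K \<Longrightarrow> inv y \<otimes> k \<otimes> y \<in> K"
  shows "commutators_with (y [^] (i::nat)) K \<subseteq> commutators_with y K"
proof -
  let ?E = "commutators_with y K"
  note Kc = subgroup.mem_carrier[OF K] subgroup.m_inv_closed[OF K]
  have sub: "derived G K \<union> (\<lambda>x. (inv y \<otimes> x \<otimes> y) \<otimes> inv x) ` K \<subseteq> carrier G"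
    using derived_in_carrier[OF subgroup.subset[OF K]] Kc y by auto
  have E: "subgroup ?E G" unfolding commutators_with_def by (rule generate_is_subgroup[OF sub])
  have com: "(inv (y [^] i) \<otimes> x \<otimes> y [^] i) \<otimes> inv x \<in> ?E" if x: "x \<in> K" for x
  proof (induction i)
    case 0
    show ?case using x Kc subgroup.one_closed[OF E] by simp
  next
    case (Suc i)
    let ?z = "inv (y [^] i) \<otimes> x \<otimes> y [^] i"
    have z: "?z \<in> K" by (rule conj_pow_closed[OF y subgroup.subset[OF K] norm x])
    have step: "inv (y [^] Suc i) \<otimes> x \<otimes> y [^] Suc i = inv y \<otimes> ?z \<otimes> y"
      using conj_conj[of "y [^] i" y x] Kc(1)[OF x] y by simp
    have c: "inv y \<otimes> ?z \<otimes> y \<in> carrier G" "?z \<in> carrier G" "inv x \<in> carrier G"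
      using Kc(1)[OF norm[OF z]] Kc(1)[OF z] Kc(1)[OF Kc(2)[OF x]] .
    have cancel: "(a \<otimes> inv b) \<otimes> (b \<otimes> d) = a \<otimes> d"
      if "a \<in> carrier G" "b \<in> carrier G" "d \<in> carrier G" for a b d
      using that by (simp add: m_assoc flip: m_assoc[of "inv b" b d])
    have "(inv y \<otimes> ?z \<otimes> y) \<otimes> inv ?z \<in> ?E"
      unfolding commutators_with_def using z by (intro generate.incl) blast
    hence "((inv y \<otimes> ?z \<otimes> y) \<otimes> inv ?z) \<otimes> (?z \<otimes> inv x) \<in> ?E"
      using Suc subgroup.m_closed[OF E] by blast
    thus ?case unfolding step cancel[OF c] .
  qed
  have "derived G K \<subseteq> ?E" unfolding commutators_with_def by (auto intro: generate.incl)
  hence "derived G K \<union> (\<lambda>x. (inv (y [^] i) \<otimes> x \<otimes> y [^] i) \<otimes> inv x) ` K \<subseteq> ?E"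
    using com by blast
  thus ?thesis unfolding commutators_with_def[of "y [^] i"] by (rule generate_subgroup_incl[OF _ E])
qed

text \<open>The character identity \<open>stab\<close> yields an intertwiner \<open>T\<close> between \<open>\<rho>\<close> and its twist by \<open>\<nu>\<close>.  As
  \<open>\<nu>\<close> is \<open>g\<close>-invariant, conjugating \<open>T\<close> by \<open>\<rho>(g)\<close> gives another one, which by Schur's lemma is \<open>cT\<close>.
  Conjugating \<open>\<rho>(gk)\<close> by \<open>T\<close> and taking traces gives \<open>c \<chi>(gk) = \<nu>(k) \<chi>(gk)\<close>, and \<open>\<nu>\<close> takes the value
  \<open>c\<close> on at most half of \<open>K\<close>.\<close>

lemma twist_invariant_character_zeros:
  assumes fin: "finite (carrier G)" and H: "subgroup H G" and K: "subgroup K G" "K \<subseteq> H" and g: "g \<in> H"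
    and norm: "\<And>k. k \<in> K \<Longrightarrow> inv g \<otimes> k \<otimes> g \<in> K"
    and \<rho>: "matrix_rep G H n \<rho>" "irreducible_on K n \<rho>"
    and \<nu>: "\<nu> \<one> = 1" "\<And>x y. x \<in> K \<Longrightarrow> y \<in> K \<Longrightarrow> \<nu> (x \<otimes> y) = \<nu> x * \<nu> y"
    and inv: "\<And>k. k \<in> K \<Longrightarrow> \<nu> (inv g \<otimes> k \<otimes> g) = \<nu> k"
    and stab: "\<And>k. k \<in> K \<Longrightarrow> \<nu> k * mat_trace (\<rho> k) = mat_trace (\<rho> k)"
    and nontriv: "k\<^sub>0 \<in> K" "\<nu> k\<^sub>0 \<noteq> 1"
  shows "card K \<le> 2 * card {k \<in> K. mat_trace (\<rho> (g \<otimes> k)) = 0}"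
proof -
  note Kc = subgroup.mem_carrier[OF K(1)] subgroup.m_closed[OF K(1)] subgroup.m_inv_closed[OF K(1)]
  have finK: "finite K" using fin subgroup.subset[OF K(1)] by (rule rev_finite_subset)
  have ginv: "inv g \<in> H" "g \<in> carrier G" using subgroup.m_inv_closed[OF H g] subgroup.mem_carrier[OF H g] .
  have \<rho>c: "\<rho> h \<in> carrier_mat n n" if "h \<in> H" for h using matrix_rep_carrier[OF \<rho>(1) that] .
  have \<rho>K: "\<rho> k \<in> carrier_mat n n" if "k \<in> K" for k using \<rho>c K(2) that by blast
  have \<rho>rep: "matrix_rep G K n \<rho>" using matrix_rep_subset[OF \<rho>(1) K(2)] .
  have \<nu>nz: "\<nu> k \<noteq> 0" if "k \<in> K" for k
    using \<nu>(2)[OF that Kc(3)[OF that]] \<nu>(1) Kc(1)[OF that] by auto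
  have same: "mat_trace (\<nu> k \<cdot>\<^sub>m \<rho> k) = mat_trace (\<rho> k)" if "k \<in> K" for k
    using stab[OF that] mat_trace_smult[OF \<rho>K[OF that]] by simp
  obtain T Z where TZ: "T \<in> carrier_mat n n" "Z \<in> carrier_mat n n" "T * Z = 1\<^sub>m n" "Z * T = 1\<^sub>m n"
    and inter: "\<And>k. k \<in> K \<Longrightarrow> (\<nu> k \<cdot>\<^sub>m \<rho> k) * T = T * \<rho> k"
    by (rule same_character_imp_equivalent[OF fin K(1) matrix_rep_twist[OF \<rho>rep \<nu>]
          irreducible_on_twist[OF \<rho>(2) \<rho>K \<nu>nz] \<rho>rep \<rho>(2) same])
      (assumption+, rule that)
  note assoc = assoc_mult_mat[of _ n n _ n _ n]
  note smult = mult_smult_distrib[of _ n n _ n] mult_smult_assoc_mat[of _ n n _ n]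
  define A where "A = \<rho> g"
  define A' where "A' = \<rho> (inv g)"
  have AA': "A \<in> carrier_mat n n" "A' \<in> carrier_mat n n" "A' * A = 1\<^sub>m n"
    using \<rho>c[OF g] \<rho>c[OF ginv(1)] matrix_rep_inv(2)[OF H \<rho>(1) g] by (auto simp: A_def A'_def)
  note carriers = TZ(1,2) AA'(1,2) mult_carrier_mat[of _ n n _ n] left_mult_one_mat[of _ n n] right_mult_one_mat[of _ n n]
  have TR: "T * \<rho> k = \<nu> k \<cdot>\<^sub>m (\<rho> k * T)" if k: "k \<in> K" for k
    unfolding inter[OF k, symmetric] by (rule mult_smult_assoc_mat[OF \<rho>K[OF k] TZ(1)])
  have RT: "\<rho> k * T = inverse (\<nu> k) \<cdot>\<^sub>m (T * \<rho> k)" if k: "k \<in> K" for k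
    unfolding TR[OF k] using \<nu>nz[OF k] by (intro eq_matI) auto
  define U where "U = A * T * A'"
  have U: "U \<in> carrier_mat n n" by (simp add: U_def carriers)
  \<comment> \<open>\<open>U\<close> has the same intertwining property as \<open>T\<close>, so \<open>Z * U\<close> commutes with \<open>\<rho>\<close>.\<close>
  have U_inter: "\<rho> k * U = inverse (\<nu> k) \<cdot>\<^sub>m (U * \<rho> k)" if k: "k \<in> K" for k
  proof -
    define k' where "k' = inv g \<otimes> k \<otimes> g"
    have k': "k' \<in> K" "k' \<in> H" "k \<in> H" using k K(2) norm[OF k] by (auto simp: k'_def)
    have \<nu>k': "\<nu> k' = \<nu> k" unfolding k'_def by (rule inv[OF k])
    have kc: "k \<in> carrier G" using Kc(1)[OF k] .
    have "k \<otimes> g = g \<otimes> k'" using kc ginv(2) by (simp add: k'_def m_assoc[symmetric])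
    hence RA: "\<rho> k * A = A * \<rho> k'"
      unfolding A_def using matrix_rep_mult[OF \<rho>(1) k'(3) g] matrix_rep_mult[OF \<rho>(1) g k'(2)] by simp
    have "k' \<otimes> inv g = inv g \<otimes> k" using kc ginv(2) by (simp add: k'_def m_assoc)
    hence AR: "\<rho> k' * A' = A' * \<rho> k"
      unfolding A'_def using matrix_rep_mult[OF \<rho>(1) k'(2) ginv(1)] matrix_rep_mult[OF \<rho>(1) ginv(1) k'(3)]
      by simp
    note cs = carriers \<rho>K[OF k] \<rho>K[OF k'(1)]
    have "\<rho> k * U = (\<rho> k * A) * (T * A')" by (simp add: U_def assoc cs)
    also have "\<dots> = A * ((\<rho> k' * T) * A')" unfolding RA by (simp add: assoc cs)
    also have "\<dots> = inverse (\<nu> k) \<cdot>\<^sub>m (A * (T * (\<rho> k' * A')))"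
      unfolding RT[OF k'(1)] \<nu>k' by (simp add: assoc smult cs)
    also have "\<dots> = inverse (\<nu> k) \<cdot>\<^sub>m (U * \<rho> k)"
      unfolding AR by (simp add: U_def assoc cs)
    finally show ?thesis .
  qed
  have comm: "\<rho> k * (Z * U) = (Z * U) * \<rho> k" if k: "k \<in> K" for k
  proof -
    note cs = carriers U \<rho>K[OF k]
    have "\<rho> k * Z = (Z * T) * (\<rho> k * Z)" using TZ(4) by (simp add: cs)
    also have "\<dots> = Z * ((T * \<rho> k) * Z)" by (simp add: assoc cs)
    also have "\<dots> = \<nu> k \<cdot>\<^sub>m (Z * (\<rho> k * (T * Z)))"
      unfolding TR[OF k] by (simp add: assoc smult cs)
    also have "\<dots> = \<nu> k \<cdot>\<^sub>m (Z * \<rho> k)" using TZ(3) by (simp add: cs)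
    finally have RZ: "\<rho> k * Z = \<nu> k \<cdot>\<^sub>m (Z * \<rho> k)" .
    have "\<rho> k * (Z * U) = (\<rho> k * Z) * U" by (simp add: assoc cs)
    also have "\<dots> = \<nu> k \<cdot>\<^sub>m (Z * (\<rho> k * U))" unfolding RZ by (simp add: assoc smult cs)
    also have "\<dots> = \<nu> k \<cdot>\<^sub>m (inverse (\<nu> k) \<cdot>\<^sub>m ((Z * U) * \<rho> k))"
      unfolding U_inter[OF k] by (simp add: assoc smult cs)
    also have "\<dots> = (Z * U) * \<rho> k" using \<nu>nz[OF k] by (intro eq_matI) auto
    finally show ?thesis .
  qed
  obtain c where c: "Z * U = c \<cdot>\<^sub>m 1\<^sub>m n"
    using irreducible_on_commutant_scalar[OF \<rho>(2) \<rho>K mult_carrier_mat[OF TZ(2) U] comm] by blast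
  have AT: "A * T = c \<cdot>\<^sub>m (T * A)"
  proof -
    have "A * T = A * T * (A' * A)" using AA'(3) by (simp add: carriers)
    also have "\<dots> = (T * Z) * (U * A)" using TZ(3) by (simp add: U_def assoc carriers U)
    also have "\<dots> = T * ((Z * U) * A)" by (simp add: assoc carriers U)
    also have "\<dots> = c \<cdot>\<^sub>m (T * A)" unfolding c by (simp add: smult carriers)
    finally show ?thesis .
  qed
  have eigen: "c * mat_trace (\<rho> (g \<otimes> k)) = \<nu> k * mat_trace (\<rho> (g \<otimes> k))" if k: "k \<in> K" for k
  proof -
    note cs = carriers \<rho>K[OF k]
    have gk: "\<rho> (g \<otimes> k) = A * \<rho> k"
      unfolding A_def using matrix_rep_mult[OF \<rho>(1) g] k K(2) by blast
    have "\<nu> k \<cdot>\<^sub>m (A * \<rho> k) * T = A * (\<nu> k \<cdot>\<^sub>m (\<rho> k * T))" by (simp add: assoc smult cs)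
    also have "\<dots> = (A * T) * \<rho> k" unfolding TR[OF k, symmetric] by (simp add: assoc cs)
    also have "\<dots> = T * (c \<cdot>\<^sub>m (A * \<rho> k))" unfolding AT by (simp add: assoc smult cs)
    finally have "mat_trace (\<nu> k \<cdot>\<^sub>m (A * \<rho> k)) = mat_trace (c \<cdot>\<^sub>m (A * \<rho> k))"
      using TZ by (intro equivalent_imp_same_trace[of _ n _ n T Z]) (auto simp: cs)
    moreover have "A * \<rho> k \<in> carrier_mat n n" by (simp add: cs)
    ultimately show ?thesis by (auto simp: gk mat_trace_smult)
  qed
  define B where "B = {k \<in> K. \<nu> k = c}"
  have "card B \<le> card (K - B)"
  proof (rule card_inj_on_le[of "\<lambda>k. k\<^sub>0 \<otimes> k"])
    \<comment> \<open>Translation by \<open>k\<^sub>0\<close> moves the fibre \<open>\<nu> = c\<close> off itself.\<close>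
    show "inj_on (\<lambda>k. k\<^sub>0 \<otimes> k) B"
      using Kc(1) nontriv(1) by (intro inj_onI) (auto simp: B_def)
    show "(\<lambda>k. k\<^sub>0 \<otimes> k) ` B \<subseteq> K - B"
    proof clarify
      fix k assume "k \<in> B"
      hence k: "k \<in> K" "\<nu> k = c" by (auto simp: B_def)
      have "\<nu> (k\<^sub>0 \<otimes> k) \<noteq> c" using \<nu>(2)[OF nontriv(1) k(1)] k(2) \<nu>nz[OF k(1)] nontriv(2) by simp
      thus "k\<^sub>0 \<otimes> k \<in> K - B" using k nontriv(1) Kc by (auto simp: B_def)
    qed
  qed (use finK in auto)
  moreover have "card K = card B + card (K - B)"
    using finK card_Diff_subset[of B K] card_mono[of K B] by (auto simp: B_def)
  moreover have "card (K - B) \<le> card {k \<in> K. mat_trace (\<rho> (g \<otimes> k)) = 0}"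
    using eigen finK by (intro card_mono) (auto simp: B_def)
  ultimately show ?thesis by linarith
qed

end

section \<open>Cyclic extensions\<close>

text \<open>\<open>H = \<langle>x\<rangle>N\<close> with \<open>N\<close> normal of index \<open>r\<close>, and \<open>\<mu>\<close> is the linear character of \<open>H/N\<close> that sends \<open>x\<close> to
  the primitive \<open>r\<close>-th root of unity \<open>\<zeta>\<close>.\<close>

locale cyclic_extension = group G for G (structure) +
  fixes H N :: "'a set" and x :: 'a and r :: nat and \<zeta> :: complex and \<mu> :: "'a \<Rightarrow> complex"
  assumes finite_carrier: "finite (carrier G)"
    and H: "subgroup H G" and N: "subgroup N G" and N_le_H: "N \<subseteq> H" and x_in_H: "x \<in> H"
    and r_pos: "0 < r" and \<zeta>_pow: "\<And>i::nat. \<zeta> ^ i = 1 \<longleftrightarrow> r dvd i" and norm_\<zeta>: "norm \<zeta> = 1"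
    and \<mu>_mult: "\<And>h h'. h \<in> H \<Longrightarrow> h' \<in> H \<Longrightarrow> \<mu> (h \<otimes> h') = \<mu> h * \<mu> h'"
    and \<mu>_range: "\<And>h. h \<in> H \<Longrightarrow> \<exists>i. \<mu> h = \<zeta> ^ i"
    and \<mu>_coset: "\<And>h j. h \<in> H \<Longrightarrow> \<mu> h = \<zeta> ^ j \<longleftrightarrow> inv (x [^] j) \<otimes> h \<in> N"

lemma root_power_eq_iff:
  fixes \<zeta> :: complex
  assumes "\<And>i::nat. \<zeta> ^ i = 1 \<longleftrightarrow> r dvd i" "\<zeta> \<noteq> 0"
  shows "\<zeta> ^ i = \<zeta> ^ j \<longleftrightarrow> int r dvd int i - int j"
proof -
  have main: "\<zeta> ^ i = \<zeta> ^ j \<longleftrightarrow> int r dvd int i - int j" if "j \<le> i" for i j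
  proof -
    have "\<zeta> ^ i = \<zeta> ^ j * \<zeta> ^ (i - j)" using that by (simp flip: power_add)
    hence "\<zeta> ^ i = \<zeta> ^ j \<longleftrightarrow> r dvd i - j" using assms by simp
    also have "\<dots> \<longleftrightarrow> int r dvd int (i - j)" by (rule int_dvd_int_iff[symmetric])
    finally show ?thesis using that by (simp add: of_nat_diff)
  qed
  show ?thesis
  proof (cases "j \<le> i")
    case True
    thus ?thesis by (rule main)
  next
    case False
    have "int r dvd int i - int j \<longleftrightarrow> int r dvd int j - int i"
      using dvd_minus_iff[of "int r" "int i - int j"] by simp
    thus ?thesis using main[of i j] False by auto
  qed
qed

lemma (in group) cyclic_extension_exists:
  assumes fin: "finite (carrier G)" and H: "subgroup H G" and N: "subgroup N G" and sub: "N \<subseteq> H"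
    and x: "x \<in> H" and norm: "\<And>n. n \<in> N \<Longrightarrow> inv x \<otimes> n \<otimes> x \<in> N"
    and gen: "\<And>h. h \<in> H \<Longrightarrow> \<exists>i::nat. inv (x [^] i) \<otimes> h \<in> N"
  obtains r \<zeta> \<mu> where "cyclic_extension G H N x r \<zeta> \<mu>"
proof -
  have xc: "x \<in> carrier G" by (rule subgroup.mem_carrier[OF H x])
  note Nc = subgroup.mem_carrier[OF N] subgroup.m_closed[OF N] subgroup.m_inv_closed[OF N]
  define r where "r = (LEAST n::nat. 0 < n \<and> x [^] n \<in> N)"
  have "0 < Coset.order G \<and> x [^] Coset.order G \<in> N"
    using fin pow_order_eq_1[OF xc] subgroup.one_closed[OF N] by (simp add: order_gt_0_iff_finite)
  hence "0 < r \<and> x [^] r \<in> N" unfolding r_def by (rule LeastI[of "\<lambda>n::nat. 0 < n \<and> x [^] n \<in> N"])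
  hence r: "0 < r" "x [^] r \<in> N" by auto
  \<comment> \<open>Integer exponents let quotients of powers of \<open>x\<close> be treated uniformly.\<close>
  have pow_iff: "x [^] k \<in> N \<longleftrightarrow> int r dvd k" for k :: int
  proof
    assume "int r dvd k"
    then obtain q where "k = int r * q" by blast
    hence "x [^] k = (x [^] r) [^] q" using int_pow_pow[OF xc, of "int r" q] by (simp add: int_pow_int)
    thus "x [^] k \<in> N" using subgroup_int_pow_closed[OF N r(2)] by simp
  next
    assume k: "x [^] k \<in> N"
    define q where "q = int r * (k div int r)"
    have "x [^] q = (x [^] r) [^] (k div int r)"
      using int_pow_pow[OF xc, of "int r" "k div int r"] by (simp add: q_def int_pow_int)
    hence q: "x [^] q \<in> N" using subgroup_int_pow_closed[OF N r(2)] by simp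
    have "k mod int r = k - q" by (simp add: q_def minus_mult_div_eq_mod)
    hence "x [^] (k mod int r) = x [^] k \<otimes> inv (x [^] q)" using int_pow_diff[OF xc] by simp
    hence "x [^] (k mod int r) \<in> N" using k q Nc by simp
    hence "x [^] nat (k mod int r) \<in> N" using r(1) int_pow_int[of G x "nat (k mod int r)"] by simp
    moreover have "nat (k mod int r) < r" using r(1) by (simp add: nat_less_iff)
    ultimately have "nat (k mod int r) = 0"
      using not_less_Least[of "nat (k mod int r)" "\<lambda>n::nat. 0 < n \<and> x [^] n \<in> N"] by (auto simp: r_def)
    moreover have "0 \<le> k mod int r" using r(1) by simp
    ultimately show "int r dvd k" by (simp add: dvd_eq_mod_eq_0)
  qed
  obtain \<zeta> :: complex where \<zeta>: "\<And>i. \<zeta> ^ i = 1 \<longleftrightarrow> r dvd i" "norm \<zeta> = 1"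
    using primitive_root_of_unity_exists[OF r(1)] by blast
  have \<zeta>0: "\<zeta> \<noteq> 0" using \<zeta>(2) by auto
  define idx where "idx h = (SOME i::nat. inv (x [^] i) \<otimes> h \<in> N)" for h
  define \<mu> where "\<mu> h = \<zeta> ^ idx h" for h
  have idx: "inv (x [^] idx h) \<otimes> h \<in> N" if "h \<in> H" for h
    unfolding idx_def using gen[OF that] by (rule someI_ex)
  have coset: "\<mu> h = \<zeta> ^ j \<longleftrightarrow> inv (x [^] j) \<otimes> h \<in> N" if h: "h \<in> H" for h j
  proof -
    let ?i = "idx h" and ?n = "inv (x [^] idx h) \<otimes> h"
    have hc: "h \<in> carrier G" by (rule subgroup.mem_carrier[OF H h])
    have n: "?n \<in> N" by (rule idx[OF h])
    have "x [^] (int ?i - int j) = x [^] (- int j) \<otimes> x [^] int ?i"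
      using int_pow_mult[OF xc, of "- int j" "int ?i"] by simp
    hence "x [^] (int ?i - int j) = inv (x [^] j) \<otimes> x [^] ?i"
      using xc by (simp add: int_pow_neg_int int_pow_int)
    moreover have "x [^] ?i \<otimes> ?n = h" using xc hc by (simp flip: m_assoc)
    ultimately have eq: "inv (x [^] j) \<otimes> h = x [^] (int ?i - int j) \<otimes> ?n"
      using xc hc by (simp add: m_assoc)
    have "x [^] (int ?i - int j) = (inv (x [^] j) \<otimes> h) \<otimes> inv ?n"
      unfolding eq using Nc(1)[OF n] xc by (simp add: m_assoc)
    hence "inv (x [^] j) \<otimes> h \<in> N \<longleftrightarrow> x [^] (int ?i - int j) \<in> N"
      using eq Nc(2)[OF _ n] Nc(2)[OF _ Nc(3)[OF n]] by metis
    thus ?thesis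
      using root_power_eq_iff[OF \<zeta>(1) \<zeta>0, of ?i j] pow_iff by (simp add: \<mu>_def)
  qed
  have mult: "\<mu> (h \<otimes> h') = \<mu> h * \<mu> h'" if h: "h \<in> H" "h' \<in> H" for h h'
  proof -
    have "inv (x [^] (idx h + idx h')) \<otimes> (h \<otimes> h') \<in> N"
      using pow_coset_mult[OF xc N norm] subgroup.mem_carrier[OF H] h idx by blast
    hence "\<mu> (h \<otimes> h') = \<zeta> ^ (idx h + idx h')"
      using coset[OF subgroup.m_closed[OF H h]] by blast
    thus ?thesis by (simp add: \<mu>_def power_add)
  qed
  have range: "\<exists>i. \<mu> h = \<zeta> ^ i" if "h \<in> H" for h by (auto simp: \<mu>_def)
  have "cyclic_extension G H N x r \<zeta> \<mu>"
    by (rule cyclic_extension.intro[OF group_axioms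
          cyclic_extension_axioms.intro[OF fin H N sub x r(1) \<zeta> mult range coset]])
  thus ?thesis by (rule that)
qed

context cyclic_extension
begin

lemma x_carrier: "x \<in> carrier G"
  by (rule subgroup.mem_carrier[OF H x_in_H])

lemma \<zeta>_unit: "\<zeta> ^ j * cnj (\<zeta> ^ j) = 1"
  unfolding complex_norm_square[symmetric] norm_power norm_\<zeta> by simp

lemma \<mu>_one: "\<mu> \<one> = 1"
  using \<mu>_coset[of \<one> 0] subgroup.one_closed[OF H] subgroup.one_closed[OF N] by simp

lemma \<mu>_eq_one_iff: "h \<in> H \<Longrightarrow> \<mu> h = 1 \<longleftrightarrow> h \<in> N"
  using \<mu>_coset[of h 0] subgroup.mem_carrier[OF H] by simp

lemma \<mu>_root: "h \<in> H \<Longrightarrow> \<mu> h ^ r = 1"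
  using \<mu>_range[of h] \<zeta>_pow[of r] by (auto intro: root_of_one_power)

lemma \<mu>_nonzero: "h \<in> H \<Longrightarrow> \<mu> h \<noteq> 0"
  using \<mu>_root[of h] r_pos by (auto simp: power_0_left)

lemma \<mu>_x_mult:
  assumes "n \<in> N"
  shows "\<mu> (x [^] (j::nat) \<otimes> n) = \<zeta> ^ j" "x [^] j \<otimes> n \<in> H"
proof -
  have n: "n \<in> carrier G" by (rule subgroup.mem_carrier[OF N assms])
  have "x [^] j \<in> H" using subgroup_int_pow_closed[OF H x_in_H, of "int j"] by (simp add: int_pow_int)
  thus "x [^] j \<otimes> n \<in> H" using assms N_le_H subgroup.m_closed[OF H] by blast
  moreover have "inv (x [^] j) \<otimes> (x [^] j \<otimes> n) = n" using n x_carrier by (simp flip: m_assoc)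
  ultimately show "\<mu> (x [^] j \<otimes> n) = \<zeta> ^ j" using \<mu>_coset[of "x [^] j \<otimes> n" j] assms by simp
qed

lemma finite_H: "finite H"
  using finite_carrier subgroup.subset[OF H] by (rule rev_finite_subset)

lemma coset_eq: "{h \<in> H. \<mu> h = \<zeta> ^ j} = (\<lambda>n. x [^] j \<otimes> n) ` N"
proof (intro equalityI subsetI)
  fix h assume "h \<in> {h \<in> H. \<mu> h = \<zeta> ^ j}"
  hence h: "h \<in> H" "inv (x [^] j) \<otimes> h \<in> N" using \<mu>_coset by auto
  have "h = x [^] j \<otimes> (inv (x [^] j) \<otimes> h)"
    using subgroup.mem_carrier[OF H h(1)] x_carrier by (simp flip: m_assoc)
  thus "h \<in> (\<lambda>n. x [^] j \<otimes> n) ` N" using h(2) by blast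
qed (use \<mu>_x_mult in auto)

lemma inj_on_coset: "inj_on (\<lambda>n. x [^] (j::nat) \<otimes> n) N"
  using x_carrier subgroup.mem_carrier[OF N] by (intro inj_onI) auto

text \<open>Fourier inversion on the cyclic group \<open>H/N\<close>.\<close>

lemma coset_sum:
  "of_nat r * (\<Sum>n\<in>N. F (x [^] (j::nat) \<otimes> n)) = (\<Sum>i<r. cnj (\<zeta> ^ j) ^ i * (\<Sum>h\<in>H. \<mu> h ^ i * F h :: complex))"
proof -
  have "(\<Sum>i<r. cnj (\<zeta> ^ j) ^ i * (\<Sum>h\<in>H. \<mu> h ^ i * F h))
      = (\<Sum>i<r. \<Sum>h\<in>H. F h * (cnj (\<zeta> ^ j) * \<mu> h) ^ i)"
    by (simp add: sum_distrib_left power_mult_distrib mult_ac)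
  also have "\<dots> = (\<Sum>h\<in>H. F h * (\<Sum>i<r. (cnj (\<zeta> ^ j) * \<mu> h) ^ i))"
    by (subst sum.swap) (simp add: sum_distrib_left)
  also have "\<dots> = (\<Sum>h\<in>H. if \<mu> h = \<zeta> ^ j then of_nat r * F h else 0)"
  proof (rule sum.cong[OF refl])
    fix h assume h: "h \<in> H"
    have "\<zeta> ^ j \<noteq> 0" using norm_\<zeta> by auto
    hence "cnj (\<zeta> ^ j) * \<mu> h = 1 \<longleftrightarrow> \<mu> h = \<zeta> ^ j"
      using \<zeta>_unit[of j] by (metis mult.commute mult_cancel_right mult.assoc mult_1_right)
    moreover have "(cnj (\<zeta> ^ j) * \<mu> h) ^ r = 1"
    proof -
      have "(\<zeta> ^ j) ^ r = 1" using \<zeta>_pow[of r] by (auto intro: root_of_one_power)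
      hence "cnj (\<zeta> ^ j) ^ r = 1" by (metis complex_cnj_one complex_cnj_power)
      thus ?thesis using \<mu>_root[OF h] by (simp only: power_mult_distrib) simp
    qed
    ultimately show "F h * (\<Sum>i<r. (cnj (\<zeta> ^ j) * \<mu> h) ^ i) = (if \<mu> h = \<zeta> ^ j then of_nat r * F h else 0)"
      by (simp add: sum_powers_root_of_unity del: complex_cnj_power)
  qed
  also have "\<dots> = (\<Sum>h\<in>{h \<in> H. \<mu> h = \<zeta> ^ j}. of_nat r * F h)"
    by (simp add: sum.inter_filter[OF finite_H])
  also have "\<dots> = of_nat r * (\<Sum>n\<in>N. F (x [^] j \<otimes> n))"
    unfolding coset_eq by (simp add: sum.reindex[OF inj_on_coset] sum_distrib_left)
  finally show ?thesis ..
qed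

lemma card_H: "card H = r * card N"
proof -
  have "card H = card (\<Union>j<r. {h \<in> H. \<mu> h = \<zeta> ^ j})"
  proof (intro arg_cong[of _ _ card] equalityI subsetI)
    fix h assume h: "h \<in> H"
    then obtain i where i: "\<mu> h = \<zeta> ^ i" using \<mu>_range by blast
    have "\<zeta> ^ i = \<zeta> ^ (r * (i div r) + i mod r)" by simp
    also have "\<dots> = \<zeta> ^ (i mod r)"
      using \<zeta>_pow[of r] by (simp only: power_add power_mult) simp
    finally show "h \<in> (\<Union>j<r. {h \<in> H. \<mu> h = \<zeta> ^ j})" using h i r_pos by auto
  qed auto
  also have "\<dots> = (\<Sum>j<r. card {h \<in> H. \<mu> h = \<zeta> ^ j})"
  proof (rule card_UN_disjoint)
    show "\<forall>i\<in>{..<r}. \<forall>j\<in>{..<r}. i \<noteq> j \<longrightarrow> {h \<in> H. \<mu> h = \<zeta> ^ i} \<inter> {h \<in> H. \<mu> h = \<zeta> ^ j} = {}"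
    proof (intro ballI impI)
      fix i j assume ij: "i \<in> {..<r}" "j \<in> {..<r}" "i \<noteq> j"
      have "\<zeta> \<noteq> 0" using norm_\<zeta> by auto
      hence "\<zeta> ^ i = \<zeta> ^ j \<longleftrightarrow> int r dvd int i - int j" by (rule root_power_eq_iff[OF \<zeta>_pow])
      moreover have "\<not> int r dvd int i - int j"
        using ij dvd_imp_le_int[of "int i - int j" "int r"] by auto
      ultimately show "{h \<in> H. \<mu> h = \<zeta> ^ i} \<inter> {h \<in> H. \<mu> h = \<zeta> ^ j} = {}" by auto
    qed
  qed (use finite_H in auto)
  also have "\<dots> = (\<Sum>j<r. card N)"
    unfolding coset_eq by (simp add: card_image[OF inj_on_coset])
  finally show ?thesis by simp
qed

lemma twist_inner_product:
  assumes \<rho>: "matrix_rep G H n \<rho>" "irreducible_on H n \<rho>" and \<tau>: "matrix_rep G H m \<tau>" "irreducible_on H m \<tau>"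
  shows "(\<Sum>h\<in>H. \<mu> h ^ i * (mat_trace (\<rho> h) * cnj (mat_trace (\<tau> h))))
    = (if \<forall>h\<in>H. \<mu> h ^ i * mat_trace (\<rho> h) = mat_trace (\<tau> h) then of_nat (card H) else 0)"
proof -
  have c: "\<rho> h \<in> carrier_mat n n" if "h \<in> H" for h by (rule matrix_rep_carrier[OF \<rho>(1) that])
  have rep: "matrix_rep G H n (\<lambda>h. \<mu> h ^ i \<cdot>\<^sub>m \<rho> h)"
    by (rule matrix_rep_twist[OF \<rho>(1)]) (simp_all add: \<mu>_one \<mu>_mult power_mult_distrib)
  have irr: "irreducible_on H n (\<lambda>h. \<mu> h ^ i \<cdot>\<^sub>m \<rho> h)"
    by (rule irreducible_on_twist[OF \<rho>(2) c]) (simp_all add: \<mu>_nonzero)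
  have tr: "mat_trace (\<mu> h ^ i \<cdot>\<^sub>m \<rho> h) = \<mu> h ^ i * mat_trace (\<rho> h)" if "h \<in> H" for h
    by (rule mat_trace_smult[OF c[OF that]])
  show ?thesis
    using character_inner_product[OF finite_carrier H rep irr \<tau>] tr by (simp add: mult.assoc)
qed

text \<open>By \<open>coset_sum\<close> the mean of \<open>|\<chi>|\<^sup>2\<close> over \<open>N\<close>, for the character \<open>\<chi>\<close> of \<open>\<rho>\<close>, is the number of \<open>i < r\<close>
  with \<open>\<mu>\<^sup>i\<chi> = \<chi>\<close>.\<close>

lemma irreducible_on_or_twist_stable:
  assumes \<rho>: "matrix_rep G H n \<rho>" "irreducible_on H n \<rho>"
  obtains (irreducible) "irreducible_on N n \<rho>"
  | (stable) i where "0 < i" "i < r" "\<And>h. h \<in> H \<Longrightarrow> \<mu> h ^ i * mat_trace (\<rho> h) = mat_trace (\<rho> h)"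
proof (cases "\<exists>i. 0 < i \<and> i < r \<and> (\<forall>h\<in>H. \<mu> h ^ i * mat_trace (\<rho> h) = mat_trace (\<rho> h))")
  case True
  thus ?thesis using stable by blast
next
  case False
  have Nc: "x [^] (0::nat) \<otimes> k = k" if "k \<in> N" for k using subgroup.mem_carrier[OF N that] by simp
  have "of_nat r * (\<Sum>k\<in>N. mat_trace (\<rho> k) * cnj (mat_trace (\<rho> k)))
      = (\<Sum>i<r. \<Sum>h\<in>H. \<mu> h ^ i * (mat_trace (\<rho> h) * cnj (mat_trace (\<rho> h))))"
    using coset_sum[of "\<lambda>h. mat_trace (\<rho> h) * cnj (mat_trace (\<rho> h))" 0] Nc by simp
  also have "\<dots> = (\<Sum>i<r. if i = 0 then of_nat (card H) else 0)"
    unfolding twist_inner_product[OF \<rho> \<rho>] using False by (intro sum.cong refl) auto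
  also have "\<dots> = of_nat r * of_nat (card N)" using r_pos by (simp add: card_H)
  finally have "(\<Sum>k\<in>N. mat_trace (\<rho> k) * cnj (mat_trace (\<rho> k))) = of_nat (card N)"
    using r_pos by simp
  moreover have "n > 0" using \<rho>(2) by (simp add: irreducible_on_def)
  ultimately show ?thesis
    using irreducible norm_one_imp_irreducible_on[OF finite_carrier N matrix_rep_subset[OF \<rho>(1) N_le_H]]
    by blast
qed

text \<open>The multiplicity \<open>c i\<close> of \<open>\<tau>\<close> in the twist of \<open>\<rho>\<close> by the \<open>i\<close>-th power of \<open>\<mu>\<close> is an integer
  that does not depend on \<open>j\<close>; only the root of unity varies with the coset.\<close>

lemma coset_inner_product:
  assumes dec: "decomposes_into H \<rho> M d \<sigma>" and \<tau>: "matrix_rep G H m \<tau>" "irreducible_on H m \<tau>"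
  obtains c :: "nat \<Rightarrow> nat" where "\<And>j::nat. (\<Sum>n\<in>N. mat_trace (\<rho> (x [^] j \<otimes> n)) * cnj (mat_trace (\<tau> (x [^] j \<otimes> n))))
    = of_nat (card N) * (\<Sum>i<r. of_nat (c i) * cnj (\<zeta> ^ j) ^ i)"
proof
  fix j :: nat
  define e where "e s i = (if \<forall>h\<in>H. \<mu> h ^ i * mat_trace (\<sigma> s h) = mat_trace (\<tau> h) then 1 else 0 :: nat)" for s i
  define c where "c i = (\<Sum>s<M. e s i)" for i
  let ?F = "\<lambda>h. mat_trace (\<rho> h) * cnj (mat_trace (\<tau> h))"
  have ip: "(\<Sum>h\<in>H. \<mu> h ^ i * ?F h) = of_nat (card H * c i)" for i
  proof -
    have "(\<Sum>h\<in>H. \<mu> h ^ i * ?F h)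
        = (\<Sum>h\<in>H. \<Sum>s<M. \<mu> h ^ i * (mat_trace (\<sigma> s h) * cnj (mat_trace (\<tau> h))))"
      using dec by (intro sum.cong refl) (simp add: decomposes_into_def sum_distrib_left sum_distrib_right)
    also have "\<dots> = (\<Sum>s<M. \<Sum>h\<in>H. \<mu> h ^ i * (mat_trace (\<sigma> s h) * cnj (mat_trace (\<tau> h))))"
      by (rule sum.swap)
    also have "\<dots> = (\<Sum>s<M. of_nat (card H * e s i))"
    proof (rule sum.cong[OF refl])
      fix s assume "s \<in> {..<M}"
      hence "matrix_rep G H (d s) (\<sigma> s)" "irreducible_on H (d s) (\<sigma> s)"
        using dec by (auto simp: decomposes_into_def)
      thus "(\<Sum>h\<in>H. \<mu> h ^ i * (mat_trace (\<sigma> s h) * cnj (mat_trace (\<tau> h)))) = of_nat (card H * e s i)"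
        by (simp add: twist_inner_product[OF _ _ \<tau>] e_def)
    qed
    finally show ?thesis by (simp add: c_def sum_distrib_left)
  qed
  have "of_nat r * (\<Sum>n\<in>N. ?F (x [^] j \<otimes> n))
      = of_nat r * (of_nat (card N) * (\<Sum>i<r. of_nat (c i) * cnj (\<zeta> ^ j) ^ i))"
    unfolding coset_sum[of ?F j] ip by (simp add: card_H sum_distrib_left mult_ac)
  thus "(\<Sum>n\<in>N. ?F (x [^] j \<otimes> n))
      = of_nat (card N) * (\<Sum>i<r. of_nat (\<Sum>s<M. if \<forall>h\<in>H. \<mu> h ^ i * mat_trace (\<sigma> s h) = mat_trace (\<tau> h) then 1 else 0) * cnj (\<zeta> ^ j) ^ i)"
    using r_pos by (simp add: c_def e_def)
qed

end

section \<open>Counting zeros and roots of unity on a coset\<close>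

abbreviation zero_or_root :: "complex \<Rightarrow> bool" where
  "zero_or_root z \<equiv> z = 0 \<or> is_root_of_unity z"

lemma is_root_of_unity_mult:
  assumes "is_root_of_unity a" "is_root_of_unity b"
  shows "is_root_of_unity (a * b)"
proof -
  obtain i j where ij: "i > 0" "a ^ i = 1" "j > 0" "b ^ j = 1"
    using assms by (auto simp: is_root_of_unity_def)
  have "a ^ (i * j) = 1" using ij by (simp add: power_mult)
  moreover have "b ^ (i * j) = 1" using ij by (simp add: mult.commute[of i j] power_mult)
  ultimately have "(a * b) ^ (i * j) = 1" by (simp add: power_mult_distrib)
  thus ?thesis using ij unfolding is_root_of_unity_def by (intro exI[of _ "i * j"]) simp
qed

lemma card_filter_eq_sum: "finite A \<Longrightarrow> card {a \<in> A. P a} = (\<Sum>a\<in>A. if P a then 1 else 0)"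
  by (simp add: sum.inter_filter[symmetric])

text \<open>Cauchy-Schwarz for two functions of the same norm.\<close>

lemma norm_inner_product_le:
  fixes u v :: "'a \<Rightarrow> complex"
  assumes u: "(\<Sum>l\<in>L. u l * cnj (u l)) = of_real b" and v: "(\<Sum>l\<in>L. v l * cnj (v l)) = of_real b"
  shows "norm (\<Sum>l\<in>L. u l * cnj (v l)) \<le> b"
proof -
  have eq: "(\<Sum>l\<in>L. (norm (w l))\<^sup>2) = b" if "(\<Sum>l\<in>L. w l * cnj (w l)) = of_real b" for w :: "'a \<Rightarrow> complex"
    using that unfolding complex_norm_square[symmetric] of_real_sum[symmetric] of_real_eq_iff .
  have "norm (\<Sum>l\<in>L. u l * cnj (v l)) \<le> (\<Sum>l\<in>L. ((norm (u l))\<^sup>2 + (norm (v l))\<^sup>2) / 2)"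
  proof (rule sum_norm_le)
    fix l
    have "0 \<le> (norm (u l) - norm (v l))\<^sup>2" by simp
    thus "norm (u l * cnj (v l)) \<le> ((norm (u l))\<^sup>2 + (norm (v l))\<^sup>2) / 2"
      by (simp add: norm_mult power2_diff)
  qed
  also have "\<dots> = ((\<Sum>l\<in>L. (norm (u l))\<^sup>2) + (\<Sum>l\<in>L. (norm (v l))\<^sup>2)) / 2"
    by (simp add: sum.distrib flip: sum_divide_distrib)
  also have "\<dots> = b" using eq[OF u] eq[OF v] by simp
  finally show ?thesis .
qed

text \<open>The case of equality: the squared norm of \<open>u - \<beta> v\<close> expands to zero.\<close>

lemma inner_product_extremal:
  fixes u v :: "'a \<Rightarrow> complex"
  assumes fin: "finite L" and u: "(\<Sum>l\<in>L. u l * cnj (u l)) = b" and v: "(\<Sum>l\<in>L. v l * cnj (v l)) = b"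
    and uv: "(\<Sum>l\<in>L. u l * cnj (v l)) = b * \<beta>" and b: "cnj b = b" and \<beta>: "\<beta> * cnj \<beta> = 1" and l: "l \<in> L"
  shows "u l = \<beta> * v l"
proof -
  have vu: "(\<Sum>l\<in>L. v l * cnj (u l)) = b * cnj \<beta>"
    using arg_cong[OF uv, of cnj] b by (simp add: mult.commute)
  let ?w = "\<lambda>l. u l - \<beta> * v l"
  have "(\<Sum>l\<in>L. ?w l * cnj (?w l))
      = (\<Sum>l\<in>L. u l * cnj (u l) - cnj \<beta> * (u l * cnj (v l)) - \<beta> * (v l * cnj (u l)) + \<beta> * cnj \<beta> * (v l * cnj (v l)))"
    by (intro sum.cong refl) (simp add: algebra_simps)
  also have "\<dots> = b - cnj \<beta> * (b * \<beta>) - \<beta> * (b * cnj \<beta>) + \<beta> * cnj \<beta> * b"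
    unfolding sum.distrib sum_subtractf sum_distrib_left[symmetric] u v uv vu ..
  also have "\<dots> = b * (1 - \<beta> * cnj \<beta>)" by (simp add: algebra_simps)
  also have "\<dots> = 0" by (simp add: \<beta>)
  finally have "of_real (\<Sum>l\<in>L. (norm (?w l))\<^sup>2) = (0 :: complex)"
    unfolding complex_norm_square[symmetric] of_real_sum .
  hence "(\<Sum>l\<in>L. (norm (?w l))\<^sup>2) = 0" using of_real_eq_0_iff by blast
  hence "(norm (?w l))\<^sup>2 = 0" using sum_nonneg_eq_0_iff[OF fin, of "\<lambda>l. (norm (?w l))\<^sup>2"] l by simp
  thus ?thesis by simp
qed

context group
begin

text \<open>The statement of the induction, on the coset \<open>gK\<close>.\<close>

definition half_zero_or_root :: "'a \<Rightarrow> 'a set \<Rightarrow> ('a \<Rightarrow> complex mat) \<Rightarrow> bool" where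
  "half_zero_or_root g K \<rho> \<longleftrightarrow> card K \<le> 2 * card {k \<in> K. zero_or_root (mat_trace (\<rho> (g \<otimes> k)))}"

text \<open>An irreducible representation of the trivial group has degree one, so \<open>\<rho>(g)\<close> is a number of
  finite order.\<close>

lemma half_zero_or_root_trivial:
  assumes fin: "finite (carrier G)" and H: "subgroup H G" and g: "g \<in> H"
    and \<rho>: "matrix_rep G H n \<rho>" "irreducible_on {\<one>} n \<rho>"
  shows "half_zero_or_root g {\<one>} \<rho>"
proof -
  have gc: "g \<in> carrier G" by (rule subgroup.mem_carrier[OF H g])
  have one: "{\<one>} \<subseteq> H" using subgroup.one_closed[OF H] by simp
  have triv: "subgroup {\<one>} G" by (rule triv_subgroup)
  have "(complex_of_nat n * of_nat n) = 1"
    using coset_norm[OF fin H triv one \<rho>, of \<one>] one by (simp add: matrix_rep_one[OF \<rho>(1)] mat_trace_one)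
  hence n: "n = 1" by (metis of_nat_mult of_nat_1 of_nat_eq_iff nat_mult_eq_1_iff)
  let ?A = "\<rho> g" and ?m = "Coset.order G"
  have A: "?A \<in> carrier_mat 1 1" using matrix_rep_carrier[OF \<rho>(1) g] n by simp
  have "upper_triangular ?A" using A by auto
  hence "(?A ^\<^sub>m ?m) $$ (0, 0) = (?A $$ (0, 0)) ^ ?m" using upper_triangular_pow[OF A] by auto
  moreover have "?A ^\<^sub>m ?m = 1\<^sub>m 1"
    using matrix_rep_pow[OF H \<rho>(1) g, of ?m] pow_order_eq_1[OF gc] n by (simp add: matrix_rep_one[OF \<rho>(1)])
  ultimately have "(mat_trace ?A) ^ ?m = 1" using A by (simp add: mat_trace_eq[OF A])
  moreover have "?m > 0" using fin by (simp add: order_gt_0_iff_finite)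
  ultimately have "is_root_of_unity (mat_trace ?A)" unfolding is_root_of_unity_def by blast
  hence "{k \<in> {\<one>}. zero_or_root (mat_trace (\<rho> (g \<otimes> k)))} = {\<one>}" using gc by auto
  thus ?thesis unfolding half_zero_or_root_def by simp
qed

lemma maximal_proper_subgroup:
  assumes fin: "finite K" and K: "subgroup K G" and D: "subgroup D G" "D \<subseteq> K" "D \<noteq> K"
  obtains N x where "subgroup N G" "D \<subseteq> N" "N \<subset> K" "x \<in> K" "x \<notin> N" "generate G (insert x N) = K"
proof -
  define S where "S = {N. subgroup N G \<and> D \<subseteq> N \<and> N \<subset> K}"
  have "finite S" using fin by (intro finite_subset[of S "Pow K"]) (auto simp: S_def)
  moreover have "S \<noteq> {}" using D by (auto simp: S_def)
  ultimately obtain N where N: "N \<in> S" "\<And>M. M \<in> S \<Longrightarrow> N \<subseteq> M \<Longrightarrow> N = M"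
    using finite_has_maximal[of S] by blast
  hence N': "subgroup N G" "D \<subseteq> N" "N \<subset> K" by (auto simp: S_def)
  then obtain x where x: "x \<in> K" "x \<notin> N" by blast
  have sub: "insert x N \<subseteq> K" using x N' by auto
  hence carr: "insert x N \<subseteq> carrier G" using subgroup.subset[OF K] by blast
  have M: "subgroup (generate G (insert x N)) G" by (rule generate_is_subgroup[OF carr])
  have incl: "insert x N \<subseteq> generate G (insert x N)" by (auto intro: generate.incl)
  have "generate G (insert x N) \<subseteq> K" by (rule generate_subgroup_incl[OF sub K])
  moreover have "generate G (insert x N) \<notin> S" using N(2)[of "generate G (insert x N)"] incl x by blast
  ultimately have "generate G (insert x N) = K" using M incl N' by (auto simp: S_def)
  thus ?thesis using that N' x by blast
qed

text \<open>The case in which \<open>g\<close> acts trivially on some nontrivial cyclic quotient \<open>K/N\<close>.  If \<open>\<rho>\<close> stays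
  irreducible on \<open>N\<close>, the bound holds on each coset of \<open>N\<close> in \<open>gK\<close>; otherwise \<open>\<chi>\<close> vanishes
  on half of \<open>gK\<close>.\<close>

lemma half_zero_or_root_commutators_proper:
  assumes fin: "finite (carrier G)" and H: "subgroup H G" and K: "subgroup K G" "K \<subseteq> H" and g: "g \<in> H"
    and norm: "\<And>k. k \<in> K \<Longrightarrow> inv g \<otimes> k \<otimes> g \<in> K"
    and \<rho>: "matrix_rep G H n \<rho>" "irreducible_on K n \<rho>"
    and D: "\<not> K \<subseteq> commutators_with g K"
    and IH: "\<And>N y. subgroup N G \<Longrightarrow> N \<subset> K \<Longrightarrow> y \<in> H \<Longrightarrow> (\<And>k. k \<in> N \<Longrightarrow> inv y \<otimes> k \<otimes> y \<in> N) \<Longrightarrow>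
       irreducible_on N n \<rho> \<Longrightarrow> half_zero_or_root y N \<rho>"
  shows "half_zero_or_root g K \<rho>"
proof -
  let ?D = "commutators_with g K" and ?L = "derived G K"
  note Kc = subgroup.mem_carrier[OF K(1)] subgroup.m_closed[OF K(1)] subgroup.m_inv_closed[OF K(1)]
  have gc: "g \<in> carrier G" by (rule subgroup.mem_carrier[OF H g])
  have finK: "finite K" using fin subgroup.subset[OF K(1)] by (rule rev_finite_subset)
  have gens: "?L \<union> (\<lambda>x. (inv g \<otimes> x \<otimes> g) \<otimes> inv x) ` K \<subseteq> K"
    using derived_incl[OF order_refl K(1)] norm Kc by auto
  have Dsub: "subgroup ?D G" unfolding commutators_with_def
    by (rule generate_is_subgroup[OF order_trans[OF gens subgroup.subset[OF K(1)]]])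
  have DK: "?D \<subseteq> K" unfolding commutators_with_def by (rule generate_subgroup_incl[OF gens K(1)])
  obtain N x where N: "subgroup N G" "?D \<subseteq> N" "N \<subset> K" and x: "x \<in> K" "x \<notin> N"
    and gen: "generate G (insert x N) = K"
    using maximal_proper_subgroup[OF finK K(1) Dsub DK] D by blast
  note Nc = subgroup.m_closed[OF N(1)]
  have LN: "?L \<subseteq> N" using N(2) unfolding commutators_with_def by (auto intro: generate.incl)
  have com: "(inv g \<otimes> k \<otimes> g) \<otimes> inv k \<in> N" if "k \<in> K" for k
  proof -
    have "(inv g \<otimes> k \<otimes> g) \<otimes> inv k \<in> ?D"
      unfolding commutators_with_def using that by (intro generate.incl) blast
    thus ?thesis using N(2) by blast
  qed
  have split: "inv g \<otimes> k \<otimes> g = ((inv g \<otimes> k \<otimes> g) \<otimes> inv k) \<otimes> k" if "k \<in> K" for k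
    using Kc(1)[OF that] gc by (simp add: m_assoc)
  have normK: "inv k \<otimes> m \<otimes> k \<in> N" if k: "k \<in> K" and m: "m \<in> N" for k m
  proof -
    have mK: "m \<in> K" using m N(3) by blast
    have c: "k \<in> carrier G" "m \<in> carrier G" using Kc(1) k mK by auto
    have "inv m \<otimes> inv k \<otimes> m \<otimes> k \<in> N"
      using commutator_in_derived[of "inv m" K "inv k"] Kc(3) k mK LN c by auto
    hence "m \<otimes> (inv m \<otimes> inv k \<otimes> m \<otimes> k) \<in> N" using Nc m by blast
    moreover have "m \<otimes> (inv m \<otimes> inv k \<otimes> m \<otimes> k) = inv k \<otimes> m \<otimes> k"
      using c by (simp add: m_assoc flip: m_assoc[of m "inv m"])
    ultimately show ?thesis by simp
  qed
  have normg: "inv g \<otimes> m \<otimes> g \<in> N" if m: "m \<in> N" for m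
  proof -
    have mK: "m \<in> K" using m N(3) by blast
    show ?thesis using split[OF mK] Nc[OF com[OF mK] m] by simp
  qed
  have NK: "N \<subseteq> K" using N(3) by blast
  obtain r \<zeta> \<mu> where "cyclic_extension G K N x r \<zeta> \<mu>"
  proof (rule cyclic_extension_exists[OF fin K(1) N(1) NK x(1) normK[OF x(1)]])
    show "\<exists>i::nat. inv (x [^] i) \<otimes> h \<in> N" if "h \<in> K" for h
      using generate_insert_normalized[OF fin N(1) Kc(1)[OF x(1)] normK[OF x(1)]] that gen by simp
  qed
  then interpret ext: cyclic_extension G K N x r \<zeta> \<mu> .
  have rhoK: "matrix_rep G K n \<rho>" by (rule matrix_rep_subset[OF \<rho>(1) K(2)])
  show ?thesis
  proof (cases rule: ext.irreducible_on_or_twist_stable[OF rhoK \<rho>(2), case_names irreducible stable])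
    case irreducible
    let ?p = "\<lambda>y. if zero_or_root (mat_trace (\<rho> y)) then 1 else 0 :: nat"
    have "card N \<le> 2 * (\<Sum>m\<in>N. ?p (g \<otimes> (k \<otimes> m)))" if k: "k \<in> K" for k
    proof -
      have "half_zero_or_root (g \<otimes> k) N \<rho>"
      proof (rule IH[OF N(1,3) _ _ irreducible])
        show "g \<otimes> k \<in> H" using subgroup.m_closed[OF H g] k K(2) by blast
        show "inv (g \<otimes> k) \<otimes> m \<otimes> (g \<otimes> k) \<in> N" if "m \<in> N" for m
          using conj_conj[OF gc Kc(1)[OF k] subgroup.mem_carrier[OF N(1) that]] normK[OF k normg[OF that]] by simp
      qed
      hence "card N \<le> 2 * card {m \<in> N. zero_or_root (mat_trace (\<rho> (g \<otimes> k \<otimes> m)))}"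
        unfolding half_zero_or_root_def .
      also have "{m \<in> N. zero_or_root (mat_trace (\<rho> (g \<otimes> k \<otimes> m)))}
          = {m \<in> N. zero_or_root (mat_trace (\<rho> (g \<otimes> (k \<otimes> m))))}"
        using gc Kc(1)[OF k] subgroup.mem_carrier[OF N(1)] by (auto simp: m_assoc)
      finally show ?thesis
        using card_filter_eq_sum[OF finite_subset[OF NK finK]] by simp
    qed
    hence "(\<Sum>k\<in>K. card N) \<le> (\<Sum>k\<in>K. 2 * (\<Sum>m\<in>N. ?p (g \<otimes> (k \<otimes> m))))" by (rule sum_mono)
    also have "\<dots> = 2 * (\<Sum>k\<in>K. \<Sum>m\<in>N. ?p (g \<otimes> (k \<otimes> m)))" by (rule sum_distrib_left[symmetric])
    also have "\<dots> = card N * (2 * (\<Sum>k\<in>K. ?p (g \<otimes> k)))"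
      using sum_over_cosets[OF finK K(1) N(1) NK, of "\<lambda>y. ?p (g \<otimes> y)"] by simp
    finally have "card N * card K \<le> card N * (2 * (\<Sum>k\<in>K. ?p (g \<otimes> k)))" by (simp add: mult.commute)
    moreover have "card N > 0"
      using finite_subset[OF NK finK] subgroup.one_closed[OF N(1)] by (auto simp: card_gt_0_iff)
    ultimately have "card K \<le> 2 * (\<Sum>k\<in>K. ?p (g \<otimes> k))" by simp
    thus ?thesis unfolding half_zero_or_root_def card_filter_eq_sum[OF finK] .
  next
    case (stable i)
    have "card K \<le> 2 * card {k \<in> K. mat_trace (\<rho> (g \<otimes> k)) = 0}"
    proof (rule twist_invariant_character_zeros[OF fin H K g norm \<rho>])
      show "\<mu> \<one> ^ i = 1" by (simp add: ext.\<mu>_one)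
      show "\<mu> (a \<otimes> b) ^ i = \<mu> a ^ i * \<mu> b ^ i" if "a \<in> K" "b \<in> K" for a b
        using that by (simp add: ext.\<mu>_mult power_mult_distrib)
      show "\<mu> (inv g \<otimes> k \<otimes> g) ^ i = \<mu> k ^ i" if k: "k \<in> K" for k
      proof -
        have c: "(inv g \<otimes> k \<otimes> g) \<otimes> inv k \<in> K" using com[OF k] NK by blast
        have "\<mu> (inv g \<otimes> k \<otimes> g) = \<mu> ((inv g \<otimes> k \<otimes> g) \<otimes> inv k) * \<mu> k"
          using split[OF k] ext.\<mu>_mult[OF c k] by simp
        thus ?thesis using ext.\<mu>_eq_one_iff[OF c] com[OF k] by simp
      qed
      show "\<mu> k ^ i * mat_trace (\<rho> k) = mat_trace (\<rho> k)" if "k \<in> K" for k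
        by (rule stable(3)[OF that])
      have "\<mu> x = \<zeta>" using ext.\<mu>_coset[OF x(1), of 1] x(1) Kc(1) subgroup.one_closed[OF N(1)] by simp
      thus "\<mu> x ^ i \<noteq> 1" using ext.\<zeta>_pow[of i] stable(1,2) by (auto dest: dvd_imp_le)
    qed (simp_all add: x(1))
    also have "\<dots> \<le> 2 * card {k \<in> K. zero_or_root (mat_trace (\<rho> (g \<otimes> k)))}"
      using finK by (intro mult_left_mono card_mono) auto
    finally show ?thesis unfolding half_zero_or_root_def .
  qed
qed

end

section \<open>The induction over cosets\<close>

text \<open>The values on \<open>gK\<close> are distributed as the values on \<open>gL\<close>, \<open>L = K'\<close>: this is
  \<open>coset_sum_average\<close> for the indicator function of zeros and roots of unity.\<close>

lemma (in group) half_zero_or_root_of_derived_coset: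
  assumes fin: "finite (carrier G)" and K: "subgroup K G" and g: "g \<in> carrier G"
    and norm: "\<And>k. k \<in> K \<Longrightarrow> inv g \<otimes> k \<otimes> g \<in> K"
    and gen: "K \<subseteq> commutators_with g K"
    and class_fun: "\<And>a k. a \<in> K \<Longrightarrow> k \<in> K \<Longrightarrow>
       mat_trace (\<rho> (a \<otimes> (g \<otimes> k) \<otimes> inv a)) = mat_trace (\<rho> (g \<otimes> k))"
    and half: "half_zero_or_root g (derived G K) \<rho>"
  shows "half_zero_or_root g K \<rho>"
proof -
  let ?L = "derived G K"
  have L: "subgroup ?L G" using derived_is_subgroup[OF subgroup.subset[OF K]] .
  have finK: "finite K" using fin subgroup.subset[OF K] by (rule rev_finite_subset)
  have finL: "finite ?L" using fin subgroup.subset[OF L] by (rule rev_finite_subset)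
  let ?p = "\<lambda>y. if zero_or_root (mat_trace (\<rho> y)) then 1 else 0 :: nat"
  have "of_nat (card ?L) * (\<Sum>k\<in>K. of_nat (?p (g \<otimes> k)) :: complex)
      = of_nat (card K) * (\<Sum>l\<in>?L. of_nat (?p (g \<otimes> l)))"
    by (rule coset_sum_average[OF fin K g norm gen, where f = "\<lambda>y. of_nat (?p y)"])
       (simp_all only: class_fun)
  hence "complex_of_nat (card ?L * (\<Sum>k\<in>K. ?p (g \<otimes> k))) = of_nat (card K * (\<Sum>l\<in>?L. ?p (g \<otimes> l)))"
    by (simp only: of_nat_mult of_nat_sum)
  hence eq: "card ?L * (\<Sum>k\<in>K. ?p (g \<otimes> k)) = card K * (\<Sum>l\<in>?L. ?p (g \<otimes> l))"
    by (simp only: of_nat_eq_iff)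
  have "card K * card ?L \<le> card K * (2 * (\<Sum>l\<in>?L. ?p (g \<otimes> l)))"
    using half unfolding half_zero_or_root_def card_filter_eq_sum[OF finL] by (rule mult_le_mono2)
  also have "\<dots> = card ?L * (2 * (\<Sum>k\<in>K. ?p (g \<otimes> k)))" using eq by simp
  finally have "card ?L * card K \<le> card ?L * (2 * (\<Sum>k\<in>K. ?p (g \<otimes> k)))" by (simp only: mult.commute)
  moreover have "card ?L > 0" using finL subgroup.one_closed[OF L] by (auto simp: card_gt_0_iff)
  ultimately show ?thesis unfolding half_zero_or_root_def card_filter_eq_sum[OF finK] by simp
qed

text \<open>The case in which \<open>g\<close> acts trivially on no nontrivial quotient of \<open>K/K'\<close>.  On the coset of the
  derived subgroup, \<open>\<chi>\<close> is a root of unity times an irreducible character of \<open>\<langle>g\<rangle>K'\<close>.\<close>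

lemma (in group) half_zero_or_root_commutators_all:
  assumes fin: "finite (carrier G)" and H: "subgroup H G" and K: "subgroup K G" "K \<subseteq> H" and g: "g \<in> H"
    and norm: "\<And>k. k \<in> K \<Longrightarrow> inv g \<otimes> k \<otimes> g \<in> K"
    and \<rho>: "matrix_rep G H n \<rho>" "irreducible_on K n \<rho>"
    and D: "K \<subseteq> commutators_with g K"
    and IH: "\<And>H' m \<tau>. subgroup H' G \<Longrightarrow> derived G K \<subseteq> H' \<Longrightarrow> g \<in> H' \<Longrightarrow>
       (\<And>l. l \<in> derived G K \<Longrightarrow> inv g \<otimes> l \<otimes> g \<in> derived G K) \<Longrightarrow>
       matrix_rep G H' m \<tau> \<Longrightarrow> irreducible_on (derived G K) m \<tau> \<Longrightarrow> half_zero_or_root g (derived G K) \<tau>"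
  shows "half_zero_or_root g K \<rho>"
proof -
  let ?L = "derived G K" and ?H = "generate G (insert g (derived G K))" and ?m = "Coset.order G"
  note Kc = subgroup.mem_carrier[OF K(1)] subgroup.m_closed[OF K(1)] subgroup.m_inv_closed[OF K(1)]
  have gc: "g \<in> carrier G" by (rule subgroup.mem_carrier[OF H g])
  have L: "subgroup ?L G" "?L \<subseteq> K"
    using derived_is_subgroup[OF subgroup.subset[OF K(1)]] derived_incl[OF order_refl K(1)] by auto
  have finK: "finite K" using fin subgroup.subset[OF K(1)] by (rule rev_finite_subset)
  have finL: "finite ?L" by (rule finite_subset[OF L(2) finK])
  have normL: "inv g \<otimes> l \<otimes> g \<in> ?L" if "l \<in> ?L" for l
    by (rule conj_derived_closed[OF K(1) gc norm that])
  have sub: "insert g ?L \<subseteq> H" using g L(2) K(2) by blast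
  have H1: "subgroup ?H G"
    by (rule generate_is_subgroup[OF order_trans[OF sub subgroup.subset[OF H]]])
  have H1H: "?H \<subseteq> H" by (rule generate_subgroup_incl[OF sub H])
  have LH1: "?L \<subseteq> ?H" and gH1: "g \<in> ?H" by (auto intro: generate.incl)
  \<comment> \<open>From here on \<open>?H = \<langle>g\<rangle>L\<close>, a cyclic extension of \<open>L = K'\<close>.\<close>
  obtain r \<zeta> \<mu> where "cyclic_extension G ?H ?L g r \<zeta> \<mu>"
  proof (rule cyclic_extension_exists[OF fin H1 L(1) LH1 gH1 normL])
    show "\<exists>i::nat. inv (g [^] i) \<otimes> h \<in> ?L" if "h \<in> ?H" for h
      using generate_insert_normalized[OF fin L(1) gc normL that] by simp
  qed
  then interpret ext: cyclic_extension G ?H ?L g r \<zeta> \<mu> .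
  have rhoH1: "matrix_rep G ?H n \<rho>" by (rule matrix_rep_subset[OF \<rho>(1) H1H])
  have powH: "g [^] (j::nat) \<in> H" "g [^] j \<in> ?H" for j
    using subgroup_int_pow_closed[OF H g, of "int j"] subgroup_int_pow_closed[OF H1 gH1, of "int j"]
    by (simp_all add: int_pow_int)
  have m_pos: "?m > 0" using fin by (simp add: order_gt_0_iff_finite)
  have g_m: "g [^] ?m = \<one>" by (rule pow_order_eq_1[OF gc])
  have class_fun: "mat_trace (\<rho> (a \<otimes> (y \<otimes> k) \<otimes> inv a)) = mat_trace (\<rho> (y \<otimes> k))"
    if "a \<in> K" "k \<in> K" "y \<in> H" for a k y
  proof -
    have H1: "a \<in> H" "inv a \<in> H" "k \<in> H" using that K(2) Kc(3) by auto
    have H2: "y \<otimes> k \<in> H" by (rule subgroup.m_closed[OF H that(3) H1(3)])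
    note H' = H1(1,2) H2 subgroup.m_closed[OF H H1(1) H2]
    have "\<rho> (a \<otimes> (y \<otimes> k) \<otimes> inv a) = \<rho> a * \<rho> (y \<otimes> k) * \<rho> (inv a)"
      using H' by (simp add: matrix_rep_mult[OF \<rho>(1)])
    also have "mat_trace \<dots> = mat_trace (\<rho> (y \<otimes> k))"
      by (rule mat_trace_similar[OF matrix_rep_carrier[OF \<rho>(1) H'(3)] matrix_rep_carrier[OF \<rho>(1) H'(1)]
            matrix_rep_carrier[OF \<rho>(1) H'(2)] matrix_rep_inv(2)[OF H \<rho>(1) H'(1)]])
    finally show ?thesis .
  qed
  have coset_norm_L: "(\<Sum>l\<in>?L. mat_trace (\<rho> (g [^] j \<otimes> l)) * cnj (mat_trace (\<rho> (g [^] j \<otimes> l)))) = of_nat (card ?L)"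
    if j: "coprime j ?m" for j
  proof -
    let ?y = "g [^] j" and ?f = "\<lambda>y. mat_trace (\<rho> y) * cnj (mat_trace (\<rho> y))"
    obtain i where i: "[j * i = 1] (mod ?m)" using cong_solve_coprime_nat[OF j] by auto
    \<comment> \<open>\<open>g\<close> is a power of \<open>?y\<close>, so the hypothesis \<open>D\<close> passes from \<open>g\<close> to \<open>?y\<close>.\<close>
    have pow_mod: "g [^] (a mod ?m) = g [^] a" for a :: nat
    proof -
      have "g [^] a = g [^] (?m * (a div ?m) + a mod ?m)" by simp
      also have "\<dots> = (g [^] ?m) [^] (a div ?m) \<otimes> g [^] (a mod ?m)"
        using gc by (simp only: nat_pow_mult[symmetric] nat_pow_pow[symmetric])
      finally show ?thesis using gc by (simp add: g_m)
    qed
    have "?y [^] i = g [^] (j * i)" using gc by (simp add: nat_pow_pow)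
    also have "\<dots> = g [^] (1::nat)"
      using pow_mod[of "j * i"] pow_mod[of 1] i by (simp add: cong_def)
    finally have gy: "?y [^] i = g" using gc by simp
    have yc: "?y \<in> carrier G" using gc by simp
    have normy: "inv ?y \<otimes> k \<otimes> ?y \<in> K" if "k \<in> K" for k
      by (rule conj_pow_closed[OF gc subgroup.subset[OF K(1)] norm that])
    have geny: "K \<subseteq> commutators_with ?y K"
      using D commutators_with_power[OF K(1) yc normy, of i] unfolding gy by blast
    have "of_nat (card ?L) * (\<Sum>k\<in>K. ?f (?y \<otimes> k)) = of_nat (card K) * (\<Sum>l\<in>?L. ?f (?y \<otimes> l))"
      by (rule coset_sum_average[OF fin K(1) yc normy geny, where f = ?f]) (simp_all add: class_fun[OF _ _ powH(1)])
    moreover have "(\<Sum>k\<in>K. ?f (?y \<otimes> k)) = of_nat (card K)"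
      by (rule coset_norm[OF fin H K \<rho> powH(1)])
    moreover have "card K \<noteq> 0" using finK subgroup.one_closed[OF K(1)] by auto
    ultimately show ?thesis by simp
  qed
  obtain M d \<sigma> where dec: "decomposes_into ?H \<rho> M d \<sigma>"
    using character_decomposes[OF H1 rhoH1] by blast
  have g1: "g [^] (1::nat) = g" using gc by simp
  have "(\<Sum>s<M. \<Sum>l\<in>?L. mat_trace (\<rho> (g \<otimes> l)) * cnj (mat_trace (\<sigma> s (g \<otimes> l)))) = of_nat (card ?L)"
  proof -
    have "(\<Sum>s<M. \<Sum>l\<in>?L. mat_trace (\<rho> (g \<otimes> l)) * cnj (mat_trace (\<sigma> s (g \<otimes> l))))
        = (\<Sum>l\<in>?L. mat_trace (\<rho> (g \<otimes> l)) * cnj (\<Sum>s<M. mat_trace (\<sigma> s (g \<otimes> l))))"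
      by (subst sum.swap) (simp add: sum_distrib_left)
    also have "\<dots> = (\<Sum>l\<in>?L. mat_trace (\<rho> (g \<otimes> l)) * cnj (mat_trace (\<rho> (g \<otimes> l))))"
      using dec ext.\<mu>_x_mult(2)[of _ 1] g1 by (intro sum.cong refl) (simp add: decomposes_into_def)
    finally show ?thesis using coset_norm_L[of 1] g1 by simp
  qed
  moreover have "card ?L \<noteq> 0" using finL subgroup.one_closed[OF L(1)] by auto
  ultimately obtain s where s: "s < M"
    and nz: "(\<Sum>l\<in>?L. mat_trace (\<rho> (g \<otimes> l)) * cnj (mat_trace (\<sigma> s (g \<otimes> l)))) \<noteq> 0"
    by (metis (no_types, lifting) lessThan_iff of_nat_eq_0_iff sum.neutral)
  define \<tau> where "\<tau> = \<sigma> s"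
  have \<tau>: "matrix_rep G ?H (d s) \<tau>" "irreducible_on ?H (d s) \<tau>"
    using dec s by (auto simp: decomposes_into_def \<tau>_def)
  have irrL: "irreducible_on ?L (d s) \<tau>"
  proof (cases rule: ext.irreducible_on_or_twist_stable[OF \<tau>, case_names irreducible stable])
    case (stable i)
    \<comment> \<open>A twist that fixes \<open>\<tau>\<close> forces its character to vanish on \<open>gL\<close>, against the choice of \<open>s\<close>.\<close>
    have "mat_trace (\<tau> (g \<otimes> l)) = 0" if l: "l \<in> ?L" for l
    proof -
      have "\<mu> (g \<otimes> l) = \<zeta>" "g \<otimes> l \<in> ?H" using ext.\<mu>_x_mult[OF l, of 1] g1 by simp_all
      hence "\<zeta> ^ i * mat_trace (\<tau> (g \<otimes> l)) = mat_trace (\<tau> (g \<otimes> l))" using stable(3) by metis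
      moreover have "\<zeta> ^ i \<noteq> 1" using ext.\<zeta>_pow[of i] stable(1,2) by (auto dest: dvd_imp_le)
      ultimately show ?thesis by simp
    qed
    thus ?thesis using nz by (simp add: \<tau>_def)
  qed
  obtain c :: "nat \<Rightarrow> nat" where c: "\<And>j::nat. (\<Sum>l\<in>?L. mat_trace (\<rho> (g [^] j \<otimes> l)) * cnj (mat_trace (\<tau> (g [^] j \<otimes> l))))
      = of_nat (card ?L) * (\<Sum>i<r. of_nat (c i) * cnj (\<zeta> ^ j) ^ i)"
    using ext.coset_inner_product[OF dec \<tau>] by blast
  \<comment> \<open>The inner products on the cosets \<open>g\<^sup>jL\<close> are \<open>|L|\<close> times the values of \<open>f\<close> at the powers of \<open>cnj \<zeta>\<close>.\<close>
  define f where "f = (\<Sum>i<r. Polynomial.monom (of_nat (c i) :: complex) i)"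
  have poly_f: "poly f w = (\<Sum>i<r. of_nat (c i) * w ^ i)" for w
    by (simp add: f_def poly_sum Polynomial.poly_monom)
  have "poly f (cnj \<zeta>) = 0 \<or> is_root_of_unity (poly f (cnj \<zeta>))"
  proof (rule bounded_conjugates_imp_root_of_unity[OF _ m_pos])
    show "poly.coeff f i \<in> \<int>" for i
      unfolding f_def Polynomial.coeff_sum by (intro Ints_sum) (simp add: Polynomial.coeff_monom)
    have "\<zeta> ^ ?m = 1"
      using ext.\<mu>_coset[of \<one> ?m] g_m subgroup.one_closed[OF H1] subgroup.one_closed[OF L(1)] ext.\<mu>_one by simp
    thus "cnj \<zeta> ^ ?m = 1" by (metis complex_cnj_one complex_cnj_power)
    fix j assume j: "coprime j ?m"
    have "norm (\<Sum>l\<in>?L. mat_trace (\<rho> (g [^] j \<otimes> l)) * cnj (mat_trace (\<tau> (g [^] j \<otimes> l)))) \<le> real (card ?L)"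
      using coset_norm_L[OF j] coset_norm[OF fin H1 L(1) LH1 \<tau>(1) irrL powH(2)[of j]]
      by (intro norm_inner_product_le) simp_all
    hence "real (card ?L) * norm (poly f (cnj \<zeta> ^ j)) \<le> real (card ?L) * 1"
      unfolding c poly_f by (simp add: norm_mult)
    thus "norm (poly f (cnj \<zeta> ^ j)) \<le> 1" using \<open>card ?L \<noteq> 0\<close> by (simp add: mult_le_cancel_left)
  qed
  moreover have inner: "(\<Sum>l\<in>?L. mat_trace (\<rho> (g \<otimes> l)) * cnj (mat_trace (\<tau> (g \<otimes> l))))
      = of_nat (card ?L) * poly f (cnj \<zeta>)"
    using c[of 1] g1 by (simp add: poly_f)
  ultimately have root: "is_root_of_unity (poly f (cnj \<zeta>))" using nz by (auto simp: \<tau>_def)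
  then obtain k where k: "k > 0" "poly f (cnj \<zeta>) ^ k = 1" by (auto simp: is_root_of_unity_def)
  hence "norm (poly f (cnj \<zeta>)) = 1"
    by (metis norm_one norm_power norm_ge_zero power_eq_1_iff less_numeral_extra(3))
  hence unit: "poly f (cnj \<zeta>) * cnj (poly f (cnj \<zeta>)) = 1" by (simp add: complex_norm_square[symmetric])
  have proportional: "mat_trace (\<rho> (g \<otimes> l)) = poly f (cnj \<zeta>) * mat_trace (\<tau> (g \<otimes> l))" if l: "l \<in> ?L" for l
  proof (rule inner_product_extremal[OF finL _ _ inner _ unit l])
    show "(\<Sum>l\<in>?L. mat_trace (\<rho> (g \<otimes> l)) * cnj (mat_trace (\<rho> (g \<otimes> l)))) = of_nat (card ?L)"
      using coset_norm_L[of 1] g1 by simp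
    show "(\<Sum>l\<in>?L. mat_trace (\<tau> (g \<otimes> l)) * cnj (mat_trace (\<tau> (g \<otimes> l)))) = of_nat (card ?L)"
      by (rule coset_norm[OF fin H1 L(1) LH1 \<tau>(1) irrL gH1])
  qed simp
  have "card ?L \<le> 2 * card {l \<in> ?L. zero_or_root (mat_trace (\<tau> (g \<otimes> l)))}"
    using IH[OF H1 LH1 gH1 normL \<tau>(1) irrL] unfolding half_zero_or_root_def .
  also have "\<dots> \<le> 2 * card {l \<in> ?L. zero_or_root (mat_trace (\<rho> (g \<otimes> l)))}"
    using finL proportional root by (intro mult_left_mono card_mono) (auto intro: is_root_of_unity_mult)
  finally have half: "half_zero_or_root g ?L \<rho>" unfolding half_zero_or_root_def .
  show ?thesis by (rule half_zero_or_root_of_derived_coset[OF fin K(1) gc norm D class_fun[OF _ _ g] half])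
qed

text \<open>Solvability is used in the form that no nontrivial subgroup is perfect, which lets the induction
  pass from \<open>K\<close> to the smaller group \<open>K'\<close>.\<close>

lemma (in group) half_zero_or_root:
  assumes fin: "finite (carrier G)"
    and solv: "\<And>J. subgroup J G \<Longrightarrow> derived G J = J \<Longrightarrow> J = {\<one>}"
    and "subgroup H G" "subgroup K G" "K \<subseteq> H" "g \<in> H"
    and "\<And>k. k \<in> K \<Longrightarrow> inv g \<otimes> k \<otimes> g \<in> K"
    and "matrix_rep G H n \<rho>" "irreducible_on K n \<rho>"
  shows "half_zero_or_root g K \<rho>"
  using assms(3-)
proof (induction "card K" arbitrary: H K g n \<rho> rule: less_induct)
  case less
  note K = less.prems(2,3)
  have finK: "finite K" using fin subgroup.subset[OF K(1)] by (rule rev_finite_subset)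
  consider "K = {\<one>}" | "K \<noteq> {\<one>}" "K \<subseteq> commutators_with g K" | "\<not> K \<subseteq> commutators_with g K" by blast
  thus ?case
  proof cases
    case 1
    thus ?thesis using half_zero_or_root_trivial[OF fin less.prems(1,4,6)] less.prems(7) by simp
  next
    case 2
    have L: "subgroup (derived G K) G" "derived G K \<subset> K"
      using derived_is_subgroup[OF subgroup.subset[OF K(1)]] derived_incl[OF order_refl K(1)]
        solv[OF K(1)] 2(1) by auto
    have "card (derived G K) < card K" by (rule psubset_card_mono[OF finK L(2)])
    thus ?thesis
      using half_zero_or_root_commutators_all[OF fin less.prems(1) K less.prems(4-7) 2(2)] less.hyps L(1) by blast
  next
    case 3
    show ?thesis
    proof (rule half_zero_or_root_commutators_proper[OF fin less.prems(1) K less.prems(4-7) 3])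
      fix N y assume N: "subgroup N G" "N \<subset> K" "y \<in> H" "\<And>k. k \<in> N \<Longrightarrow> inv y \<otimes> k \<otimes> y \<in> N"
        "irreducible_on N n \<rho>"
      have "card N < card K" by (rule psubset_card_mono[OF finK N(2)])
      moreover have "N \<subseteq> H" using N(2) K(2) by blast
      ultimately show "half_zero_or_root y N \<rho>"
        using less.hyps less.prems(1,6) N by blast
    qed
  qed
qed

lemma (in group) solvable_imp_no_perfect_subgroup:
  assumes "solvable G" "subgroup J G" "derived G J = J"
  shows "J = {\<one>}"
proof -
  obtain n where n: "(derived G ^^ n) J = {\<one>}"
    using solvable_imp_trivial_derived_seq[OF solvable_subgroup[OF assms(2,1)]] by blast
  have "(derived G ^^ k) J = J" for k by (induction k) (simp_all add: assms(3))
  thus ?thesis using n by simp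
qed

text \<open>The column space of \<open>Y\<close> is the range of \<open>v \<mapsto> Yv\<close>, an invariant subspace.\<close>

lemma (in group) irreducible_rep_imp_matrix_rep:
  assumes "irreducible_rep G n \<rho>"
  shows "matrix_rep G (carrier G) n \<rho>" "irreducible_on (carrier G) n \<rho>"
proof -
  have hom: "\<rho> \<in> hom G (units_of (ring_mat TYPE(complex) n ()))"
    using assms by (simp add: irreducible_rep_def complex_rep_def)
  have c: "\<rho> x \<in> carrier_mat n n" if "x \<in> carrier G" for x
    using hom that by (auto simp: hom_def units_of_def Units_def ring_mat_def)
  have mult: "\<rho> (x \<otimes> y) = \<rho> x * \<rho> y" if "x \<in> carrier G" "y \<in> carrier G" for x y
    using hom that by (auto simp: hom_def units_of_def ring_mat_def)
  have "\<rho> \<one> = 1\<^sub>m n"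
  proof -
    have "\<rho> \<one> \<in> Units (ring_mat TYPE(complex) n ())" using hom by (auto simp: hom_def units_of_def)
    then obtain B where B: "B \<in> carrier_mat n n" "B * \<rho> \<one> = 1\<^sub>m n"
      by (auto simp: Units_def ring_mat_def)
    have "\<rho> \<one> = B * (\<rho> \<one> * \<rho> \<one>)"
      using mat_mult_inverse_cancel[OF B(2,1) c c] by simp
    also have "\<rho> \<one> * \<rho> \<one> = \<rho> \<one>" using mult[of \<one> \<one>] by simp
    finally show ?thesis using B by simp
  qed
  thus "matrix_rep G (carrier G) n \<rho>" using c mult by (simp add: matrix_rep_def)
  show "irreducible_on (carrier G) n \<rho>"
    unfolding irreducible_on_def
  proof (intro conjI allI impI)
    show "n > 0" using assms by (simp add: irreducible_rep_def)
    fix m Y S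
    assume Y: "Y \<in> carrier_mat n m" and S: "\<forall>h\<in>carrier G. S h \<in> carrier_mat m m \<and> \<rho> h * Y = Y * S h"
    define W where "W = (\<lambda>v. Y *\<^sub>v v) ` carrier_vec m"
    have sub: "VectorSpace.subspace class_ring W (module_vec TYPE(complex) n)"
    proof (rule VectorSpace.subspace.intro[OF vec_vs submodule.intro[OF vec_module]])
      show "W \<subseteq> carrier (module_vec TYPE(complex) n)" using Y by (auto simp: W_def module_vec_simps)
      show "\<zero>\<^bsub>module_vec TYPE(complex) n\<^esub> \<in> W"
        using Y by (auto simp: W_def module_vec_simps intro!: image_eqI[of _ _ "0\<^sub>v m"])
      fix v w :: "complex vec" assume "v \<in> W" "w \<in> W"
      then obtain a b where ab: "a \<in> carrier_vec m" "v = Y *\<^sub>v a" "b \<in> carrier_vec m" "w = Y *\<^sub>v b"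
        by (auto simp: W_def)
      have "v + w = Y *\<^sub>v (a + b)" using mult_add_distrib_mat_vec[OF Y ab(1,3)] ab by simp
      thus "v \<oplus>\<^bsub>module_vec TYPE(complex) n\<^esub> w \<in> W" using ab by (auto simp: W_def module_vec_simps)
    next
      fix c :: complex and v assume "v \<in> W"
      then obtain a where a: "a \<in> carrier_vec m" "v = Y *\<^sub>v a" by (auto simp: W_def)
      have "c \<cdot>\<^sub>v v = Y *\<^sub>v (c \<cdot>\<^sub>v a)" using mult_mat_vec[OF Y a(1), of c] a by simp
      thus "c \<odot>\<^bsub>module_vec TYPE(complex) n\<^esub> v \<in> W" using a by (auto simp: W_def module_vec_simps)
    qed
    have inv: "\<rho> h *\<^sub>v w \<in> W" if h: "h \<in> carrier G" and w: "w \<in> W" for h w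
    proof -
      obtain v where v: "v \<in> carrier_vec m" "w = Y *\<^sub>v v" using w by (auto simp: W_def)
      have Sh: "S h \<in> carrier_mat m m" "\<rho> h * Y = Y * S h" using S h by auto
      have "\<rho> h *\<^sub>v w = (\<rho> h * Y) *\<^sub>v v"
        unfolding v(2) by (rule assoc_mult_mat_vec[OF c[OF h] Y v(1), symmetric])
      also have "\<dots> = Y *\<^sub>v (S h *\<^sub>v v)"
        unfolding Sh(2) by (rule assoc_mult_mat_vec[OF Y Sh(1) v(1)])
      finally show ?thesis using Sh(1) v(1) by (auto simp: W_def)
    qed
    have "invariant_subspace G n \<rho> W" using sub inv by (simp add: invariant_subspace_def)
    hence "W = {0\<^sub>v n} \<or> W = carrier_vec n" using assms by (auto simp: irreducible_rep_def)
    thus "Y = 0\<^sub>m n m \<or> (\<exists>Z\<in>carrier_mat m n. Y * Z = 1\<^sub>m n)"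
    proof
      assume W0: "W = {0\<^sub>v n}"
      have "col Y j = 0\<^sub>v n" if j: "j < m" for j
      proof -
        have "Y *\<^sub>v unit_vec m j \<in> W" by (auto simp: W_def)
        moreover have "Y *\<^sub>v unit_vec m j = col Y j" using Y j by (intro eq_vecI) auto
        ultimately show ?thesis using W0 by simp
      qed
      hence "col Y j $ i = 0" if "i < n" "j < m" for i j using that by simp
      hence "Y = 0\<^sub>m n m" using Y by (intro eq_matI) auto
      thus ?thesis by simp
    next
      assume "W = carrier_vec n"
      hence "unit_vec n j \<in> W" for j by simp
      hence "\<forall>j. \<exists>v. v \<in> carrier_vec m \<and> Y *\<^sub>v v = unit_vec n j" unfolding W_def by (metis imageE)
      then obtain v where v: "\<And>j. v j \<in> carrier_vec m" "\<And>j. Y *\<^sub>v v j = unit_vec n j" by metis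
      define Z where "Z = mat m n (\<lambda>(i, j). v j $ i)"
      have "Z \<in> carrier_mat m n" by (simp add: Z_def)
      moreover have "Y * Z = 1\<^sub>m n"
      proof (rule eq_matI)
        fix i j assume ij: "i < dim_row (1\<^sub>m n :: complex mat)" "j < dim_col (1\<^sub>m n :: complex mat)"
        have "col Z j = v j" using v(1)[of j] ij by (intro eq_vecI) (auto simp: Z_def)
        hence "(Y * Z) $$ (i, j) = (Y *\<^sub>v v j) $ i" using Y ij by (simp add: Z_def)
        thus "(Y * Z) $$ (i, j) = 1\<^sub>m n $$ (i, j)" using v(2) ij by simp
      qed (use Y in \<open>auto simp: Z_def\<close>)
      ultimately show ?thesis by blast
    qed
  qed
qed

theorem theorem1p1:
  fixes G :: "('a, 'b) monoid_scheme" and \<chi> :: "'a \<Rightarrow> complex"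
  assumes "group G" and "finite (carrier G)" and "solvable G" and "\<chi> \<in> Irr G"
  shows "char_lambda G \<chi> \<ge> 1 / 2"
proof -
  interpret group G by fact
  obtain n \<rho> where \<chi>: "\<chi> = rep_character G \<rho>" and irr: "irreducible_rep G n \<rho>"
    using assms(4) by (auto simp: Irr_def)
  note \<rho> = irreducible_rep_imp_matrix_rep[OF irr]
  let ?A = "{g \<in> carrier G. \<chi> g = 0 \<or> is_root_of_unity (\<chi> g)}"
  have "half_zero_or_root \<one>\<^bsub>G\<^esub> (carrier G) \<rho>"
    using half_zero_or_root[OF assms(2) solvable_imp_no_perfect_subgroup[OF assms(3)]
      subgroup_self subgroup_self order_refl one_closed _ \<rho>] by simp
  moreover have "{k \<in> carrier G. zero_or_root (mat_trace (\<rho> (\<one>\<^bsub>G\<^esub> \<otimes>\<^bsub>G\<^esub> k)))} = ?A"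
    by (auto simp: \<chi> rep_character_def)
  ultimately have "card (carrier G) \<le> 2 * card ?A" by (simp add: half_zero_or_root_def)
  hence "real (card (carrier G)) \<le> 2 * real (card ?A)" by linarith
  moreover have "real (card (carrier G)) > 0"
    using assms(2) by (simp add: card_gt_0_iff) (use one_closed in blast)
  ultimately show ?thesis by (simp add: char_lambda_def field_simps)
qed

end
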